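(* Let $D_1\subset D_2\subset\cdots$ be sub-spaces of $L^2(T)$ with $\dim D_d=d$ and let $D=\overline{\bigcup_{d\ge1}D_d}$. Assume that (i) $\beta\in D\oplus S^\perp$ (equivalently, the orthogonal projection of $\beta$ on $S\cap D^\perp$ is $0$); (ii) $D\subseteq S$. For $d\ge k\ge1$ let $\widetilde\beta^{d,k}_n=\sum_{i=1}^k\langle\widehat\beta^{D_d}_n,\psi^d_i\rangle\psi^d_i$, where $\widehat\beta^{D_d}_n$ is the least square estimator in $D_d$ and $\psi^d_1,\dots,\psi^d_d$ is the Karhunen–Loève basis of $X$ projected on $D_d$. Let $\beta^D$ and $\beta^{S^\perp}$ be the orthogonal projections of $\beta$ on $D$ and on $S^\perp$. Then there exists a sequence of integers $k_d\to\infty$ with $k_d\le d$ such that: (1) for each $d$ the almost sure limit $\lim_{n\to\infty}\widetilde\beta^{d,k_d}_n$ exists in $L^2(T)$, and the sequence $\left\{\lim_{n\to\infty}\widetilde\beta^{d,k_d}_n;\,d\ge1\right\}$ converges in $L^2(T)$ to $\beta^D$ as $d\to\infty$; moreover $\|\gamma^{d,k_d}\|\to0$ as $d\to\infty$, where $\gamma^{d,k}=\sum_{i=1}^k\langle\gamma^d,\psi^d_i\rangle\psi^d_i$ and $\gamma^d\in D_d$ is the asymptotic bias on $D_d$, defined in the context; (2) there exists a sequence of positive integers $\{d_n;n\ge1\}$ such that, with $d=d_n$ and $k=k_{d_n}$, $$\widetilde\beta^{d,k}_n\to\beta^D\quad\text{almost surely as }n\to\infty,$$ that is, $\|\widetilde\beta^{d,k}_n-\beta\|\to\|\beta^{S^\perp}\|$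 almost surely; in particular, if $\beta\in D$, then $\|\widetilde\beta^{d,k}_n-\beta\|\to0$ almost surely.
   Context: $T\subset\mathbb{R}$ is compact, $\langle a,b\rangle=\int_T a(t)b(t)\,dt$ is the inner product of $L^2(T)$ and $\|\cdot\|$ its norm. The model is $y_i=\langle x_i,\beta\rangle+\epsilon_i$, where $\beta\in L^2(T)$ is deterministic, $x_1,x_2,\dots$ are i.i.d. copies of an $L^2(T)$-valued random element $X$ with $\mathbb{E}[X]=0$ and $\mathbb{E}\|X\|^2<\infty$, and $\epsilon_1,\epsilon_2,\dots$ are mutually independent real random variables, independent of the $x_i$, with $\mathbb{E}[\epsilon_i]=0$ and $\mathrm{Var}[\epsilon_i]=\sigma^2>0$. $S$ is the smallest closed linear sub-space of $L^2(T)$ containing the support of the law of $X$; $S^\perp$ is its orthogonal complement. $\widehat\beta^{D_d}_n=\arg\min_{b\in D_d}\sum_{i=1}^n(y_i-\langle x_i,b\rangle)^2$; since $D_d\subseteq S$, for each fixed $d$ it is almost surely uniquely defined for all sufficiently large $n$, and convergence statements refer to such $n$. The Karhunen–Loève basis $\psi^d_1,\dots,\psi^d_d$ of $X$ projected on $D_d$ is an orthonormal basis of $D_d$ made of eigenfunctions of the covariance operator of the orthogonal projection of $X$ on $D_d$, ordered by non-increasing eigenvalues $\lambda^d_i=\mathrm{Var}[\langle X,\psi^d_i\rangle]$ (fixed once for each $d$). The asymptotic bias is $\gamma^d=\sum_{i=1}^d\delta^d_i\psi^d_i$ with $\delta^d_i=\mathrm{Cov}\left(\langle X,\psi^d_i\rangle,\langle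 X,\beta^{F_d}\rangle\right)/\mathrm{Var}[\langle X,\psi^d_i\rangle]$, where $F_d=S\cap D_d^\perp$ and $\beta^{F_d}$ is the orthogonal projection of $\beta$ on $F_d$. *)

theory Defs
  imports "HOL-Probability.Probability"
begin

section \<open>The Hilbert space of square-integrable functions\<close>

definition square_integrable :: "(real \<Rightarrow> real) \<Rightarrow> bool" where
  "square_integrable f \<longleftrightarrow> f \<in> borel_measurable lborel \<and> integrable lborel (\<lambda>t. (f t)\<^sup>2)"

lemma square_integrable_measurable: "square_integrable f \<Longrightarrow> f \<in> borel_measurable lborel"
  by (simp add: square_integrable_def)

lemma square_integrable_square: "square_integrable f \<Longrightarrow> integrable lborel (\<lambda>t. (f t)\<^sup>2)"
  by (simp add: square_integrable_def)

lemma square_integrable_mult: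
  assumes "square_integrable f" "square_integrable g"
  shows "integrable lborel (\<lambda>t. f t * g t)"
proof (rule Bochner_Integration.integrable_bound)
  show "integrable lborel (\<lambda>t. (f t)\<^sup>2 + (g t)\<^sup>2)"
    using assms by (auto simp: square_integrable_def)
  show "(\<lambda>t. f t * g t) \<in> borel_measurable lborel"
    using assms by (auto simp: square_integrable_def)
  have "\<bar>a * b\<bar> \<le> a\<^sup>2 + b\<^sup>2" for a b :: real
  proof -
    have "0 \<le> (\<bar>a\<bar> - \<bar>b\<bar>)\<^sup>2" by simp
    then have "2 * (\<bar>a\<bar> * \<bar>b\<bar>) \<le> a\<^sup>2 + b\<^sup>2" by (simp add: power2_diff)
    moreover have "0 \<le> \<bar>a\<bar> * \<bar>b\<bar>" by simp
    ultimately show ?thesis unfolding abs_mult by linarith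
  qed
  then show "AE t in lborel. norm (f t * g t) \<le> norm ((f t)\<^sup>2 + (g t)\<^sup>2)"
    by auto
qed

lemma square_integrable_zero: "square_integrable (\<lambda>t. 0)"
  by (simp add: square_integrable_def)

lemma square_integrable_scale: "square_integrable f \<Longrightarrow> square_integrable (\<lambda>t. c * f t)"
  by (auto simp: square_integrable_def power_mult_distrib)

lemma square_integrable_add:
  assumes "square_integrable f" "square_integrable g"
  shows "square_integrable (\<lambda>t. f t + g t)"
  using assms square_integrable_mult[OF assms]
  by (auto simp: square_integrable_def power2_sum mult.assoc)

lemma square_integrable_uminus: "square_integrable f \<Longrightarrow> square_integrable (\<lambda>t. - f t)"
  by (simp add: square_integrable_def)

lemma square_integrable_diff:
  "square_integrable f \<Longrightarrow> square_integrable g \<Longrightarrow> square_integrable (\<lambda>t. f t - g t)"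
  using square_integrable_add[of f "\<lambda>t. - g t"] square_integrable_uminus[of g] by simp

definition L2_rel :: "(real \<Rightarrow> real) \<Rightarrow> (real \<Rightarrow> real) \<Rightarrow> bool" where
  "L2_rel f g \<longleftrightarrow> square_integrable f \<and> square_integrable g \<and> (AE t in lborel. f t = g t)"

text \<open>The space of (classes of) square-integrable functions on the whole line. The space over a
  set \<open>T\<close> depends on a value and so is not a type of its own; it is the closed subspace
  \<open>L2_on T\<close> below, with functions on \<open>T\<close> extended by zero.\<close>

quotient_type L2 = "real \<Rightarrow> real" / partial: L2_rel
proof (rule part_equivpI)
  show "\<exists>f. L2_rel f f"
    using square_integrable_zero by (auto simp: L2_rel_def)
  show "symp L2_rel"
    by (auto simp: symp_def L2_rel_def)
  show "transp L2_rel"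
    unfolding transp_def L2_rel_def
  proof (intro allI impI conjI; (elim conjE)?)
    fix f g h :: "real \<Rightarrow> real"
    assume "AE t in lborel. f t = g t" "AE t in lborel. g t = h t"
    then show "AE t in lborel. f t = h t" by eventually_elim simp
  qed
qed

instantiation L2 :: real_vector
begin

lift_definition zero_L2 :: L2 is "\<lambda>t. 0"
  by (simp add: L2_rel_def square_integrable_zero)

lift_definition plus_L2 :: "L2 \<Rightarrow> L2 \<Rightarrow> L2" is "\<lambda>f g t. f t + g t"
  by (auto simp: L2_rel_def intro: square_integrable_add)

lift_definition uminus_L2 :: "L2 \<Rightarrow> L2" is "\<lambda>f t. - f t"
  by (auto simp: L2_rel_def intro: square_integrable_uminus)

lift_definition minus_L2 :: "L2 \<Rightarrow> L2 \<Rightarrow> L2" is "\<lambda>f g t. f t - g t"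
  by (auto simp: L2_rel_def intro: square_integrable_diff)

lift_definition scaleR_L2 :: "real \<Rightarrow> L2 \<Rightarrow> L2" is "\<lambda>c f t. c * f t"
  by (auto simp: L2_rel_def intro: square_integrable_scale)

instance
proof
  fix f g h :: L2 and a b :: real
  show "f + g + h = f + (g + h)"
    by transfer (auto simp: L2_rel_def add.assoc intro: square_integrable_add)
  show "f + g = g + f"
    by transfer (auto simp: L2_rel_def add.commute intro: square_integrable_add)
  show "0 + f = f"
    by transfer (auto simp: L2_rel_def)
  show "- f + f = 0"
    by transfer (auto simp: L2_rel_def square_integrable_zero)
  show "f - g = f + - g"
    by transfer (auto simp: L2_rel_def intro: square_integrable_diff)
  show "a *\<^sub>R (f + g) = a *\<^sub>R f + a *\<^sub>R g"
    by transfer (auto simp: L2_rel_def algebra_simps intro: square_integrable_add square_integrable_scale)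
  show "(a + b) *\<^sub>R f = a *\<^sub>R f + b *\<^sub>R f"
    by transfer (auto simp: L2_rel_def algebra_simps intro: square_integrable_add square_integrable_scale)
  show "a *\<^sub>R b *\<^sub>R f = (a * b) *\<^sub>R f"
    by transfer (auto simp: L2_rel_def mult.assoc intro!: square_integrable_scale)
  show "1 *\<^sub>R f = f"
    by transfer (auto simp: L2_rel_def)
qed

end

instantiation L2 :: real_inner
begin

lift_definition inner_L2 :: "L2 \<Rightarrow> L2 \<Rightarrow> real" is "\<lambda>f g. LINT t|lborel. f t * g t"
  unfolding L2_rel_def
  by (intro integral_cong_AE) (auto simp: square_integrable_def)

definition norm_L2 :: "L2 \<Rightarrow> real" where "norm_L2 f = sqrt (inner f f)"

definition dist_L2 :: "L2 \<Rightarrow> L2 \<Rightarrow> real" where "dist_L2 f g = norm (f - g)"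

definition sgn_L2 :: "L2 \<Rightarrow> L2" where "sgn_L2 f = f /\<^sub>R norm f"

definition uniformity_L2 :: "(L2 \<times> L2) filter" where
  "uniformity_L2 = (INF e\<in>{0<..}. principal {(f, g). dist f g < e})"

definition open_L2 :: "L2 set \<Rightarrow> bool" where
  "open_L2 U \<longleftrightarrow> (\<forall>f\<in>U. \<forall>\<^sub>F (f', g) in uniformity. f' = f \<longrightarrow> g \<in> U)"

instance
proof
  fix f g h :: L2 and a :: real
  show "dist f g = norm (f - g)"
    by (fact dist_L2_def)
  show "sgn f = f /\<^sub>R norm f"
    by (fact sgn_L2_def)
  show "(uniformity :: (L2 \<times> L2) filter) = (INF e\<in>{0<..}. principal {(f, g). dist f g < e})"
    by (fact uniformity_L2_def)
  show "open U \<longleftrightarrow> (\<forall>f\<in>U. \<forall>\<^sub>F (f', g) in uniformity. f' = f \<longrightarrow> g \<in> U)" for U :: "L2 set"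
    by (fact open_L2_def)
  show "inner f g = inner g f"
    by transfer (simp add: mult.commute)
  show "inner (f + g) h = inner f h + inner g h"
    by transfer (auto simp: L2_rel_def algebra_simps square_integrable_mult)
  show "inner (a *\<^sub>R f) g = a * inner f g"
    by transfer (auto simp: mult.assoc)
  show "0 \<le> inner f f"
    by transfer simp
  show "inner f f = 0 \<longleftrightarrow> f = 0"
  proof transfer
    fix f assume "L2_rel f f"
    then have f: "square_integrable f" by (simp add: L2_rel_def)
    then have "(LINT t|lborel. f t * f t) = 0 \<longleftrightarrow> (AE t in lborel. f t * f t = 0)"
      by (intro integral_nonneg_eq_0_iff_AE) (auto simp: square_integrable_mult)
    then show "(LINT t|lborel. f t * f t) = 0 \<longleftrightarrow> L2_rel f (\<lambda>t. 0)"
      using f by (simp add: L2_rel_def square_integrable_zero)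
  qed
  show "norm f = sqrt (inner f f)"
    by (fact norm_L2_def)
qed

end

lemma square_integrable_rep: "square_integrable (rep_L2 f)"
  using Quotient3_rep_reflp[OF Quotient3_L2, of f] by (simp add: L2_rel_def)

lemma abs_rep_L2: "abs_L2 (rep_L2 f) = f"
  by (rule Quotient3_abs_rep[OF Quotient3_L2])

lemma rep_abs_L2: "square_integrable f \<Longrightarrow> AE t in lborel. rep_L2 (abs_L2 f) t = f t"
  using rep_abs_rsp_left[OF Quotient3_L2, of f f] by (simp add: L2_rel_def)

lemma abs_L2_eqI:
  "square_integrable f \<Longrightarrow> square_integrable g \<Longrightarrow> AE t in lborel. f t = g t \<Longrightarrow> abs_L2 f = abs_L2 g"
  by (intro Quotient3_rel_abs[OF Quotient3_L2]) (simp add: L2_rel_def)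

lemma inner_L2_eq: "inner f g = (LINT t|lborel. rep_L2 f t * rep_L2 g t)"
  by (simp add: inner_L2_def)

lemma norm_L2_eq: "norm f = sqrt (LINT t|lborel. (rep_L2 f t)\<^sup>2)" for f :: L2
  by (simp add: norm_L2_def inner_L2_eq power2_eq_square)

lemma minus_abs_L2:
  "square_integrable f \<Longrightarrow> square_integrable g \<Longrightarrow> abs_L2 f - abs_L2 g = abs_L2 (\<lambda>t. f t - g t)"
  by (rule minus_L2.abs_eq) (auto simp: eq_onp_def L2_rel_def)

lemma plus_abs_L2:
  "square_integrable f \<Longrightarrow> square_integrable g \<Longrightarrow> abs_L2 f + abs_L2 g = abs_L2 (\<lambda>t. f t + g t)"
  by (rule plus_L2.abs_eq) (auto simp: eq_onp_def L2_rel_def)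

lemma scaleR_abs_L2: "square_integrable f \<Longrightarrow> c *\<^sub>R abs_L2 f = abs_L2 (\<lambda>t. c * f t)"
  by (rule scaleR_L2.abs_eq) (auto simp: eq_onp_def L2_rel_def)

lemma norm_abs_L2: "square_integrable f \<Longrightarrow> norm (abs_L2 f) = sqrt (LINT t|lborel. (f t)\<^sup>2)"
  unfolding norm_L2_eq
  using rep_abs_L2[of f] square_integrable_measurable[OF square_integrable_rep, of "abs_L2 f"]
  by (intro arg_cong[of _ _ sqrt] integral_cong_AE) (auto simp: square_integrable_def)

definition L2_on :: "real set \<Rightarrow> L2 set" where
  "L2_on T = {f. AE t in lborel. t \<notin> T \<longrightarrow> rep_L2 f t = 0}"

lemma inner_L2_on:
  assumes "f \<in> L2_on T" and "T \<in> sets borel"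
  shows "inner f g = (LINT t:T|lborel. rep_L2 f t * rep_L2 g t)"
  unfolding inner_L2_eq set_lebesgue_integral_def
proof (rule integral_cong_AE)
  show "(\<lambda>t. rep_L2 f t * rep_L2 g t) \<in> borel_measurable lborel"
    using square_integrable_measurable[OF square_integrable_rep] by (intro borel_measurable_times)
  then show "(\<lambda>t. indicat_real T t *\<^sub>R (rep_L2 f t * rep_L2 g t)) \<in> borel_measurable lborel"
    using assms(2) by (intro borel_measurable_scaleR borel_measurable_indicator) auto
  show "AE t in lborel. rep_L2 f t * rep_L2 g t = indicat_real T t *\<^sub>R (rep_L2 f t * rep_L2 g t)"
    using assms(1) unfolding L2_on_def by (auto simp: indicator_def)
qed

lemma L2_dominated:
  assumes sq: "\<And>i. square_integrable (s i)" "square_integrable f" "square_integrable w"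
    and lim: "AE t in lborel. (\<lambda>i. s i t) \<longlonglongrightarrow> f t"
    and bnd: "\<And>i. AE t in lborel. \<bar>s i t - f t\<bar> \<le> w t"
  shows "(\<lambda>i. abs_L2 (s i)) \<longlonglongrightarrow> abs_L2 f"
proof -
  have "(\<lambda>i. LINT t|lborel. (s i t - f t)\<^sup>2) \<longlonglongrightarrow> (LINT (t::real)|lborel. (0 :: real))"
  proof (rule integral_dominated_convergence[where w = "\<lambda>t. (w t)\<^sup>2"])
    show "(\<lambda>t. 0::real) \<in> borel_measurable lborel" by simp
    show "(\<lambda>t. (s i t - f t)\<^sup>2) \<in> borel_measurable lborel" for i
      using square_integrable_measurable[OF sq(1)] square_integrable_measurable[OF sq(2)]
      by (intro borel_measurable_power borel_measurable_diff)
    show "integrable lborel (\<lambda>t. (w t)\<^sup>2)"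
      using sq(3) by (simp add: square_integrable_def)
    show "AE t in lborel. (\<lambda>i. (s i t - f t)\<^sup>2) \<longlonglongrightarrow> 0"
      using lim
    proof eventually_elim
      case (elim t)
      have "(\<lambda>i. (s i t - f t)\<^sup>2) \<longlonglongrightarrow> (f t - f t)\<^sup>2"
        by (intro tendsto_intros elim)
      then show ?case by simp
    qed
    show "AE t in lborel. norm ((s i t - f t)\<^sup>2) \<le> (w t)\<^sup>2" for i
      using bnd[of i]
    proof eventually_elim
      case (elim t)
      then have "\<bar>s i t - f t\<bar>\<^sup>2 \<le> (w t)\<^sup>2" by (intro power_mono) auto
      then show ?case by simp
    qed
  qed
  then have "(\<lambda>i. sqrt (LINT t|lborel. (s i t - f t)\<^sup>2)) \<longlonglongrightarrow> sqrt 0"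
    by (intro tendsto_real_sqrt) simp
  moreover have "norm (abs_L2 (s i) - abs_L2 f) = sqrt (LINT t|lborel. (s i t - f t)\<^sup>2)" for i
    using sq by (simp add: minus_abs_L2 norm_abs_L2 square_integrable_diff)
  ultimately have "(\<lambda>i. norm (abs_L2 (s i) - abs_L2 f)) \<longlonglongrightarrow> 0"
    by simp
  then show ?thesis
    using LIM_zero_cancel tendsto_norm_zero_iff by blast
qed

instance L2 :: complete_space
proof
  fix X :: "nat \<Rightarrow> L2" assume X: "Cauchy X"
  have "\<exists>r. strict_mono r \<and> (\<forall>n. norm (X (r (Suc n)) - X (r n)) \<le> (1/2)^n)"
  proof -
    have "\<exists>N. \<forall>m\<ge>N. \<forall>n\<ge>N. norm (X m - X n) < (1/2)^k" for k
      using X unfolding Cauchy_iff by (meson zero_less_power half_gt_zero zero_less_one)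
    then obtain N where N: "\<And>k m n. m \<ge> N k \<Longrightarrow> n \<ge> N k \<Longrightarrow> norm (X m - X n) < (1/2)^k"
      by metis
    define r where "r = rec_nat (N 0) (\<lambda>k q. max (Suc q) (N (Suc k)))"
    have r_Suc: "r (Suc k) = max (Suc (r k)) (N (Suc k))" for k by (simp add: r_def)
    have "strict_mono r" by (auto simp: strict_mono_Suc_iff r_Suc)
    moreover have ge: "r k \<ge> N k" for k by (cases k) (auto simp: r_Suc, simp add: r_def)
    have "norm (X (r (Suc k)) - X (r k)) \<le> (1/2)^k" for k
      using ge[of k] r_Suc[of k] by (intro less_imp_le[OF N]) auto
    ultimately show ?thesis by blast
  qed
  then obtain r where r: "strict_mono r" and
    close: "\<And>n. norm (X (r (Suc n)) - X (r n)) \<le> (1/2)^n" by blast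
  define f where "f n = rep_L2 (X (r n))" for n
  have f: "square_integrable (f n)" for n
    by (simp add: f_def square_integrable_rep)
  have abs_f: "abs_L2 (f n) = X (r n)" for n
    by (simp add: f_def abs_rep_L2)
  have f_meas [measurable]: "f n \<in> borel_measurable lborel" for n
    using f square_integrable_measurable by blast
  define g where "g N t = (\<Sum>n<N. \<bar>f (Suc n) t - f n t\<bar>)" for N t
  have g_nonneg: "0 \<le> g N t" for N t by (simp add: g_def sum_nonneg)
  have g: "square_integrable (g N) \<and> norm (abs_L2 (g N)) \<le> 2 - 2 * (1/2)^N" for N
  proof (induction N)
    case 0
    have "abs_L2 (\<lambda>t. 0) = 0" by (simp add: zero_L2_def)
    then show ?case by (simp add: g_def square_integrable_zero)
  next
    case (Suc N)
    have sq: "square_integrable (\<lambda>t. \<bar>f (Suc N) t - f N t\<bar>)"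
      using square_integrable_diff[OF f f, of "Suc N" N] by (auto simp: square_integrable_def)
    have eq: "g (Suc N) = (\<lambda>t. g N t + \<bar>f (Suc N) t - f N t\<bar>)"
      by (auto simp: g_def)
    have "norm (abs_L2 (\<lambda>t. \<bar>f (Suc N) t - f N t\<bar>)) = norm (abs_L2 (f (Suc N)) - abs_L2 (f N))"
      using sq f by (simp add: norm_abs_L2 minus_abs_L2 square_integrable_diff)
    also have "\<dots> \<le> (1/2)^N" using close by (simp add: abs_f)
    finally have "norm (abs_L2 (g N) + abs_L2 (\<lambda>t. \<bar>f (Suc N) t - f N t\<bar>)) \<le> 2 - 2 * (1/2)^N + (1/2)^N"
      using Suc.IH norm_triangle_ineq[of "abs_L2 (g N)" "abs_L2 (\<lambda>t. \<bar>f (Suc N) t - f N t\<bar>)"]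
      by linarith
    then show ?case
      using Suc.IH sq by (simp add: eq plus_abs_L2 square_integrable_add)
  qed
  have g_meas [measurable]: "g N \<in> borel_measurable lborel" for N
    using g square_integrable_measurable by blast
  have g_bound: "(LINT t|lborel. (g N t)\<^sup>2) \<le> 4" for N
  proof -
    have "norm (abs_L2 (g N)) \<le> 2" using g[of N] zero_le_power[of "1/2::real" N] by linarith
    then have "sqrt (LINT t|lborel. (g N t)\<^sup>2) \<le> sqrt 4"
      using g[of N] by (simp add: norm_abs_L2)
    then show ?thesis by (simp only: real_sqrt_le_iff)
  qed
  have g_mono: "mono (\<lambda>N. g N t)" for t
    unfolding mono_iff_le_Suc by (simp add: g_def)
  have bound: "(\<integral>\<^sup>+t. (SUP N. ennreal ((g N t)\<^sup>2)) \<partial>lborel) \<le> 4"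
  proof -
    have "(\<integral>\<^sup>+t. (SUP N. ennreal ((g N t)\<^sup>2)) \<partial>lborel) = (SUP N. \<integral>\<^sup>+t. ennreal ((g N t)\<^sup>2) \<partial>lborel)"
    proof (rule nn_integral_monotone_convergence_SUP)
      show "incseq (\<lambda>N t. ennreal ((g N t)\<^sup>2))"
        unfolding incseq_def le_fun_def
        using g_mono by (auto intro!: ennreal_leI power_mono g_nonneg simp: mono_def)
    qed simp
    also have "\<dots> \<le> 4"
    proof (rule SUP_least)
      fix N
      have "(\<integral>\<^sup>+t. ennreal ((g N t)\<^sup>2) \<partial>lborel) = ennreal (LINT t|lborel. (g N t)\<^sup>2)"
        using g[of N] by (intro nn_integral_eq_integral) (auto simp: square_integrable_def)
      also have "\<dots> \<le> ennreal 4" by (intro ennreal_leI g_bound)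
      finally show "(\<integral>\<^sup>+t. ennreal ((g N t)\<^sup>2) \<partial>lborel) \<le> 4" by simp
    qed
    finally show ?thesis .
  qed
  define G where "G t = (SUP N. ennreal ((g N t)\<^sup>2))" for t
  have G_meas [measurable]: "G \<in> borel_measurable lborel"
    unfolding G_def by measurable
  have int_G: "(\<integral>\<^sup>+t. G t \<partial>lborel) < \<infinity>"
    unfolding G_def infinity_ennreal_def by (rule le_less_trans[OF bound]) simp
  then have AE_fin: "AE t in lborel. G t \<noteq> \<infinity>"
    by (intro nn_integral_noteq_infinite) (auto simp: less_top)
  define h where "h t = sqrt (enn2real (G t))" for t
  have h_meas [measurable]: "h \<in> borel_measurable lborel"
    unfolding h_def by measurable
  have h_sq: "AE t in lborel. ennreal ((h t)\<^sup>2) = G t"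
    using AE_fin
  proof eventually_elim
    case (elim t)
    then show ?case by (simp add: h_def less_top)
  qed
  have h: "square_integrable h"
    unfolding square_integrable_def
  proof
    show "integrable lborel (\<lambda>t. (h t)\<^sup>2)"
    proof (rule integrableI_nonneg)
      show "(\<integral>\<^sup>+t. ennreal ((h t)\<^sup>2) \<partial>lborel) < \<infinity>"
        using int_G nn_integral_cong_AE[OF h_sq] by simp
    qed auto
  qed measurable
  have AE_le: "AE t in lborel. \<forall>N. g N t \<le> h t"
    using h_sq
  proof eventually_elim
    case (elim t)
    show ?case
    proof
      fix N
      have "ennreal ((g N t)\<^sup>2) \<le> ennreal ((h t)\<^sup>2)"
        unfolding elim G_def by (rule SUP_upper) simp
      then have "(g N t)\<^sup>2 \<le> (h t)\<^sup>2" by simp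
      then show "g N t \<le> h t"
        by (rule power2_le_imp_le) (simp add: h_def)
    qed
  qed
  define F where "F t = lim (\<lambda>n. f n t)" for t
  have F_meas [measurable]: "F \<in> borel_measurable lborel"
    unfolding F_def by measurable
  have diff_le: "\<bar>f m t - f n t\<bar> \<le> g m t" if "n \<le> m" for m n t
  proof -
    have "f m t - f n t = (\<Sum>i=n..<m. f (Suc i) t - f i t)"
      using sum_Suc_diff'[OF that, of "\<lambda>i. f i t"] by simp
    then have "\<bar>f m t - f n t\<bar> \<le> (\<Sum>i=n..<m. \<bar>f (Suc i) t - f i t\<bar>)" by simp
    also have "\<dots> \<le> g m t" unfolding g_def by (intro sum_mono2) auto
    finally show ?thesis .
  qed
  have AE_lim: "AE t in lborel. (\<lambda>n. f n t) \<longlonglongrightarrow> F t"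
    using AE_le
  proof eventually_elim
    case (elim t)
    define a where "a n = f (Suc n) t - f n t" for n
    have "summable (\<lambda>n. \<bar>a n\<bar>)"
      by (rule summableI_nonneg_bounded[where x = "h t"])
         (use elim in \<open>auto simp: g_def a_def\<close>)
    then have "summable a"
      by (rule summable_rabs_cancel)
    then have "(\<lambda>N. f 0 t + (\<Sum>n<N. a n)) \<longlonglongrightarrow> f 0 t + suminf a"
      by (intro tendsto_add tendsto_const summable_LIMSEQ)
    moreover have "f 0 t + (\<Sum>n<N. a n) = f N t" for N
      by (induction N) (simp_all add: a_def)
    ultimately show ?case
      by (simp add: F_def limI)
  qed
  have AE_bnd: "AE t in lborel. \<bar>f n t - F t\<bar> \<le> h t" for n
    using AE_lim AE_le
  proof eventually_elim
    case (elim t)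
    have "(\<lambda>m. \<bar>f n t - f m t\<bar>) \<longlonglongrightarrow> \<bar>f n t - F t\<bar>"
      by (intro tendsto_intros elim)
    then show ?case
    proof (rule Lim_bounded[where M = n], intro allI impI)
      fix m assume "n \<le> m"
      then show "\<bar>f n t - f m t\<bar> \<le> h t"
        using diff_le[of n m t] elim(2) by (metis abs_minus_commute order_trans)
    qed
  qed
  have F: "square_integrable F"
  proof -
    have "square_integrable (\<lambda>t. f 0 t - F t)"
      unfolding square_integrable_def
    proof
      show "integrable lborel (\<lambda>t. (f 0 t - F t)\<^sup>2)"
      proof (rule Bochner_Integration.integrable_bound)
        show "integrable lborel (\<lambda>t. (h t)\<^sup>2)" by (rule square_integrable_square[OF h])
        show "AE t in lborel. norm ((f 0 t - F t)\<^sup>2) \<le> norm ((h t)\<^sup>2)"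
          using AE_bnd[of 0]
        proof eventually_elim
          case (elim t)
          then have "\<bar>f 0 t - F t\<bar>\<^sup>2 \<le> (h t)\<^sup>2" by (intro power_mono) auto
          then show ?case by simp
        qed
      qed measurable
    qed measurable
    from square_integrable_diff[OF f[of 0] this] show ?thesis by simp
  qed
  have "(\<lambda>n. abs_L2 (f n)) \<longlonglongrightarrow> abs_L2 F"
    by (rule L2_dominated[OF f F h AE_lim AE_bnd])
  then have "(X \<circ> r) \<longlonglongrightarrow> abs_L2 F" by (simp add: abs_f comp_def)
  then have "\<exists>l. (X \<circ> r) \<longlonglongrightarrow> l" by blast
  moreover have "X \<longlonglongrightarrow> l" if "(X \<circ> r) \<longlonglongrightarrow> l" for l
    using X r that by (rule Cauchy_converges_subseq)
  ultimately show "convergent X"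
    by (auto simp: convergent_def)
qed

instance L2 :: banach ..

lemma second_countable_from_dense:
  fixes Q :: "'a :: metric_space set"
  assumes "countable Q" and "closure Q = UNIV"
  shows "\<exists>B :: 'a set set. countable B \<and> open = generate_topology B"
proof -
  define B where "B = (\<lambda>(q, n). ball q (1 / real (Suc n))) ` (Q \<times> UNIV)"
  have "countable B"
    unfolding B_def using assms(1) by (intro countable_image countable_SIGMA) auto
  moreover have "topological_basis B"
  proof (rule topological_basisI)
    show "open U" if "U \<in> B" for U
      using that by (auto simp: B_def)
    fix U and x :: 'a assume "open U" "x \<in> U"
    then obtain e where e: "e > 0" "ball x e \<subseteq> U" by (meson openE)
    obtain n where n: "1 / real (Suc n) < e / 2"
      using e(1) by (metis half_gt_zero inverse_eq_divide reals_Archimedean)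
    have "x \<in> closure Q" using assms(2) by simp
    then obtain q where q: "q \<in> Q" "dist q x < 1 / real (Suc n)"
      unfolding closure_approachable by (metis of_nat_0_less_iff zero_less_Suc zero_less_divide_1_iff)
    have "ball q (1 / real (Suc n)) \<subseteq> ball x e"
    proof
      fix z assume "z \<in> ball q (1 / real (Suc n))"
      then have "dist q z < e / 2" "dist q x < e / 2" using n q by auto
      then show "z \<in> ball x e"
        using dist_triangle3[of x z q] by (simp add: dist_commute)
    qed
    then show "\<exists>B'\<in>B. x \<in> B' \<and> B' \<subseteq> U"
      using q e(2) by (intro bexI[of _ "ball q (1 / real (Suc n))"]) (auto simp: B_def dist_commute)
  qed
  ultimately show ?thesis
    using topological_basis_imp_subbasis by blast
qed

lemma subspace_closure:
  fixes V :: "'a :: real_normed_vector set"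
  assumes "subspace V"
  shows "subspace (closure V)"
  unfolding subspace_def
proof (intro conjI ballI allI)
  show "0 \<in> closure V"
    using subspace_0[OF assms] closure_subset by blast
next
  fix x y assume "x \<in> closure V" "y \<in> closure V"
  then obtain u v where "\<And>n. u n \<in> V" "u \<longlonglongrightarrow> x" "\<And>n. v n \<in> V" "v \<longlonglongrightarrow> y"
    unfolding closure_sequential by blast
  then have "\<And>n. u n + v n \<in> V" "(\<lambda>n. u n + v n) \<longlonglongrightarrow> x + y"
    by (auto intro: tendsto_add subspace_add[OF assms])
  then show "x + y \<in> closure V"
    unfolding closure_sequential by (intro exI[of _ "\<lambda>n. u n + v n"]) blast
next
  fix c x assume "x \<in> closure V"
  then obtain u where "\<And>n. u n \<in> V" "u \<longlonglongrightarrow> x"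
    unfolding closure_sequential by blast
  then have "\<And>n. c *\<^sub>R u n \<in> V" "(\<lambda>n. c *\<^sub>R u n) \<longlonglongrightarrow> c *\<^sub>R x"
    by (auto intro: tendsto_scaleR subspace_scale[OF assms])
  then show "c *\<^sub>R x \<in> closure V"
    unfolding closure_sequential by (intro exI[of _ "\<lambda>n. c *\<^sub>R u n"]) blast
qed

lemma borel_eq_rat_atMost: "borel = sigma UNIV (range (\<lambda>q. {..real_of_rat q}))"
proof (rule borel_eq_sigmaI1[OF borel_eq_atMost])
  fix X :: "real set" assume "X \<in> range atMost"
  then obtain a where X: "X = {..a}" by auto
  have "{..a} = (\<Inter>q \<in> {q. a \<le> real_of_rat q}. {..real_of_rat q})"
  proof (intro equalityI subsetI)
    fix z assume z: "z \<in> (\<Inter>q \<in> {q. a \<le> real_of_rat q}. {..real_of_rat q})"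
    show "z \<in> {..a}"
    proof (rule ccontr)
      assume "z \<notin> {..a}"
      then obtain q where q: "a < real_of_rat q" "real_of_rat q < z"
        using of_rat_dense[of a z] by auto
      have "z \<in> {..real_of_rat q}"
        by (rule INT_D[OF z]) (use q in simp)
      with q show False by simp
    qed
  qed auto
  also have "\<dots> \<in> sets (sigma UNIV (range (\<lambda>q. {..real_of_rat q})))"
  proof (rule sets.countable_INT'')
    show "UNIV \<in> sets (sigma UNIV (range (\<lambda>q. {..real_of_rat q})))"
      using sets.top[of "sigma UNIV (range (\<lambda>q. {..real_of_rat q}))"] by simp
  qed auto
  finally show "X \<in> sets (sigma UNIV (range (\<lambda>q. {..real_of_rat q})))"
    by (simp add: X)
qed auto

lemma square_integrable_indicator:
  assumes "A \<in> sets borel"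
  shows "square_integrable (indicat_real (A \<inter> {- real n..real n}))"
proof -
  have "emeasure lborel (A \<inter> {- real n..real n}) \<le> emeasure lborel {- real n..real n}"
    using assms by (intro emeasure_mono) auto
  also have "\<dots> < \<infinity>" by simp
  finally have "integrable lborel (indicat_real (A \<inter> {- real n..real n}))"
    using assms by (intro integrable_real_indicator) auto
  moreover have "(\<lambda>t. (indicat_real (A \<inter> {- real n..real n}) t)\<^sup>2) = indicat_real (A \<inter> {- real n..real n})"
    by (auto simp: indicator_def)
  ultimately show ?thesis
    using assms by (simp add: square_integrable_def)
qed

instance L2 :: second_countable_topology
proof
  define I where "I n = {- real n..real n}" for n
  define J where "J A n = abs_L2 (indicat_real (A \<inter> I n))" for A n
  define B where "B = (\<lambda>(q, n). J {..real_of_rat q} n) ` UNIV"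
  define V where "V = closure (span B)"
  have "countable B" unfolding B_def by (intro countable_image) auto
  have V: "subspace V" "closed V" unfolding V_def by (auto intro: subspace_closure subspace_span)
  have sq: "square_integrable (indicat_real (A \<inter> I n))" if "A \<in> sets borel" for A n
    using square_integrable_indicator[OF that] by (simp add: I_def)
  have J_V: "J A n \<in> V" if "A \<in> sets borel" for A n
  proof -
    let ?G = "range (\<lambda>q. {..real_of_rat q})"
    have borel: "sets borel = sigma_sets UNIV ?G"
      using arg_cong[OF borel_eq_rat_atMost, of sets] by (simp only: sets_measure_of subset_UNIV Pow_UNIV)
    have J_atMost: "J {..real_of_rat q} n \<in> V" for q
      unfolding V_def by (rule subsetD[OF closure_subset], rule span_base) (auto simp: B_def)
    have "Int_stable ?G"
    proof (rule Int_stableI_image)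
      fix p q :: rat
      have "{..real_of_rat p} \<inter> {..real_of_rat q} = {..min (real_of_rat p) (real_of_rat q)}"
        by auto
      also have "\<dots> = {..real_of_rat (min p q)}"
        by (cases "p \<le> q") (simp_all add: min_def of_rat_less_eq)
      finally show "\<exists>r\<in>UNIV. {..real_of_rat p} \<inter> {..real_of_rat q} = {..real_of_rat r}" by blast
    qed
    moreover have "?G \<subseteq> Pow UNIV" by simp
    moreover have "A \<in> sigma_sets UNIV ?G" using that unfolding borel .
    ultimately show ?thesis
    proof (induction rule: sigma_sets_induct_disjoint)
      case (basic A)
      then show ?case using J_atMost by auto
    next
      case empty
      have "indicat_real ({} \<inter> I n) = (\<lambda>t. 0)" by auto
      then have "J {} n = 0" by (simp add: J_def zero_L2_def)
      then show ?case using V(1) by (simp add: subspace_0)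
    next
      case (compl A)
      obtain q where q: "real n < real_of_rat q"
        using of_rat_dense[of "real n" "real n + 1"] by auto
      have "{..real_of_rat q} \<inter> I n = UNIV \<inter> I n" using q by (auto simp: I_def)
      then have univ: "J UNIV n \<in> V" using J_atMost[of q] by (simp add: J_def)
      have "J (UNIV - A) n = J UNIV n - J A n"
      proof -
        have A: "A \<in> sets borel" using compl(1) unfolding borel .
        have "(\<lambda>t. indicat_real (UNIV \<inter> I n) t - indicat_real (A \<inter> I n) t)
            = indicat_real ((UNIV - A) \<inter> I n)"
          by (auto simp: indicator_def fun_eq_iff)
        then show ?thesis
          unfolding J_def using minus_abs_L2[OF sq[of UNIV n] sq[OF A, of n]] by simp
      qed
      then show ?case using univ compl(2) V(1) by (simp add: subspace_diff)
    next
      case (union A)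
      have A: "A i \<in> sets borel" for i using union(2) unfolding borel by blast
      define s where "s N = indicat_real ((\<Union>i<N. A i) \<inter> I n)" for N
      have UA: "(\<Union>i<N. A i) \<in> sets borel" for N using A by auto
      have s_V: "abs_L2 (s N) \<in> V" for N
      proof (induction N)
        case 0
        have "abs_L2 (\<lambda>t. 0) = 0" by (simp add: zero_L2_def)
        then show ?case using V(1) by (simp add: s_def subspace_0)
      next
        case (Suc N)
        have "A i \<inter> A N = {}" if "i < N" for i
          using union(1) that by (simp add: disjoint_family_on_def)
        then have disj: "(\<Union>i<N. A i) \<inter> A N = {}" by blast
        have "s (Suc N) = (\<lambda>t. s N t + indicat_real (A N \<inter> I n) t)"
        proof
          fix t
          have "(\<Union>i<Suc N. A i) = (\<Union>i<N. A i) \<union> A N"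
            by (auto simp: less_Suc_eq)
          then show "s (Suc N) t = s N t + indicat_real (A N \<inter> I n) t"
            using disj by (auto simp: s_def indicator_def)
        qed
        then have "abs_L2 (s (Suc N)) = abs_L2 (s N) + J (A N) n"
          using sq[OF UA] sq[OF A] by (simp add: J_def plus_abs_L2 s_def)
        then show ?case using Suc union(3) V(1) by (simp add: subspace_add)
      qed
      have "(\<lambda>N. abs_L2 (s N)) \<longlonglongrightarrow> abs_L2 (indicat_real ((\<Union>i. A i) \<inter> I n))"
      proof (rule L2_dominated)
        show "square_integrable (s N)" for N unfolding s_def by (rule sq[OF UA])
        show "square_integrable (indicat_real ((\<Union>i. A i) \<inter> I n))" by (intro sq sets.countable_UN) (use A in auto)
        show "square_integrable (indicat_real (UNIV \<inter> I n))" by (intro sq) auto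
        show "AE t in lborel. (\<lambda>N. s N t) \<longlonglongrightarrow> indicat_real ((\<Union>i. A i) \<inter> I n) t"
        proof (intro AE_I2)
          fix t
          have "(\<lambda>N. indicat_real (\<Union>i<N. A i) t * indicat_real (I n) t)
              \<longlonglongrightarrow> indicat_real (\<Union>i. A i) t * indicat_real (I n) t"
            by (intro tendsto_mult_right LIMSEQ_indicator_UN)
          then show "(\<lambda>N. s N t) \<longlonglongrightarrow> indicat_real ((\<Union>i. A i) \<inter> I n) t"
            by (simp add: s_def indicator_inter_arith)
        qed
        show "AE t in lborel. \<bar>s N t - indicat_real ((\<Union>i. A i) \<inter> I n) t\<bar> \<le> indicat_real (UNIV \<inter> I n) t" for N
          by (auto simp: s_def indicator_def)
      qed
      then show ?case
        unfolding J_def by (rule closed_sequentially[OF V(2) s_V])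
    qed
  qed
  have V_UNIV: "f \<in> V" for f
  proof -
    define g where "g = rep_L2 f"
    have g: "square_integrable g" by (simp add: g_def square_integrable_rep)
    then have [measurable]: "g \<in> borel_measurable lborel" by (rule square_integrable_measurable)
    from borel_measurable_implies_sequence_metric[OF this, of 0] obtain s where
      s: "\<And>i. simple_function lborel (s i)" "\<And>t. (\<lambda>i. s i t) \<longlonglongrightarrow> g t"
        "\<And>i t. \<bar>s i t\<bar> \<le> 2 * \<bar>g t\<bar>"
      by auto
    define u where "u i t = indicat_real (I i) t * s i t" for i t
    have fin: "finite (range (s i))" for i
      using simple_functionD(1)[OF s(1)[of i]] by simp
    have level: "s i -` {y} \<in> sets borel" for i y
      using simple_functionD(2)[OF s(1)[of i], of "{y}"] by simp
    define e where "e i y = (\<lambda>t. y * indicat_real (s i -` {y} \<inter> I i) t)" for i y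
    have e: "square_integrable (e i y)" "abs_L2 (e i y) \<in> V" for i y
    proof -
      show "square_integrable (e i y)"
        unfolding e_def by (intro square_integrable_scale sq level)
      have "abs_L2 (e i y) = y *\<^sub>R J (s i -` {y}) i"
        using sq[OF level] by (simp add: J_def e_def scaleR_abs_L2)
      then show "abs_L2 (e i y) \<in> V"
        using V(1) J_V[OF level] by (simp add: subspace_scale)
    qed
    have part: "square_integrable (\<lambda>t. \<Sum>y\<in>Y. e i y t) \<and> abs_L2 (\<lambda>t. \<Sum>y\<in>Y. e i y t) \<in> V"
      if "finite Y" for Y i
      using that
    proof (induction Y)
      case empty
      have "abs_L2 (\<lambda>t. 0) = 0" by (simp add: zero_L2_def)
      then show ?case using V(1) by (simp add: square_integrable_zero subspace_0)
    next
      case (insert y Y)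
      then show ?case
        using e[of i y] V(1)
        by (simp add: square_integrable_add plus_abs_L2[symmetric] subspace_add)
    qed
    have u_eq: "u i = (\<lambda>t. \<Sum>y\<in>range (s i). e i y t)" for i
    proof
      fix t
      have "(\<Sum>y\<in>range (s i). e i y t)
          = (\<Sum>y\<in>range (s i). if y = s i t then y * indicat_real (I i) t else 0)"
        by (intro sum.cong) (auto simp: e_def indicator_def)
      then show "u i t = (\<Sum>y\<in>range (s i). e i y t)"
        using fin[of i] by (simp add: u_def)
    qed
    have "(\<lambda>i. abs_L2 (u i)) \<longlonglongrightarrow> abs_L2 g"
    proof (rule L2_dominated)
      show "square_integrable (u i)" for i
        unfolding u_eq using part[OF fin] by blast
      show "square_integrable g" by fact
      show "square_integrable (\<lambda>t. 3 * \<bar>g t\<bar>)"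
        using square_integrable_scale[of "\<lambda>t. \<bar>g t\<bar>" 3] g by (simp add: square_integrable_def)
      show "AE t in lborel. (\<lambda>i. u i t) \<longlonglongrightarrow> g t"
      proof (intro AE_I2)
        fix t
        obtain m where m: "\<bar>t\<bar> \<le> real m" using real_arch_simple by blast
        have "eventually (\<lambda>i. u i t = s i t) sequentially"
          using eventually_ge_at_top[of m]
        proof eventually_elim
          case (elim i)
          then have "t \<in> I i" using m by (auto simp: I_def abs_le_iff)
          then show ?case by (simp add: u_def)
        qed
        then show "(\<lambda>i. u i t) \<longlonglongrightarrow> g t"
          using s(2) by (simp add: tendsto_cong)
      qed
      show "AE t in lborel. \<bar>u i t - g t\<bar> \<le> 3 * \<bar>g t\<bar>" for i
      proof (intro AE_I2)
        fix t
        have "\<bar>u i t\<bar> \<le> 2 * \<bar>g t\<bar>"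
          using s(3)[of i t] by (auto simp: u_def indicator_def)
        then show "\<bar>u i t - g t\<bar> \<le> 3 * \<bar>g t\<bar>" by linarith
      qed
    qed
    moreover have "abs_L2 (u i) \<in> V" for i
      unfolding u_eq using part[OF fin] by blast
    ultimately have "abs_L2 g \<in> V"
      using V(2) closed_sequentially[of V "\<lambda>i. abs_L2 (u i)" "abs_L2 g"] by simp
    then show "f \<in> V" by (simp add: g_def abs_rep_L2)
  qed
  define Q where "Q = (\<lambda>l. \<Sum>(q, b)\<leftarrow>l. real_of_rat q *\<^sub>R b) ` lists (UNIV \<times> B)"
  have Q_countable: "countable Q"
    unfolding Q_def using \<open>countable B\<close> by (intro countable_image countable_lists countable_SIGMA) auto
  have "span B \<subseteq> closure Q"
  proof
    fix x assume "x \<in> span B"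
    then show "x \<in> closure Q"
    proof (induction rule: span_induct_alt)
      case base
      have "0 \<in> Q" unfolding Q_def by (rule image_eqI[of _ _ "[]"]) auto
      then show ?case using closure_subset by blast
    next
      case (step c b y)
      obtain Y where Y: "\<And>n. Y n \<in> Q" "Y \<longlonglongrightarrow> y"
        using step(2) unfolding closure_sequential by blast
      have "c \<in> closure \<rat>" by (simp add: Rats_closure_real)
      then obtain C where C: "\<And>n. C n \<in> \<rat>" "C \<longlonglongrightarrow> c"
        unfolding closure_sequential by blast
      have "C n *\<^sub>R b + Y n \<in> Q" for n
      proof -
        obtain l where l: "l \<in> lists (UNIV \<times> B)" "Y n = (\<Sum>(q, b)\<leftarrow>l. real_of_rat q *\<^sub>R b)"
          using Y(1)[of n] unfolding Q_def by blast
        obtain q where "C n = real_of_rat q" using C(1)[of n] by (auto elim: Rats_cases)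
        then have "C n *\<^sub>R b + Y n = (\<Sum>(q, b)\<leftarrow>(q, b) # l. real_of_rat q *\<^sub>R b)"
          using l(2) by simp
        moreover have "(q, b) # l \<in> lists (UNIV \<times> B)" using l(1) step(1) by auto
        ultimately show ?thesis unfolding Q_def by blast
      qed
      moreover have "(\<lambda>n. C n *\<^sub>R b + Y n) \<longlonglongrightarrow> c *\<^sub>R b + y"
        by (intro tendsto_intros C Y)
      ultimately show ?case
        unfolding closure_sequential by (intro exI[of _ "\<lambda>n. C n *\<^sub>R b + Y n"]) blast
    qed
  qed
  then have "closure (span B) \<subseteq> closure Q"
    by (simp add: closure_minimal)
  then have "closure Q = UNIV"
    using V_UNIV unfolding V_def by blast
  with Q_countable show "\<exists>B :: L2 set set. countable B \<and> open = generate_topology B"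
    by (rule second_countable_from_dense)
qed

section \<open>Functional linear regression\<close>

text \<open>The library's \<open>indep_var\<close>, for two random elements with values in different types.\<close>

definition indep_elements ::
  "'w measure \<Rightarrow> 'a measure \<Rightarrow> ('w \<Rightarrow> 'a) \<Rightarrow> 'b measure \<Rightarrow> ('w \<Rightarrow> 'b) \<Rightarrow> bool" where
  "indep_elements M N U N' W \<longleftrightarrow>
    U \<in> measurable M N \<and> W \<in> measurable M N' \<and>
    prob_space.indep_set M {U -` A \<inter> space M | A. A \<in> sets N} {W -` A \<inter> space M | A. A \<in> sets N'}"

definition law_support :: "'w measure \<Rightarrow> ('w \<Rightarrow> 'a :: topological_space) \<Rightarrow> 'a set" where
  "law_support M X = {a. \<forall>U. open U \<longrightarrow> a \<in> U \<longrightarrow> emeasure (distr M borel X) U > 0}"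

definition closed_span :: "'a :: real_normed_vector set \<Rightarrow> 'a set" where
  "closed_span A = (\<lambda>V. subspace V \<and> closed V) hull A"

text \<open>Uniquely determined whenever \<open>V\<close> is a complete subspace.\<close>

definition orth_proj :: "'a :: real_inner set \<Rightarrow> 'a \<Rightarrow> 'a" where
  "orth_proj V f = (THE p. p \<in> V \<and> (\<forall>v\<in>V. orthogonal (f - p) v))"

definition covariance :: "'w measure \<Rightarrow> ('w \<Rightarrow> real) \<Rightarrow> ('w \<Rightarrow> real) \<Rightarrow> real" where
  "covariance M U W = (LINT \<omega>|M. (U \<omega> - integral\<^sup>L M U) * (W \<omega> - integral\<^sup>L M W))"

definition cov_operator ::
  "'w measure \<Rightarrow> ('w \<Rightarrow> 'a :: {real_inner, banach, second_countable_topology}) \<Rightarrow> 'a \<Rightarrow> 'a" where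
  "cov_operator M Z h =
    (LINT \<omega>|M. inner (Z \<omega> - integral\<^sup>L M Z) h *\<^sub>R (Z \<omega> - integral\<^sup>L M Z))"

text \<open>The basis is indexed by \<open>{1..d}\<close>; values of \<open>\<psi>\<close> outside this range are irrelevant.\<close>

definition kl_basis ::
  "'w measure \<Rightarrow> ('w \<Rightarrow> 'a :: {real_inner, banach, second_countable_topology}) \<Rightarrow>
    'a set \<Rightarrow> nat \<Rightarrow> (nat \<Rightarrow> 'a) \<Rightarrow> bool" where
  "kl_basis M X V d \<psi> \<longleftrightarrow>
    (\<forall>i\<in>{1..d}. norm (\<psi> i) = 1) \<and>
    (\<forall>i\<in>{1..d}. \<forall>j\<in>{1..d}. i \<noteq> j \<longrightarrow> orthogonal (\<psi> i) (\<psi> j)) \<and>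
    span (\<psi> ` {1..d}) = V \<and>
    (\<forall>i\<in>{1..d}. cov_operator M (\<lambda>\<omega>. orth_proj V (X \<omega>)) (\<psi> i) =
       prob_space.variance M (\<lambda>\<omega>. inner (X \<omega>) (\<psi> i)) *\<^sub>R \<psi> i) \<and>
    (\<forall>i\<in>{1..d}. \<forall>j\<in>{1..d}. i \<le> j \<longrightarrow>
       prob_space.variance M (\<lambda>\<omega>. inner (X \<omega>) (\<psi> j))
       \<le> prob_space.variance M (\<lambda>\<omega>. inner (X \<omega>) (\<psi> i)))"

definition basis_trunc :: "(nat \<Rightarrow> 'a :: real_inner) \<Rightarrow> nat \<Rightarrow> 'a \<Rightarrow> 'a" where
  "basis_trunc \<psi> k b = (\<Sum>i=1..k. inner b (\<psi> i) *\<^sub>R \<psi> i)"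

definition is_least_square ::
  "'a :: real_inner set \<Rightarrow> (nat \<Rightarrow> 'a) \<Rightarrow> (nat \<Rightarrow> real) \<Rightarrow> nat \<Rightarrow> 'a \<Rightarrow> bool" where
  "is_least_square V x y n =
    is_arg_min (\<lambda>b. \<Sum>i=1..n. (y i - inner (x i) b)\<^sup>2) (\<lambda>b. b \<in> V)"

text \<open>Meaningful only where the minimiser is unique.\<close>

definition least_square ::
  "'a :: real_inner set \<Rightarrow> (nat \<Rightarrow> 'a) \<Rightarrow> (nat \<Rightarrow> real) \<Rightarrow> nat \<Rightarrow> 'a" where
  "least_square V x y n = (THE b. is_least_square V x y n b)"

text \<open>The argument \<open>F\<close> is the orthogonal complement, within the closed span of the support of \<open>X\<close>,
  of the space spanned by \<open>\<psi>\<close>.\<close>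

definition asymptotic_bias ::
  "'w measure \<Rightarrow> ('w \<Rightarrow> 'a :: real_inner) \<Rightarrow> 'a set \<Rightarrow> nat \<Rightarrow> (nat \<Rightarrow> 'a) \<Rightarrow> 'a \<Rightarrow> 'a" where
  "asymptotic_bias M X F d \<psi> \<beta> =
    (\<Sum>i=1..d.
      (covariance M (\<lambda>\<omega>. inner (X \<omega>) (\<psi> i)) (\<lambda>\<omega>. inner (X \<omega>) (orth_proj F \<beta>))
       / prob_space.variance M (\<lambda>\<omega>. inner (X \<omega>) (\<psi> i))) *\<^sub>R \<psi> i)"

end

theory Submission
  imports Defs "HOL-Library.Discrete_Functions"
begin

text \<open>In the Karhunen--Loeve basis of \<open>D d\<close> the Gram matrix of the sample converges to a positive
  diagonal matrix, so by the strong law the least square estimator converges to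
  \<open>P\<^sub>d u + \<gamma>\<^sup>d\<close>, where \<open>u\<close> is the projection of \<open>\<beta>\<close> on \<open>Dinf\<close> and \<open>P\<^sub>d\<close> the projection on \<open>D d\<close>.
  For fixed \<open>k\<close> the first \<open>k\<close> coefficients of \<open>\<gamma>\<^sup>d\<close> are at most \<open>const * norm (u - P\<^sub>d u) / \<lambda>\<^sup>d\<^sub>k\<close>, and
  \<open>\<lambda>\<^sup>d\<^sub>k \<ge> \<lambda>\<^sup>k\<^sub>k > 0\<close> by Courant--Fischer, so they vanish as \<open>d\<close> grows; hence so does the truncated bias if
  \<open>k\<^sub>d\<close> grows slowly. On the other hand \<open>u\<close> is approximated, modulo the orthogonal complement of \<open>Dinf\<close>, by
  \<open>\<Gamma> w\<close> with \<open>\<Gamma>\<close> the covariance operator and \<open>w\<close> in some \<open>D m\<close>; the coefficients of \<open>\<Gamma> w\<close> beyond the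
  \<open>k\<close>-th have norm at most \<open>\<lambda>\<^sup>d\<^sub>k * norm w = O(1 / k)\<close>, uniformly in \<open>d\<close>. So the truncation error of \<open>u\<close>
  vanishes for every choice of \<open>k\<^sub>d\<close> tending to infinity, without any assumption on spectral gaps.\<close>

text \<open>Truncation is forced by the bias: its coefficients are covariances with
  \<open>u - P\<^sub>d u\<close> divided by eigenvalues, the last eigenvalue is at most of order
  \<open>1 / d\<close>, and nothing relates its decay to that of
  \<open>norm (u - P\<^sub>d u)\<close>. Hence two diagonal selections: \<open>k\<^sub>d\<close>
  against the bias limits at fixed \<open>k\<close>, and the dimension against the almost sure
  limits at fixed \<open>d\<close>. Bases of different \<open>D d\<close> may be unrelated, so
  eigenvectors are never compared across \<open>d\<close>; only eigenvalues are, together with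
  \<open>\<Gamma> w\<close>, whose \<open>w\<close> lies in every later space.
  \<open>\<Gamma> w\<close> may leave \<open>Dinf\<close>, but truncations annihilate the orthogonal
  complement of \<open>Dinf\<close>, so approximation modulo that complement is enough. Two strong
  laws are needed. Products of coordinates of \<open>X\<close> are merely integrable, which calls
  for the i.i.d. law under a first moment. The noise terms need not be identically distributed, but
  their products with coordinates of the sample are uncorrelated with equal second moments. Apart
  from the final section, the Hilbert space is abstract.\<close>

declare One_nat_def [simp del]

section \<open>Orthonormal families and orthogonal projections\<close>

text \<open>Indices run over \<open>{1..d}\<close> as in \<open>kl_basis\<close>, so that every
  initial segment of a Karhunen--Loeve basis is again of this form.\<close>

definition orthonormal_upto :: "nat \<Rightarrow> (nat \<Rightarrow> 'a :: real_inner) \<Rightarrow> bool" where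
  "orthonormal_upto d \<psi> \<longleftrightarrow>
    (\<forall>i\<in>{1..d}. \<forall>j\<in>{1..d}. inner (\<psi> i) (\<psi> j) = (if i = j then 1 else 0))"

lemma orthonormal_uptoD:
  "orthonormal_upto d \<psi> \<Longrightarrow> i \<in> {1..d} \<Longrightarrow> j \<in> {1..d} \<Longrightarrow>
    inner (\<psi> i) (\<psi> j) = (if i = j then 1 else 0)"
  by (simp add: orthonormal_upto_def)

lemma orthonormal_upto_mono: "orthonormal_upto d \<psi> \<Longrightarrow> k \<le> d \<Longrightarrow> orthonormal_upto k \<psi>"
  by (simp add: orthonormal_upto_def)

lemma inner_sum_basis:
  assumes "orthonormal_upto d \<psi>" "j \<in> {1..d}"
  shows "inner (\<Sum>i=1..d. c i *\<^sub>R \<psi> i) (\<psi> j) = c j"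
proof -
  have "inner (\<Sum>i=1..d. c i *\<^sub>R \<psi> i) (\<psi> j) = (\<Sum>i=1..d. if i = j then c i else 0)"
    unfolding inner_sum_left
    using assms by (intro sum.cong) (auto simp: orthonormal_uptoD)
  then show ?thesis using assms(2) by simp
qed

lemma inner_sum_basis_sum_basis:
  assumes "orthonormal_upto d \<psi>"
  shows "inner (\<Sum>i=1..d. a i *\<^sub>R \<psi> i) (\<Sum>i=1..d. c i *\<^sub>R \<psi> i) = (\<Sum>i=1..d. a i * c i)"
proof -
  have "inner (\<Sum>i=1..d. a i *\<^sub>R \<psi> i) (\<Sum>i=1..d. c i *\<^sub>R \<psi> i) =
      (\<Sum>j=1..d. c j * inner (\<Sum>i=1..d. a i *\<^sub>R \<psi> i) (\<psi> j))"
    unfolding inner_sum_right by simp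
  also have "\<dots> = (\<Sum>j=1..d. a j * c j)"
    using inner_sum_basis[OF assms, of _ a] by (intro sum.cong) simp_all
  finally show ?thesis .
qed

lemma norm_sum_basis:
  "orthonormal_upto d \<psi> \<Longrightarrow> (norm (\<Sum>i=1..d. c i *\<^sub>R \<psi> i))\<^sup>2 = (\<Sum>i=1..d. (c i)\<^sup>2)"
  by (simp add: power2_norm_eq_inner inner_sum_basis_sum_basis) (simp add: power2_eq_square)

section \<open>Truncated expansions as linear contractions\<close>

lemma basis_trunc_add: "basis_trunc \<psi> k (a + b) = basis_trunc \<psi> k a + basis_trunc \<psi> k b"
  by (simp add: basis_trunc_def inner_add_left scaleR_add_left sum.distrib)

lemma basis_trunc_scaleR: "basis_trunc \<psi> k (c *\<^sub>R a) = c *\<^sub>R basis_trunc \<psi> k a"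
  by (simp add: basis_trunc_def scaleR_sum_right)

lemma linear_basis_trunc: "linear (basis_trunc \<psi> k)"
  by (rule linearI) (simp_all add: basis_trunc_add basis_trunc_scaleR)

lemmas basis_trunc_diff = linear_diff[OF linear_basis_trunc]

lemma inner_basis_trunc: "inner (basis_trunc \<psi> k b) a = (\<Sum>i=1..k. inner b (\<psi> i) * inner a (\<psi> i))"
  by (simp add: basis_trunc_def inner_sum_left inner_commute[of a])

text \<open>The squared norm of the truncation equals its inner product with \<open>b\<close>;
  Cauchy--Schwarz then allows one factor to be cancelled.\<close>

lemma bessel:
  assumes "orthonormal_upto k \<psi>"
  shows "(norm (basis_trunc \<psi> k b))\<^sup>2 \<le> (norm b)\<^sup>2"
proof -
  have "(norm (basis_trunc \<psi> k b))\<^sup>2 = inner (basis_trunc \<psi> k b) b"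
    unfolding inner_basis_trunc unfolding basis_trunc_def norm_sum_basis[OF assms]
    by (simp add: power2_eq_square)
  also have "\<dots> \<le> norm (basis_trunc \<psi> k b) * norm b"
    by (rule norm_cauchy_schwarz)
  finally have "norm (basis_trunc \<psi> k b) \<le> norm b"
    by (cases "norm (basis_trunc \<psi> k b) = 0") (auto simp: power2_eq_square)
  then show ?thesis by (intro power_mono) auto
qed

lemma sum_square_inner_le:
  "orthonormal_upto k \<psi> \<Longrightarrow> (\<Sum>i=1..k. (inner b (\<psi> i))\<^sup>2) \<le> (norm b)\<^sup>2"
  using bessel[of k \<psi> b] norm_sum_basis[of k \<psi> "\<lambda>i. inner b (\<psi> i)"] by (simp add: basis_trunc_def)

lemma norm_basis_trunc_le: "orthonormal_upto k \<psi> \<Longrightarrow> norm (basis_trunc \<psi> k b) \<le> norm b"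
  by (rule power2_le_imp_le[OF bessel norm_ge_zero])

lemma basis_trunc_in_span: "k \<le> d \<Longrightarrow> basis_trunc \<psi> k b \<in> span (\<psi> ` {1..d})"
  unfolding basis_trunc_def
  by (intro subspace_sum subspace_span subspace_scale[OF subspace_span] span_base) auto

lemma inner_basis_trunc_basis:
  "orthonormal_upto d \<psi> \<Longrightarrow> j \<in> {1..d} \<Longrightarrow> inner (basis_trunc \<psi> d b) (\<psi> j) = inner b (\<psi> j)"
  unfolding basis_trunc_def by (rule inner_sum_basis)

lemma basis_trunc_basis_trunc:
  assumes "orthonormal_upto d \<psi>" "k \<le> d"
  shows "basis_trunc \<psi> k (basis_trunc \<psi> d b) = basis_trunc \<psi> k b"
  unfolding basis_trunc_def[of \<psi> k]
  using assms by (intro sum.cong) (simp_all add: inner_basis_trunc_basis)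

text \<open>The residual is orthogonal to each \<open>\<psi> i\<close>, and the vectors orthogonal
  to it form a subspace, which therefore contains the span.\<close>

lemma orthogonal_diff_basis_trunc:
  assumes "orthonormal_upto d \<psi>" "v \<in> span (\<psi> ` {1..d})"
  shows "orthogonal (b - basis_trunc \<psi> d b) v"
proof -
  have "subspace {v. inner (b - basis_trunc \<psi> d b) v = 0}"
    by (simp add: subspace_def inner_add_right)
  moreover have "\<psi> ` {1..d} \<subseteq> {v. inner (b - basis_trunc \<psi> d b) v = 0}"
    using inner_basis_trunc_basis[OF assms(1)] by (auto simp: inner_diff_left)
  ultimately have "span (\<psi> ` {1..d}) \<subseteq> {v. inner (b - basis_trunc \<psi> d b) v = 0}"
    by (rule span_minimal[rotated])
  then show ?thesis using assms(2) by (auto simp: orthogonal_def)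
qed

text \<open>For a second candidate \<open>q\<close>, the vector \<open>q - p\<close> lies in
  \<open>V\<close> and is the difference of two residuals orthogonal to \<open>V\<close>, hence
  orthogonal to itself. Completeness plays no part once a candidate is at hand.\<close>

lemma orth_proj_eqI:
  assumes "subspace V" "p \<in> V" "\<And>v. v \<in> V \<Longrightarrow> orthogonal (f - p) v"
  shows "orth_proj V f = p"
  unfolding orth_proj_def
proof (rule the_equality)
  show "p \<in> V \<and> (\<forall>v\<in>V. orthogonal (f - p) v)" using assms by blast
  fix q assume q: "q \<in> V \<and> (\<forall>v\<in>V. orthogonal (f - q) v)"
  have "q - p \<in> V" using assms q by (intro subspace_diff) auto
  then have "inner (f - p) (q - p) = 0" "inner (f - q) (q - p) = 0"
    using assms(3) q by (auto simp: orthogonal_def)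
  then have "inner (q - p) (q - p) = 0" by (simp add: algebra_simps)
  then show "q = p" by simp
qed

lemma orth_proj_span_eq:
  "orthonormal_upto d \<psi> \<Longrightarrow> orth_proj (span (\<psi> ` {1..d})) b = basis_trunc \<psi> d b"
  by (intro orth_proj_eqI subspace_span basis_trunc_in_span orthogonal_diff_basis_trunc) auto

lemma basis_trunc_eq_self:
  assumes "orthonormal_upto d \<psi>" "b \<in> span (\<psi> ` {1..d})"
  shows "basis_trunc \<psi> d b = b"
proof -
  have "b - basis_trunc \<psi> d b \<in> span (\<psi> ` {1..d})"
    by (intro subspace_diff subspace_span assms basis_trunc_in_span order_refl)
  from orthogonal_diff_basis_trunc[OF assms(1) this, of b] show ?thesis
    by (simp add: orthogonal_def)
qed

lemma orthonormal_upto_independent: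
  assumes "orthonormal_upto d \<psi>"
  shows "independent (\<psi> ` {1..d})" and "card (\<psi> ` {1..d}) = d"
proof -
  have "pairwise orthogonal (\<psi> ` {1..d})"
    unfolding pairwise_def orthogonal_def using orthonormal_uptoD[OF assms] by force
  moreover have "0 \<notin> \<psi> ` {1..d}"
  proof
    assume "0 \<in> \<psi> ` {1..d}"
    then obtain i where i: "i \<in> {1..d}" "\<psi> i = 0" by auto
    with orthonormal_uptoD[OF assms i(1) i(1)] show False by simp
  qed
  ultimately show "independent (\<psi> ` {1..d})" by (rule pairwise_orthogonal_independent)
  have "inj_on \<psi> {1..d}"
  proof (rule inj_onI)
    fix i j assume ij: "i \<in> {1..d}" "j \<in> {1..d}" "\<psi> i = \<psi> j"
    then show "i = j"
      using orthonormal_uptoD[OF assms ij(1) ij(2)] orthonormal_uptoD[OF assms ij(1) ij(1)]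
      by (metis zero_neq_one)
  qed
  then show "card (\<psi> ` {1..d}) = d" by (simp add: card_image)
qed

lemma linear_inj_span_finite_surj:
  fixes f :: "'a :: real_vector \<Rightarrow> 'a"
  assumes B: "finite B" "independent B" and f: "linear f" "inj_on f (span B)"
    and sub: "f ` B \<subseteq> span B"
  shows "f ` span B = span B"
proof -
  have ind: "independent (f ` B)"
    by (rule linear_independent_injective_image[OF f(1) B(2) f(2)])
  have card: "card (f ` B) = card B"
    by (rule card_image) (rule inj_on_subset[OF f(2) span_superset])
  have "span B \<subseteq> span (f ` B)"
  proof (rule ccontr)
    assume "\<not> span B \<subseteq> span (f ` B)"
    then obtain c where c: "c \<in> span B" "c \<notin> span (f ` B)" by blast
    then have "independent (insert c (f ` B))" using ind by (simp add: independent_insertI)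
    moreover have "insert c (f ` B) \<subseteq> span B" using c sub by auto
    ultimately have "card (insert c (f ` B)) \<le> card B"
      using independent_span_bound[OF B(1)] by blast
    moreover have "c \<notin> f ` B" using c(2) span_superset[of "f ` B"] by blast
    ultimately show False using B(1) card by simp
  qed
  moreover have "span (f ` B) \<subseteq> span B" using sub by (simp add: span_minimal)
  ultimately show ?thesis using linear_span_image[OF f(1), of B] by simp
qed

text \<open>An injective \<open>f\<close> would carry \<open>B\<close> to an independent set too
  large for \<open>span C\<close>. This produces the test vector of the min-max argument for
  eigenvalues.\<close>

lemma linear_kernel_nontrivial:
  fixes f :: "'a :: real_vector \<Rightarrow> 'a"
  assumes B: "independent B" and C: "finite C" "card C < card B"
    and f: "linear f" "f ` B \<subseteq> span C"
  obtains b where "b \<in> span B" "b \<noteq> 0" "f b = 0"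
proof (cases "inj_on f (span B)")
  case True
  have "independent (f ` B)"
    by (rule linear_independent_injective_image[OF f(1) B True])
  moreover have "card (f ` B) = card B"
    by (rule card_image) (rule inj_on_subset[OF True span_superset])
  ultimately have "card B \<le> card C" using independent_span_bound[OF C(1) _ f(2)] by simp
  then show ?thesis using C(2) by simp
next
  case False
  then obtain b where "b \<in> span B" "f b = 0" "b \<noteq> 0"
    unfolding linear_inj_on_iff_eq_0[OF f(1) subspace_span] by blast
  then show ?thesis using that by blast
qed

text \<open>The classical Hilbert space argument: a minimising sequence is Cauchy by the
  parallelogram law, and varying its limit along a line in \<open>V\<close> gives
  orthogonality.\<close>

lemma projection_exists:
  fixes f :: "'a :: {real_inner, complete_space}"
  assumes V: "subspace V" "closed V"
  obtains p where "p \<in> V" "\<And>v. v \<in> V \<Longrightarrow> orthogonal (f - p) v"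
proof -
  define \<delta> where "\<delta> = infdist f V"
  have ne: "V \<noteq> {}" using subspace_0[OF V(1)] by blast
  have \<delta>: "\<delta> \<le> norm (f - v)" if "v \<in> V" for v
    using infdist_le[OF that, of f] by (simp add: \<delta>_def dist_norm)
  have \<delta>0: "0 \<le> \<delta>" by (simp add: \<delta>_def infdist_nonneg)
  have "\<exists>v\<in>V. norm (f - v) < \<delta> + 1 / real (Suc n)" for n
  proof (rule ccontr)
    assume "\<not> ?thesis"
    then have "\<delta> + 1 / real (Suc n) \<le> infdist f V"
      using ne by (auto simp: infdist_def dist_norm not_less intro!: cINF_greatest)
    then show False by (simp add: \<delta>_def)
  qed
  then obtain v where v: "\<And>n. v n \<in> V" "\<And>n. norm (f - v n) < \<delta> + 1 / real (Suc n)" by metis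
  \<comment> \<open>The parallelogram identity for \<open>f - a\<close> and \<open>f - b\<close>;
    the midpoint lies in \<open>V\<close>, so its distance to \<open>f\<close> is at least
    \<open>\<delta>\<close>.\<close>
  have par: "(norm (a - b))\<^sup>2 \<le> 2 * (norm (f - a))\<^sup>2 + 2 * (norm (f - b))\<^sup>2 - 4 * \<delta>\<^sup>2"
    if "a \<in> V" "b \<in> V" for a b
  proof -
    have "(1/2) *\<^sub>R (a + b) \<in> V" using that V by (intro subspace_scale subspace_add) auto
    then have "\<delta>\<^sup>2 \<le> (norm (f - (1/2) *\<^sub>R (a + b)))\<^sup>2" using \<delta> \<delta>0 by (intro power_mono) auto
    moreover have "(norm (a - b))\<^sup>2 + 4 * (norm (f - (1/2) *\<^sub>R (a + b)))\<^sup>2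
        = 2 * (norm (f - a))\<^sup>2 + 2 * (norm (f - b))\<^sup>2"
      by (simp add: power2_norm_eq_inner algebra_simps inner_commute)
    ultimately show ?thesis by linarith
  qed
  have lim: "(\<lambda>n. (norm (f - v n))\<^sup>2) \<longlonglongrightarrow> \<delta>\<^sup>2"
  proof (rule tendsto_power, rule tendsto_sandwich)
    show "\<forall>\<^sub>F n in sequentially. \<delta> \<le> norm (f - v n)" using \<delta> v by simp
    show "\<forall>\<^sub>F n in sequentially. norm (f - v n) \<le> \<delta> + 1 / real (Suc n)"
      using v(2) by (simp add: less_imp_le)
    show "(\<lambda>n. \<delta> + 1 / real (Suc n)) \<longlonglongrightarrow> \<delta>"
      using tendsto_add[OF tendsto_const LIMSEQ_inverse_real_of_nat, of \<delta>] by (simp add: inverse_eq_divide)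
  qed simp
  have "Cauchy v"
  proof (rule metric_CauchyI)
    fix e :: real assume "e > 0"
    then have "\<forall>\<^sub>F n in sequentially. (norm (f - v n))\<^sup>2 < \<delta>\<^sup>2 + e\<^sup>2 / 4"
      using lim by (intro order_tendstoD(2)) auto
    then obtain N where N: "\<And>n. n \<ge> N \<Longrightarrow> (norm (f - v n))\<^sup>2 < \<delta>\<^sup>2 + e\<^sup>2 / 4"
      by (auto simp: eventually_sequentially)
    have "dist (v m) (v n) < e" if "m \<ge> N" "n \<ge> N" for m n
    proof -
      have "(norm (v m - v n))\<^sup>2 < e\<^sup>2"
        using par[OF v(1)[of m] v(1)[of n]] N[OF that(1)] N[OF that(2)] by linarith
      then show ?thesis
        using \<open>e > 0\<close> by (simp add: dist_norm power_less_imp_less_base)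
    qed
    then show "\<exists>N. \<forall>m\<ge>N. \<forall>n\<ge>N. dist (v m) (v n) < e" by blast
  qed
  then obtain p where p: "v \<longlonglongrightarrow> p" using Cauchy_convergent convergent_def by blast
  have pV: "p \<in> V" using closed_sequentially[OF V(2) v(1) p] .
  have "(\<lambda>n. (norm (f - v n))\<^sup>2) \<longlonglongrightarrow> (norm (f - p))\<^sup>2" by (intro tendsto_intros p)
  then have min: "(norm (f - p))\<^sup>2 = \<delta>\<^sup>2" using lim LIMSEQ_unique by blast
  have "orthogonal (f - p) w" if w: "w \<in> V" for w
  proof -
    define s where "s = inner (f - p) w"
    have quad: "2 * t * s \<le> t * t * (norm w)\<^sup>2" for t
    proof -
      have "p + t *\<^sub>R w \<in> V" using pV w V(1) by (intro subspace_add subspace_scale)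
      then have "\<delta>\<^sup>2 \<le> (norm (f - (p + t *\<^sub>R w)))\<^sup>2" using \<delta> \<delta>0 by (intro power_mono) auto
      also have "\<dots> = (norm (f - p))\<^sup>2 - 2 * t * s + t * t * (norm w)\<^sup>2"
        by (simp add: power2_norm_eq_inner s_def algebra_simps inner_commute)
      finally show ?thesis using min by linarith
    qed
    have "s = 0"
    proof (rule ccontr)
      assume s: "s \<noteq> 0"
      \<comment> \<open>The summand 1 keeps \<open>W\<close> positive even for \<open>w = 0\<close>.
        Taking \<open>t = s / W\<close> in \<open>quad\<close> yields
        \<open>s * s / W \<le> 0\<close>.\<close>
      define W where "W = (norm w)\<^sup>2 + 1"
      have W: "W > 0" "(norm w)\<^sup>2 \<le> W" by (simp_all add: W_def add_nonneg_pos)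
      have "2 * (s / W) * s \<le> (s / W) * (s / W) * (norm w)\<^sup>2" by (rule quad)
      also have "\<dots> \<le> (s / W) * (s / W) * W" using W by (intro mult_left_mono) auto
      also have "\<dots> = (s / W) * s" using W by simp
      finally have "(s / W) * s \<le> 0" by simp
      moreover have "s * s / W > 0" using s W
        by (intro divide_pos_pos) (cases s "0::real" rule: linorder_cases; auto intro: mult_neg_neg)
      ultimately show False by simp
    qed
    then show ?thesis by (simp add: orthogonal_def s_def)
  qed
  with pV that show ?thesis by blast
qed

section \<open>Least squares on a finite-dimensional space\<close>

text \<open>Positivity makes the normal operator injective on \<open>V\<close>, hence surjective by
  finite dimension, so the normal equations are solvable. They cancel the cross term in the
  expansion of the objective around \<open>b\<close>, and the remaining quadratic part is positive:
  the minimum is strict.\<close>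

lemma least_square_unique:
  fixes x :: "nat \<Rightarrow> 'a :: real_inner"
  assumes \<psi>: "orthonormal_upto d \<psi>" and V: "V = span (\<psi> ` {1..d})"
    and pos: "\<And>b. b \<in> V \<Longrightarrow> b \<noteq> 0 \<Longrightarrow> (\<Sum>l=1..n. (inner (x l) b)\<^sup>2) > 0"
  obtains b where "b \<in> V" "\<And>b'. is_least_square V x y n b' \<longleftrightarrow> b' = b"
    "\<And>v. v \<in> V \<Longrightarrow> (\<Sum>l=1..n. inner (x l) b * inner (x l) v) = (\<Sum>l=1..n. y l * inner (x l) v)"
proof -
  define P where "P = basis_trunc \<psi> d"
  \<comment> \<open>The normal operator. Projecting each \<open>x l\<close> keeps its values in
    \<open>V\<close> and does not change pairings with vectors of \<open>V\<close>.\<close>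
  define f where "f b = (\<Sum>l=1..n. inner (x l) b *\<^sub>R P (x l))" for b
  have PV: "P a \<in> V" for a unfolding P_def V by (rule basis_trunc_in_span) simp
  have sV: "subspace V" by (simp add: V)
  have Pin: "inner (P a) v = inner a v" if "v \<in> V" for a v
    using orthogonal_diff_basis_trunc[OF \<psi>, of v a] that by (simp add: P_def V orthogonal_def inner_diff_left)
  have fin: "inner (f b) v = (\<Sum>l=1..n. inner (x l) b * inner (x l) v)" if "v \<in> V" for b v
    by (simp add: f_def inner_sum_left Pin[OF that])
  have fV: "f b \<in> V" for b
    unfolding f_def by (intro subspace_sum subspace_scale sV PV)
  have lin: "linear f"
    by (rule linearI) (simp_all add: f_def inner_add_right scaleR_add_left sum.distrib scaleR_sum_right)
  have "inj_on f V"
    unfolding linear_inj_on_iff_eq_0[OF lin sV]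
  proof (intro ballI impI)
    fix b assume b: "b \<in> V" "f b = 0"
    then have "(\<Sum>l=1..n. (inner (x l) b)\<^sup>2) = 0"
      using fin[OF b(1), of b] by (simp add: power2_eq_square)
    then show "b = 0" using pos[OF b(1)] by force
  qed
  then have "f ` V = V"
    unfolding V using fV \<psi> lin
    by (intro linear_inj_span_finite_surj orthonormal_upto_independent) (auto simp: V)
  moreover have "(\<Sum>l=1..n. y l *\<^sub>R P (x l)) \<in> V"
    by (intro subspace_sum subspace_scale sV PV)
  ultimately obtain b where b: "b \<in> V" "f b = (\<Sum>l=1..n. y l *\<^sub>R P (x l))" by (metis imageE)
  have normal: "(\<Sum>l=1..n. inner (x l) b * inner (x l) v) = (\<Sum>l=1..n. y l * inner (x l) v)"
    if "v \<in> V" for v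
    using fin[OF that, of b] by (simp add: b(2) inner_sum_left Pin[OF that])
  define Q where "Q b' = (\<Sum>l=1..n. (y l - inner (x l) b')\<^sup>2)" for b'
  have strict: "Q b < Q b'" if "b' \<in> V" "b' \<noteq> b" for b'
  proof -
    define v where "v = b' - b"
    have v: "v \<in> V" "v \<noteq> 0" "b' = b + v" using that b sV by (auto simp: v_def subspace_diff)
    have "Q b' = (\<Sum>l=1..n. (y l - inner (x l) b)\<^sup>2 + (inner (x l) v)\<^sup>2
        + 2 * (inner (x l) b * inner (x l) v) - 2 * (y l * inner (x l) v))"
      unfolding Q_def v(3) by (intro sum.cong) (simp_all add: power2_eq_square algebra_simps)
    also have "\<dots> = Q b + (\<Sum>l=1..n. (inner (x l) v)\<^sup>2)
        + 2 * (\<Sum>l=1..n. inner (x l) b * inner (x l) v) - 2 * (\<Sum>l=1..n. y l * inner (x l) v)"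
      by (simp add: Q_def sum.distrib sum_subtractf sum_distrib_left)
    also have "\<dots> > Q b" using pos[OF v(1,2)] normal[OF v(1)] by simp
    finally show ?thesis .
  qed
  have "is_least_square V x y n b' \<longleftrightarrow> b' = b" for b'
    unfolding is_least_square_def is_arg_min_def Q_def[symmetric]
    using strict b(1) by (metis less_asym less_irrefl)
  with b normal that show ?thesis by blast
qed

section \<open>Stability of the minimiser under errors in the moments\<close>

lemma sum_abs_inner_basis_le:
  assumes "orthonormal_upto d \<psi>"
  shows "(\<Sum>i=1..d. \<bar>inner b (\<psi> i)\<bar>) \<le> real d * norm b"
proof -
  have "\<bar>inner b (\<psi> i)\<bar> \<le> norm b" if "i \<in> {1..d}" for i
    using Cauchy_Schwarz_ineq2[of b "\<psi> i"] orthonormal_uptoD[OF assms that that]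
    by (simp add: norm_eq_sqrt_inner)
  then have "(\<Sum>i=1..d. \<bar>inner b (\<psi> i)\<bar>) \<le> (\<Sum>i=1..d. norm b)" by (intro sum_mono)
  then show ?thesis by simp
qed

text \<open>A deterministic estimate in which \<open>\<eta>\<close> is chosen before the sample, so
  that it can be applied outcome by outcome. A Gram matrix close to a positive diagonal one stays
  coercive; testing the normal equations with the difference of the minimiser and the limiting
  solution then bounds that difference.\<close>

lemma least_square_perturbation:
  fixes \<psi> :: "nat \<Rightarrow> 'a :: real_inner"
  assumes \<psi>: "orthonormal_upto d \<psi>" and V: "V = span (\<psi> ` {1..d})"
    and \<nu>: "\<And>i. i \<in> {1..d} \<Longrightarrow> \<nu> i > 0" and e: "e > 0"
  obtains \<eta> where "\<eta> > 0"
    "\<And>x y n. (\<And>i j. i \<in> {1..d} \<Longrightarrow> j \<in> {1..d} \<Longrightarrow>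
        \<bar>(\<Sum>l=1..n. inner (x l) (\<psi> i) * inner (x l) (\<psi> j)) / real n - (if i = j then \<nu> i else 0)\<bar> < \<eta>)
      \<Longrightarrow> (\<And>i. i \<in> {1..d} \<Longrightarrow> \<bar>(\<Sum>l=1..n. y l * inner (x l) (\<psi> i)) / real n - c i\<bar> < \<eta>)
      \<Longrightarrow> (\<exists>!b. is_least_square V x y n b) \<and>
        norm (least_square V x y n - (\<Sum>i=1..d. (c i / \<nu> i) *\<^sub>R \<psi> i)) < e"
proof -
  \<comment> \<open>The extra element 1 makes the minimum meaningful also for
    \<open>d = 0\<close>.\<close>
  define \<mu> where "\<mu> = Min (insert 1 (\<nu> ` {1..d}))"
  have \<mu>: "\<mu> > 0" unfolding \<mu>_def using \<nu> by (subst Min_gr_iff) auto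
  have \<mu>_le: "\<mu> \<le> \<nu> i" if "i \<in> {1..d}" for i unfolding \<mu>_def using that by (intro Min_le) auto
  define a where "a i = c i / \<nu> i" for i
  define A where "A = (\<Sum>i=1..d. \<bar>a i\<bar>)"
  have A: "A \<ge> 0" by (simp add: A_def sum_nonneg)
  define b0 where "b0 = (\<Sum>i=1..d. a i *\<^sub>R \<psi> i)"
  define R where "R = 2 / \<mu> * (real d * (1 + A))"
  have R: "R \<ge> 0" using \<mu> A by (simp add: R_def)
  \<comment> \<open>The first entry keeps the Gram error below half of the coercivity constant
    \<open>\<mu>\<close>, since that error is at most
    \<open>\<eta> * (real d * norm b)\<^sup>2\<close>; the second makes the final bound
    \<open>R * \<eta>\<close> smaller than \<open>e\<close>. The added 2 and 1 keep the denominators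
    positive.\<close>
  define \<eta> where "\<eta> = min (\<mu> / (2 * (real d)\<^sup>2 + 2)) (e / (R + 1))"
  have \<eta>: "\<eta> > 0" using \<mu> e R by (simp add: \<eta>_def add_nonneg_pos)
  have \<eta>1: "\<eta> * (real d)\<^sup>2 \<le> \<mu> / 2"
  proof -
    have "\<eta> * (real d)\<^sup>2 \<le> (\<mu> / (2 * (real d)\<^sup>2 + 2)) * (real d)\<^sup>2"
      by (intro mult_right_mono) (auto simp: \<eta>_def)
    also have "\<dots> \<le> \<mu> / 2" using \<mu> by (simp add: field_simps add_pos_nonneg)
    finally show ?thesis .
  qed
  have \<eta>2: "R * \<eta> < e"
  proof -
    have "R * \<eta> \<le> R * (e / (R + 1))" using R by (intro mult_left_mono) (auto simp: \<eta>_def)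
    also have "\<dots> < e" using R e by (simp add: field_simps)
    finally show ?thesis .
  qed
  show ?thesis
  proof (rule that[OF \<eta>], goal_cases)
    case (1 x y n)
    define G where "G i j = (\<Sum>l=1..n. inner (x l) (\<psi> i) * inner (x l) (\<psi> j)) / real n" for i j
    define E where "E i j = G i j - (if i = j then \<nu> i else 0)" for i j
    have E: "\<bar>E i j\<bar> \<le> \<eta>" if "i \<in> {1..d}" "j \<in> {1..d}" for i j
      using 1(1)[OF that] by (simp add: E_def G_def)
    have inner_x: "inner (x l) b = (\<Sum>i=1..d. inner b (\<psi> i) * inner (x l) (\<psi> i))" if "b \<in> V" for b l
      using arg_cong[OF basis_trunc_eq_self[OF \<psi>, of b], of "inner (x l)"] that
      by (simp add: V basis_trunc_def inner_sum_right)
    have gram: "(\<Sum>l=1..n. inner (x l) b * inner (x l) v) / real n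
        = (\<Sum>j=1..d. \<Sum>i=1..d. inner b (\<psi> i) * inner v (\<psi> j) * G i j)" if "b \<in> V" "v \<in> V" for b v
    proof -
      have "(\<Sum>l=1..n. inner (x l) b * inner (x l) v) =
        (\<Sum>l=1..n. \<Sum>j=1..d. \<Sum>i=1..d. inner b (\<psi> i) * inner v (\<psi> j) * (inner (x l) (\<psi> i) * inner (x l) (\<psi> j)))"
        unfolding inner_x[OF that(1)] inner_x[OF that(2)] sum_product
        by (rule sum.cong[OF refl], subst sum.swap) (simp add: mult_ac)
      also have "\<dots> = (\<Sum>j=1..d. \<Sum>i=1..d. inner b (\<psi> i) * inner v (\<psi> j) * (\<Sum>l=1..n. inner (x l) (\<psi> i) * inner (x l) (\<psi> j)))"
        by (subst sum.swap, rule sum.cong, rule refl, subst sum.swap) (simp add: sum_distrib_left)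
      finally show ?thesis
        unfolding G_def times_divide_eq_right sum_divide_distrib[symmetric] by simp
    qed
    have lower: "\<mu> / 2 * (norm b)\<^sup>2 \<le> (\<Sum>l=1..n. (inner (x l) b)\<^sup>2) / real n" if b: "b \<in> V" for b
    proof -
      define t where "t i = inner b (\<psi> i)" for i
      have nb: "(norm b)\<^sup>2 = (\<Sum>i=1..d. (t i)\<^sup>2)"
        using norm_sum_basis[OF \<psi>, of t] basis_trunc_eq_self[OF \<psi>, of b] b
        by (simp add: V basis_trunc_def t_def)
      have "(\<Sum>l=1..n. (inner (x l) b)\<^sup>2) / real n = (\<Sum>j=1..d. \<Sum>i=1..d. t i * t j * G i j)"
        using gram[OF b b] by (simp add: t_def power2_eq_square)
      also have "\<dots> = (\<Sum>j=1..d. \<Sum>i=1..d. (if i = j then \<nu> i * (t i)\<^sup>2 else 0) + t i * t j * E i j)"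
        by (intro sum.cong refl) (simp add: E_def algebra_simps power2_eq_square)
      also have "\<dots> = (\<Sum>j=1..d. \<nu> j * (t j)\<^sup>2) + (\<Sum>j=1..d. \<Sum>i=1..d. t i * t j * E i j)"
        by (simp add: sum.distrib)
      finally have eq: "(\<Sum>l=1..n. (inner (x l) b)\<^sup>2) / real n =
        (\<Sum>j=1..d. \<nu> j * (t j)\<^sup>2) + (\<Sum>j=1..d. \<Sum>i=1..d. t i * t j * E i j)" .
      have "\<bar>\<Sum>j=1..d. \<Sum>i=1..d. t i * t j * E i j\<bar> \<le> (\<Sum>j=1..d. \<Sum>i=1..d. \<bar>t i\<bar> * \<bar>t j\<bar> * \<eta>)"
        using E by (intro order_trans[OF sum_abs] sum_mono) (auto simp: abs_mult intro!: mult_left_mono)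
      also have "\<dots> = \<eta> * (\<Sum>i=1..d. \<bar>t i\<bar>)\<^sup>2"
        by (simp add: power2_eq_square sum_product sum_distrib_left mult_ac)
      also have "\<dots> \<le> \<eta> * (real d * norm b)\<^sup>2"
        using \<eta> sum_abs_inner_basis_le[OF \<psi>, of b]
        by (intro mult_left_mono power_mono) (auto simp: t_def sum_nonneg)
      also have "\<dots> = (\<eta> * (real d)\<^sup>2) * (norm b)\<^sup>2" by (simp add: power_mult_distrib)
      also have "\<dots> \<le> \<mu> / 2 * (norm b)\<^sup>2" using \<eta>1 by (intro mult_right_mono) auto
      finally have "\<bar>\<Sum>j=1..d. \<Sum>i=1..d. t i * t j * E i j\<bar> \<le> \<mu> / 2 * (norm b)\<^sup>2" .
      moreover have "\<mu> * (norm b)\<^sup>2 \<le> (\<Sum>j=1..d. \<nu> j * (t j)\<^sup>2)"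
        unfolding nb sum_distrib_left using \<mu>_le by (intro sum_mono mult_right_mono) auto
      ultimately show ?thesis unfolding eq by linarith
    qed
    have pos: "(\<Sum>l=1..n. (inner (x l) b)\<^sup>2) > 0" if "b \<in> V" "b \<noteq> 0" for b
    proof -
      have "0 < \<mu> / 2 * (norm b)\<^sup>2" using \<mu> that by simp
      \<comment> \<open>Division by zero gives zero, so a positive quotient also excludes
        \<open>n = 0\<close>.\<close>
      then have "0 < (\<Sum>l=1..n. (inner (x l) b)\<^sup>2) / real n" using lower[OF that(1)] by linarith
      then show ?thesis by (simp add: zero_less_divide_iff)
    qed
    obtain b where b: "b \<in> V" and ls: "\<And>b'. is_least_square V x y n b' \<longleftrightarrow> b' = b"
      and normal: "\<And>v. v \<in> V \<Longrightarrow>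
        (\<Sum>l=1..n. inner (x l) b * inner (x l) v) = (\<Sum>l=1..n. y l * inner (x l) v)"
      using least_square_unique[OF \<psi> V pos] by blast
    have LS: "least_square V x y n = b" by (simp add: least_square_def ls)
    have b0: "b0 \<in> V"
      unfolding b0_def V by (intro subspace_sum subspace_span subspace_scale[OF subspace_span] span_base) auto
    have b0_inner: "inner b0 (\<psi> i) = a i" if "i \<in> {1..d}" for i
      unfolding b0_def using \<psi> that by (rule inner_sum_basis)
    define v where "v = b - b0"
    have v: "v \<in> V" unfolding v_def using b b0 by (simp add: V subspace_diff)
    define t where "t i = inner v (\<psi> i)" for i
    have sq: "inner (x l) v * inner (x l) v = inner (x l) b * inner (x l) v - inner (x l) b0 * inner (x l) v" for l
      by (simp add: v_def inner_diff_right left_diff_distrib right_diff_distrib)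
    \<comment> \<open>Coercivity at \<open>v = b - b0\<close>: by the normal equations the quadratic
      form becomes the defect of \<open>b0\<close> in them, tested with \<open>v\<close>.\<close>
    have "\<mu> / 2 * (norm v)\<^sup>2 \<le> (\<Sum>l=1..n. inner (x l) v * inner (x l) v) / real n"
      using lower[OF v] by (simp add: power2_eq_square)
    also have "\<dots> = (\<Sum>l=1..n. y l * inner (x l) v) / real n - (\<Sum>l=1..n. inner (x l) b0 * inner (x l) v) / real n"
      unfolding sq sum_subtractf diff_divide_distrib normal[OF v] ..
    also have "(\<Sum>l=1..n. y l * inner (x l) v) / real n
        = (\<Sum>j=1..d. t j * ((\<Sum>l=1..n. y l * inner (x l) (\<psi> j)) / real n))"
      unfolding inner_x[OF v] t_def sum_distrib_left sum_divide_distrib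
      by (subst sum.swap) (simp add: mult_ac)
    also have "(\<Sum>l=1..n. inner (x l) b0 * inner (x l) v) / real n
        = (\<Sum>j=1..d. t j * (\<Sum>i=1..d. a i * G i j))"
      unfolding gram[OF b0 v] sum_distrib_left
      by (intro sum.cong refl) (simp add: b0_inner t_def mult_ac)
    also have "(\<Sum>j=1..d. t j * ((\<Sum>l=1..n. y l * inner (x l) (\<psi> j)) / real n))
          - (\<Sum>j=1..d. t j * (\<Sum>i=1..d. a i * G i j))
        = (\<Sum>j=1..d. t j * ((\<Sum>l=1..n. y l * inner (x l) (\<psi> j)) / real n - (\<Sum>i=1..d. a i * G i j)))"
      by (simp only: right_diff_distrib sum_subtractf)
    also have "\<dots> \<le> (\<Sum>j=1..d. \<bar>t j\<bar> * (\<eta> * (1 + A)))"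
    proof (rule sum_mono)
      fix j assume j: "j \<in> {1..d}"
      \<comment> \<open>Since \<open>a j * \<nu> j = c j\<close>, the vector \<open>b0\<close>
        solves the limiting equations exactly and only the errors \<open>E\<close> remain.\<close>
      have "(\<Sum>i=1..d. a i * G i j) = (\<Sum>i=1..d. (if i = j then a i * \<nu> i else 0) + a i * E i j)"
        by (intro sum.cong refl) (simp add: E_def algebra_simps)
      also have "\<dots> = c j + (\<Sum>i=1..d. a i * E i j)"
        using j \<nu>[OF j] by (simp add: sum.distrib a_def)
      finally have eq: "(\<Sum>i=1..d. a i * G i j) = c j + (\<Sum>i=1..d. a i * E i j)" .
      have "\<bar>\<Sum>i=1..d. a i * E i j\<bar> \<le> (\<Sum>i=1..d. \<bar>a i\<bar> * \<eta>)"
        using E j by (intro order_trans[OF sum_abs] sum_mono) (auto simp: abs_mult intro!: mult_left_mono)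
      then have "\<bar>\<Sum>i=1..d. a i * E i j\<bar> \<le> \<eta> * A"
        by (simp add: A_def sum_distrib_left mult.commute)
      then have bnd: "\<bar>(\<Sum>l=1..n. y l * inner (x l) (\<psi> j)) / real n - (\<Sum>i=1..d. a i * G i j)\<bar> \<le> \<eta> * (1 + A)"
        unfolding eq using 1(2)[OF j] by (simp add: algebra_simps)
      have "t j * ((\<Sum>l=1..n. y l * inner (x l) (\<psi> j)) / real n - (\<Sum>i=1..d. a i * G i j))
          \<le> \<bar>t j\<bar> * \<bar>(\<Sum>l=1..n. y l * inner (x l) (\<psi> j)) / real n - (\<Sum>i=1..d. a i * G i j)\<bar>"
        unfolding abs_mult[symmetric] by (rule abs_ge_self)
      also have "\<dots> \<le> \<bar>t j\<bar> * (\<eta> * (1 + A))" using bnd by (intro mult_left_mono) auto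
      finally show "t j * ((\<Sum>l=1..n. y l * inner (x l) (\<psi> j)) / real n - (\<Sum>i=1..d. a i * G i j))
          \<le> \<bar>t j\<bar> * (\<eta> * (1 + A))" .
    qed
    also have "\<dots> = (\<Sum>j=1..d. \<bar>t j\<bar>) * (\<eta> * (1 + A))" by (simp add: sum_distrib_right)
    also have "\<dots> \<le> (real d * norm v) * (\<eta> * (1 + A))"
      using sum_abs_inner_basis_le[OF \<psi>, of v] \<eta> A by (intro mult_right_mono) (auto simp: t_def)
    finally have main: "\<mu> / 2 * (norm v)\<^sup>2 \<le> (real d * norm v) * (\<eta> * (1 + A))" .
    have "norm v \<le> R * \<eta>"
    proof (cases "norm v = 0")
      case True
      then show ?thesis using R \<eta> by simp
    next
      case False
      then have nv: "norm v > 0" by simp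
      have "norm v * (\<mu> / 2 * norm v) \<le> norm v * (real d * (\<eta> * (1 + A)))"
        using main by (simp add: power2_eq_square mult_ac)
      then have "\<mu> / 2 * norm v \<le> real d * (\<eta> * (1 + A))" using nv by (simp only: mult_le_cancel_left_pos)
      then show ?thesis using \<mu> by (simp add: R_def field_simps)
    qed
    then have "norm v < e" using \<eta>2 by linarith
    then show ?case by (simp add: ls LS v_def b0_def a_def)
  qed
qed

section \<open>A diagonal selection\<close>

lemma diagonal_selection:
  fixes P :: "nat \<Rightarrow> nat \<Rightarrow> bool"
  assumes "\<And>j. j \<ge> 1 \<Longrightarrow> \<forall>\<^sub>F n in sequentially. P j n"
  obtains k :: "nat \<Rightarrow> nat" where "\<And>n. n \<ge> 1 \<Longrightarrow> 1 \<le> k n \<and> k n \<le> n"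
    "filterlim k at_top sequentially" "\<forall>\<^sub>F n in sequentially. P (k n) n"
proof -
  define J where "J n = {j \<in> {1..n}. j = 1 \<or> P j n}" for n
  define k where "k n = Max (J n)" for n
  have fin: "finite (J n)" for n by (simp add: J_def)
  have k: "k n \<in> J n" if "n \<ge> 1" for n
    unfolding k_def using that by (intro Max_in fin) (auto simp: J_def)
  have ge: "\<forall>\<^sub>F n in sequentially. j \<le> k n" if "j \<ge> 1" for j
    using assms[OF that] eventually_ge_at_top[of j]
  proof eventually_elim
    case (elim n)
    then have "j \<in> J n" using that by (simp add: J_def)
    then show ?case unfolding k_def by (intro Max_ge fin)
  qed
  show ?thesis
  proof (rule that)
    show "1 \<le> k n \<and> k n \<le> n" if "n \<ge> 1" for n using k[OF that] by (simp add: J_def)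
    show "filterlim k at_top sequentially"
      unfolding filterlim_at_top
    proof
      fix Z
      show "\<forall>\<^sub>F n in sequentially. Z \<le> k n"
        using ge[of "max 1 Z"] by (auto elim: eventually_mono)
    qed
    have "\<forall>\<^sub>F n in sequentially. 2 \<le> k n" by (rule ge) simp
    then show "\<forall>\<^sub>F n in sequentially. P (k n) n"
      using eventually_ge_at_top[of 1]
    proof eventually_elim
      case (elim n)
      then show ?case using k[of n] by (auto simp: J_def)
    qed
  qed
qed

section \<open>Strong laws of large numbers\<close>

text \<open>The sum of the squares has finite expectation, hence is finite almost surely, and the
  terms of a convergent series vanish.\<close>

lemma AE_tendsto_0_if_summable_square:
  fixes Y :: "nat \<Rightarrow> 'a \<Rightarrow> real"
  assumes meas [measurable]: "\<And>n. Y n \<in> borel_measurable M"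
    and int: "\<And>n. integrable M (\<lambda>\<omega>. (Y n \<omega>)\<^sup>2)"
    and sum: "summable (\<lambda>n. LINT \<omega>|M. (Y n \<omega>)\<^sup>2)"
  shows "AE \<omega> in M. (\<lambda>n. Y n \<omega>) \<longlonglongrightarrow> 0"
proof -
  have "(\<integral>\<^sup>+\<omega>. (\<Sum>n. ennreal ((Y n \<omega>)\<^sup>2)) \<partial>M) = (\<Sum>n. \<integral>\<^sup>+\<omega>. ennreal ((Y n \<omega>)\<^sup>2) \<partial>M)"
    by (rule nn_integral_suminf) simp
  also have "\<dots> = (\<Sum>n. ennreal (LINT \<omega>|M. (Y n \<omega>)\<^sup>2))"
    by (intro suminf_cong nn_integral_eq_integral int) simp
  also have "\<dots> = ennreal (\<Sum>n. LINT \<omega>|M. (Y n \<omega>)\<^sup>2)"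
    by (rule suminf_ennreal2[OF _ sum]) simp
  also have "\<dots> \<noteq> \<infinity>" by simp
  finally have "AE \<omega> in M. (\<Sum>n. ennreal ((Y n \<omega>)\<^sup>2)) \<noteq> \<infinity>"
    by (intro nn_integral_noteq_infinite) auto
  then show ?thesis
  proof eventually_elim
    case (elim \<omega>)
    then have "summable (\<lambda>n. (Y n \<omega>)\<^sup>2)" by (intro summable_suminf_not_top) auto
    then have "(\<lambda>n. sqrt ((Y n \<omega>)\<^sup>2)) \<longlonglongrightarrow> sqrt 0"
      by (intro tendsto_real_sqrt summable_LIMSEQ_zero)
    then show ?case by (simp add: tendsto_rabs_zero_iff)
  qed
qed

lemma (in prob_space) expectation_sum_square_uncorrelated:
  fixes Z :: "'i \<Rightarrow> 'a \<Rightarrow> real"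
  assumes I: "finite I"
    and int: "\<And>i j. i \<in> I \<Longrightarrow> j \<in> I \<Longrightarrow> integrable M (\<lambda>\<omega>. Z i \<omega> * Z j \<omega>)"
    and uncor: "\<And>i j. i \<in> I \<Longrightarrow> j \<in> I \<Longrightarrow> i \<noteq> j \<Longrightarrow> expectation (\<lambda>\<omega>. Z i \<omega> * Z j \<omega>) = 0"
  shows "integrable M (\<lambda>\<omega>. (\<Sum>i\<in>I. Z i \<omega>)\<^sup>2)"
    and "expectation (\<lambda>\<omega>. (\<Sum>i\<in>I. Z i \<omega>)\<^sup>2) = (\<Sum>i\<in>I. expectation (\<lambda>\<omega>. (Z i \<omega>)\<^sup>2))"
proof -
  have eq: "(\<Sum>i\<in>I. Z i \<omega>)\<^sup>2 = (\<Sum>i\<in>I. \<Sum>j\<in>I. Z i \<omega> * Z j \<omega>)" for \<omega>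
    by (simp add: power2_eq_square sum_product)
  show "integrable M (\<lambda>\<omega>. (\<Sum>i\<in>I. Z i \<omega>)\<^sup>2)"
    unfolding eq by (intro Bochner_Integration.integrable_sum int)
  have "expectation (\<lambda>\<omega>. (\<Sum>i\<in>I. Z i \<omega>)\<^sup>2) = (\<Sum>i\<in>I. \<Sum>j\<in>I. expectation (\<lambda>\<omega>. Z i \<omega> * Z j \<omega>))"
    unfolding eq
    by (subst Bochner_Integration.integral_sum)
       (auto intro!: Bochner_Integration.integrable_sum int sum.cong Bochner_Integration.integral_sum)
  also have "\<dots> = (\<Sum>i\<in>I. \<Sum>j\<in>I. if i = j then expectation (\<lambda>\<omega>. (Z i \<omega>)\<^sup>2) else 0)"
    by (intro sum.cong refl) (auto simp: uncor power2_eq_square)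
  also have "\<dots> = (\<Sum>i\<in>I. expectation (\<lambda>\<omega>. (Z i \<omega>)\<^sup>2))"
    using I by simp
  finally show "expectation (\<lambda>\<omega>. (\<Sum>i\<in>I. Z i \<omega>)\<^sup>2) = (\<Sum>i\<in>I. expectation (\<lambda>\<omega>. (Z i \<omega>)\<^sup>2))" .
qed

text \<open>Along the squares \<open>n\<^sup>2\<close> the averages have second moments of order
  \<open>1 / n\<^sup>2\<close>, which is summable. Between consecutive squares the partial sums are
  controlled by \<open>Y2\<close>.\<close>

lemma (in prob_space) slln_uncorrelated:
  fixes Z :: "nat \<Rightarrow> 'a \<Rightarrow> real"
  assumes meas: "\<And>i. i \<ge> 1 \<Longrightarrow> Z i \<in> borel_measurable M"
    and int: "\<And>i j. i \<ge> 1 \<Longrightarrow> j \<ge> 1 \<Longrightarrow> integrable M (\<lambda>\<omega>. Z i \<omega> * Z j \<omega>)"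
    and uncor: "\<And>i j. i \<ge> 1 \<Longrightarrow> j \<ge> 1 \<Longrightarrow> i \<noteq> j \<Longrightarrow> expectation (\<lambda>\<omega>. Z i \<omega> * Z j \<omega>) = 0"
    and bnd: "\<And>i. i \<ge> 1 \<Longrightarrow> expectation (\<lambda>\<omega>. (Z i \<omega>)\<^sup>2) \<le> C"
  shows "AE \<omega> in M. (\<lambda>n. (\<Sum>i=1..n. Z i \<omega>) / real n) \<longlonglongrightarrow> 0"
proof -
  define S where "S n \<omega> = (\<Sum>i=1..n. Z i \<omega>)" for n \<omega>
  have S_meas [measurable]: "S n \<in> borel_measurable M" for n
    unfolding S_def using meas by (intro borel_measurable_sum) auto
  have S_diff: "S b \<omega> - S a \<omega> = (\<Sum>i\<in>{a<..b}. Z i \<omega>)" if "a \<le> b" for a b \<omega>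
  proof -
    have "{1..b} = {1..a} \<union> {a<..b}" using that by auto
    then have "S b \<omega> = S a \<omega> + (\<Sum>i\<in>{a<..b}. Z i \<omega>)"
      unfolding S_def by (simp only:) (intro sum.union_disjoint; auto)
    then show ?thesis by simp
  qed
  have C: "0 \<le> C" using order_trans[OF _ bnd[of 1]] by simp
  have moment: "integrable M (\<lambda>\<omega>. (S b \<omega> - S a \<omega>)\<^sup>2)"
    "expectation (\<lambda>\<omega>. (S b \<omega> - S a \<omega>)\<^sup>2) \<le> C * real (b - a)" if "a \<le> b" for a b
  proof -
    note * = expectation_sum_square_uncorrelated[of "{a<..b}" Z, OF _ int uncor, folded S_diff[OF that]]
    show "integrable M (\<lambda>\<omega>. (S b \<omega> - S a \<omega>)\<^sup>2)" by (rule *(1)) auto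
    have "expectation (\<lambda>\<omega>. (S b \<omega> - S a \<omega>)\<^sup>2) = (\<Sum>i\<in>{a<..b}. expectation (\<lambda>\<omega>. (Z i \<omega>)\<^sup>2))"
      by (rule *(2)) auto
    also have "\<dots> \<le> (\<Sum>i\<in>{a<..b}. C)" by (intro sum_mono bnd) auto
    finally show "expectation (\<lambda>\<omega>. (S b \<omega> - S a \<omega>)\<^sup>2) \<le> C * real (b - a)" by (simp add: mult.commute)
  qed
  have S0: "S 0 \<omega> = 0" for \<omega> by (simp add: S_def)
  have inv_sq: "summable (\<lambda>n. K * inverse ((real n)\<^sup>2))" for K
    by (intro summable_mult inverse_power_summable) simp
  define Y1 where "Y1 n \<omega> = S (n\<^sup>2) \<omega> / (real n)\<^sup>2" for n \<omega>
  have Y1: "AE \<omega> in M. (\<lambda>n. Y1 n \<omega>) \<longlonglongrightarrow> 0"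
  proof (rule AE_tendsto_0_if_summable_square)
    show "Y1 n \<in> borel_measurable M" for n unfolding Y1_def by measurable
    have eq: "(\<lambda>\<omega>. (Y1 n \<omega>)\<^sup>2) = (\<lambda>\<omega>. (S (n\<^sup>2) \<omega> - S 0 \<omega>)\<^sup>2 / (real n)^4)" for n
      by (simp add: Y1_def S0 power_divide flip: power_mult)
    show "integrable M (\<lambda>\<omega>. (Y1 n \<omega>)\<^sup>2)" for n
      unfolding eq by (intro integrable_divide moment) simp
    show "summable (\<lambda>n. expectation (\<lambda>\<omega>. (Y1 n \<omega>)\<^sup>2))"
    proof (rule summable_comparison_test'[OF inv_sq[of C]])
      fix n :: nat
      have "expectation (\<lambda>\<omega>. (Y1 n \<omega>)\<^sup>2) \<le> C * real (n\<^sup>2) / (real n)^4"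
        unfolding eq using moment(2)[of 0 "n\<^sup>2"] by (simp add: divide_right_mono)
      also have "\<dots> = C * inverse ((real n)\<^sup>2)"
        by (cases "n = 0") (simp_all add: field_simps power_numeral_reduce)
      finally show "norm (expectation (\<lambda>\<omega>. (Y1 n \<omega>)\<^sup>2)) \<le> C * inverse ((real n)\<^sup>2)" by simp
    qed
  qed
  \<comment> \<open>The range covers every \<open>m\<close> before the next square. The Euclidean
    norm of the increments replaces their maximum: it dominates each of them, and its second moment
    is a plain sum of variances.\<close>
  define Y2 where "Y2 n \<omega> = sqrt (\<Sum>m=n\<^sup>2..n\<^sup>2 + 2 * n. (S m \<omega> - S (n\<^sup>2) \<omega>)\<^sup>2) / (real n)\<^sup>2" for n \<omega>
  have Y2: "AE \<omega> in M. (\<lambda>n. Y2 n \<omega>) \<longlonglongrightarrow> 0"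
  proof (rule AE_tendsto_0_if_summable_square)
    show "Y2 n \<in> borel_measurable M" for n unfolding Y2_def by measurable
    have eq: "(\<lambda>\<omega>. (Y2 n \<omega>)\<^sup>2) = (\<lambda>\<omega>. (\<Sum>m=n\<^sup>2..n\<^sup>2 + 2 * n. (S m \<omega> - S (n\<^sup>2) \<omega>)\<^sup>2) / (real n)^4)" for n
      by (simp add: Y2_def power_divide sum_nonneg flip: power_mult)
    show "integrable M (\<lambda>\<omega>. (Y2 n \<omega>)\<^sup>2)" for n
      unfolding eq by (intro integrable_divide Bochner_Integration.integrable_sum moment) simp
    show "summable (\<lambda>n. expectation (\<lambda>\<omega>. (Y2 n \<omega>)\<^sup>2))"
    \<comment> \<open>There are \<open>2 * n + 1 \<le> 3 * n\<close> increments, each with second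
      moment at most \<open>2 * n * C\<close>, whence the 6.\<close>
    proof (rule summable_comparison_test'[OF inv_sq[of "6 * C"]])
      fix n :: nat
      have "expectation (\<lambda>\<omega>. \<Sum>m=n\<^sup>2..n\<^sup>2 + 2 * n. (S m \<omega> - S (n\<^sup>2) \<omega>)\<^sup>2)
          = (\<Sum>m=n\<^sup>2..n\<^sup>2 + 2 * n. expectation (\<lambda>\<omega>. (S m \<omega> - S (n\<^sup>2) \<omega>)\<^sup>2))"
        by (intro Bochner_Integration.integral_sum moment) simp
      also have "\<dots> \<le> (\<Sum>m=n\<^sup>2..n\<^sup>2 + 2 * n. C * real (2 * n))"
        by (intro sum_mono order_trans[OF moment(2)] mult_left_mono C of_nat_mono) auto
      also have "\<dots> = (2 * real n + 1) * (C * (2 * real n))" by simp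
      also have "\<dots> \<le> 6 * C * (real n)\<^sup>2"
      proof (cases "n = 0")
        case False
        then have "2 * real n + 1 \<le> 3 * real n" by simp
        then have "(2 * real n + 1) * (C * (2 * real n)) \<le> 3 * real n * (C * (2 * real n))"
          using C by (intro mult_right_mono) auto
        then show ?thesis by (simp add: power2_eq_square)
      qed simp
      finally have "expectation (\<lambda>\<omega>. (Y2 n \<omega>)\<^sup>2) \<le> 6 * C * (real n)\<^sup>2 / (real n)^4"
        unfolding eq by (simp add: divide_right_mono)
      also have "\<dots> = 6 * C * inverse ((real n)\<^sup>2)"
        by (cases "n = 0") (simp_all add: field_simps power_numeral_reduce)
      finally show "norm (expectation (\<lambda>\<omega>. (Y2 n \<omega>)\<^sup>2)) \<le> 6 * C * inverse ((real n)\<^sup>2)" by simp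
    qed
  qed
  have fs: "filterlim floor_sqrt at_top sequentially"
    unfolding filterlim_at_top
  proof
    fix r
    show "\<forall>\<^sub>F n in sequentially. r \<le> floor_sqrt n"
      using eventually_ge_at_top[of "r\<^sup>2"] by eventually_elim (simp add: le_floor_sqrt_iff)
  qed
  show ?thesis
    using Y1 Y2
  proof eventually_elim
    case (elim \<omega>)
    have "(\<lambda>n. \<bar>Y1 n \<omega>\<bar> + Y2 n \<omega>) \<longlonglongrightarrow> \<bar>0\<bar> + 0"
      by (intro tendsto_intros elim)
    then have lim: "(\<lambda>n. \<bar>Y1 (floor_sqrt n) \<omega>\<bar> + Y2 (floor_sqrt n) \<omega>) \<longlonglongrightarrow> 0"
      using filterlim_compose[OF _ fs] by fastforce
    show ?case
      unfolding S_def[symmetric]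
    proof (rule tendsto_rabs_zero_cancel, rule tendsto_sandwich[OF _ _ tendsto_const lim])
      show "\<forall>\<^sub>F n in sequentially. \<bar>S n \<omega> / real n\<bar> \<le> \<bar>Y1 (floor_sqrt n) \<omega>\<bar> + Y2 (floor_sqrt n) \<omega>"
        using eventually_ge_at_top[of 1]
      proof eventually_elim
        case (elim n)
        define r where "r = floor_sqrt n"
        have r: "r \<ge> 1" "r\<^sup>2 \<le> n" "n \<le> r\<^sup>2 + 2 * r"
          using elim Suc_floor_sqrt_power2_gt[of n] floor_sqrt_power2_le[of n]
          by (auto simp: r_def le_floor_sqrt_iff power2_eq_square)
        have rn: "(real r)\<^sup>2 \<le> real n" using r(2) of_nat_mono by fastforce
        have "\<bar>S n \<omega> / real n\<bar> \<le> \<bar>S n \<omega>\<bar> / (real r)\<^sup>2"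
          using rn r(1) elim by (simp add: frac_le)
        also have "\<dots> \<le> (\<bar>S (r\<^sup>2) \<omega>\<bar> + \<bar>S n \<omega> - S (r\<^sup>2) \<omega>\<bar>) / (real r)\<^sup>2"
          by (intro divide_right_mono) auto
        also have "\<bar>S n \<omega> - S (r\<^sup>2) \<omega>\<bar> \<le> sqrt (\<Sum>m=r\<^sup>2..r\<^sup>2 + 2 * r. (S m \<omega> - S (r\<^sup>2) \<omega>)\<^sup>2)"
        proof (rule real_le_rsqrt)
          show "\<bar>S n \<omega> - S (r\<^sup>2) \<omega>\<bar>\<^sup>2 \<le> (\<Sum>m=r\<^sup>2..r\<^sup>2 + 2 * r. (S m \<omega> - S (r\<^sup>2) \<omega>)\<^sup>2)"
            using r member_le_sum[of n "{r\<^sup>2..r\<^sup>2 + 2 * r}" "\<lambda>m. (S m \<omega> - S (r\<^sup>2) \<omega>)\<^sup>2"] by simp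
        qed
        finally show ?case
          by (simp add: Y1_def Y2_def r_def[symmetric] add_divide_distrib divide_right_mono)
      qed
    qed simp
  qed
qed

text \<open>If the top power lies below \<open>z\<close>, the whole geometric sum is at most
  \<open>\<alpha> / (\<alpha> - 1)\<close> times that power. With \<open>z\<close> a value of the
  random variable, this bounds the expected tail probabilities.\<close>

lemma sum_power_below_le:
  fixes \<alpha> z :: real
  assumes "1 < \<alpha>" "0 \<le> z"
  shows "(\<Sum>n<N. if \<alpha>^n < z then \<alpha>^n else 0) \<le> \<alpha> / (\<alpha> - 1) * z"
proof (induction N)
  case (Suc N)
  show ?case
  proof (cases "\<alpha>^N < z")
    case True
    have "(\<Sum>n<Suc N. if \<alpha>^n < z then \<alpha>^n else 0) \<le> (\<Sum>n<Suc N. \<alpha>^n)"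
      using assms by (intro sum_mono) auto
    also have "\<dots> = (\<alpha>^Suc N - 1) / (\<alpha> - 1)" using assms by (subst geometric_sum) auto
    also have "\<dots> \<le> \<alpha> * z / (\<alpha> - 1)" using assms True
      by (intro divide_right_mono) (simp_all, smt (verit) mult_left_mono)
    finally show ?thesis by simp
  next
    case False
    then show ?thesis using Suc by simp
  qed
qed (use assms in simp)

text \<open>Induction with \<open>z\<close> general: for \<open>z > 1\<close> the term
  \<open>n = 0\<close> drops out, and shifting the index replaces \<open>z\<close> by
  \<open>z / \<alpha>\<close>. The bound serves the truncated second moments.\<close>

lemma sum_inverse_power_above_le:
  fixes \<alpha> z :: real
  assumes "1 < \<alpha>" "0 < z"
  shows "(\<Sum>n<N. if z \<le> \<alpha>^n then 1 / \<alpha>^n else 0) \<le> \<alpha> / (\<alpha> - 1) / z"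
  using assms(2)
proof (induction N arbitrary: z)
  case (Suc N)
  show ?case
  proof (cases "z \<le> 1")
    case True
    have "(\<Sum>n<Suc N. if z \<le> \<alpha>^n then 1 / \<alpha>^n else 0) \<le> (\<Sum>n<Suc N. (1 / \<alpha>)^n)"
      using assms(1) by (intro sum_mono) (auto simp: power_one_over)
    also have "\<dots> = (1 - (1 / \<alpha>)^Suc N) / (1 - 1 / \<alpha>)"
      using assms(1) by (subst sum_gp_strict) auto
    also have "\<dots> \<le> 1 / (1 - 1 / \<alpha>)" using assms(1) by (intro divide_right_mono) auto
    also have "\<dots> = \<alpha> / (\<alpha> - 1)" using assms(1) by (simp add: field_simps)
    also have "\<dots> \<le> \<alpha> / (\<alpha> - 1) / z"
      using True Suc.prems assms(1) mult_left_mono[of 1 "1 / z" "\<alpha> / (\<alpha> - 1)"] by simp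
    finally show ?thesis .
  next
    case False
    have "(\<Sum>n<Suc N. if z \<le> \<alpha>^n then 1 / \<alpha>^n else 0)
        = (\<Sum>n<N. if z \<le> \<alpha>^Suc n then 1 / \<alpha>^Suc n else 0)"
      using False by (subst sum.lessThan_Suc_shift) simp
    also have "\<dots> = 1 / \<alpha> * (\<Sum>n<N. if z / \<alpha> \<le> \<alpha>^n then 1 / \<alpha>^n else 0)"
      unfolding sum_distrib_left using assms(1) by (intro sum.cong) (auto simp: field_simps)
    also have "\<dots> \<le> 1 / \<alpha> * (\<alpha> / (\<alpha> - 1) / (z / \<alpha>))"
      using assms(1) Suc.prems by (intro mult_left_mono Suc.IH) auto
    also have "\<dots> = \<alpha> / (\<alpha> - 1) / z" using assms(1) by simp
    finally show ?thesis .
  qed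
qed (use assms in simp)

text \<open>Monotonicity traps \<open>s N\<close> between its values at two neighbouring geometric
  indices, at the price of a factor tending to \<open>\<alpha> = 1 + 1 / Suc m\<close> on either
  side. Letting \<open>m\<close> grow removes the factor.\<close>

lemma average_tendsto_if_geometric_subsequences:
  fixes s :: "nat \<Rightarrow> real"
  assumes s: "incseq s" "\<And>n. 0 \<le> s n"
    and lim: "\<And>m. (\<lambda>n. s (nat \<lceil>(1 + 1 / real (Suc m))^n\<rceil>) / real (nat \<lceil>(1 + 1 / real (Suc m))^n\<rceil>)) \<longlonglongrightarrow> \<mu>"
  shows "(\<lambda>n. s n / real n) \<longlonglongrightarrow> \<mu>"
proof -
  have squeeze: "\<forall>\<^sub>F N in sequentially. s N / real N < b" "\<forall>\<^sub>F N in sequentially. a < s N / real N"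
    if "\<mu> * (1 + 1 / real (Suc m)) < b" "a < \<mu> / (1 + 1 / real (Suc m))" for a b m
  proof -
    define \<alpha> where "\<alpha> = 1 + 1 / real (Suc m)"
    have \<alpha>: "1 < \<alpha>" by (simp add: \<alpha>_def)
    define K where "K n = nat \<lceil>\<alpha>^n\<rceil>" for n
    have \<alpha>1: "1 \<le> \<alpha>^n" for n using \<alpha> by (simp add: one_le_power)
    have K: "\<alpha>^n \<le> real (K n)" "real (K n) \<le> \<alpha>^n + 1" for n
      using \<alpha>1[of n] by (auto simp: K_def)
    have K1: "1 \<le> real (K n)" for n using K(1)[of n] \<alpha>1[of n] by linarith
    \<comment> \<open>The exponent with
      \<open>\<alpha>^r N \<le> N < \<alpha>^Suc (r N)\<close>.\<close>
    define r where "r N = nat \<lfloor>log \<alpha> (real N)\<rfloor>" for N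
    have r: "K (r N) \<le> N" "N \<le> K (Suc (r N))" if N: "N \<ge> 1" for N
    proof -
      have l0: "0 \<le> log \<alpha> (real N)" using N \<alpha> by simp
      then have rl: "real (r N) \<le> log \<alpha> (real N)" "log \<alpha> (real N) < real (Suc (r N))"
        by (auto simp: r_def) linarith+
      have "\<alpha> powr real (r N) \<le> real N" using rl(1) N \<alpha> by (subst (asm) le_log_iff) auto
      then have "\<alpha>^r N \<le> real N" using \<alpha> by (simp add: powr_realpow)
      then show "K (r N) \<le> N" by (simp add: K_def ceiling_le_iff nat_le_iff)
      have "real N < \<alpha> powr real (Suc (r N))" using rl(2) N \<alpha> by (subst (asm) log_less_iff) auto
      then have "real N < \<alpha>^Suc (r N)" using \<alpha> by (simp add: powr_realpow del: power_Suc of_nat_Suc)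
      then have "real N \<le> real (K (Suc (r N)))" using K(1)[of "Suc (r N)"] by linarith
      then show "N \<le> K (Suc (r N))" by simp
    qed
    have r_top: "filterlim r at_top sequentially"
      unfolding filterlim_at_top
    proof
      fix Z
      show "\<forall>\<^sub>F N in sequentially. Z \<le> r N"
        using eventually_ge_at_top[of "max 1 (nat \<lceil>\<alpha>^Z\<rceil>)"]
      proof eventually_elim
        case (elim N)
        then have "\<alpha>^Z \<le> real N" "1 \<le> N" by (auto simp: nat_le_iff ceiling_le_iff)
        then have "real Z \<le> log \<alpha> (real N)" using \<alpha> by (subst le_log_iff) (auto simp: powr_realpow)
        then show "Z \<le> r N" by (simp add: r_def le_nat_iff le_floor_iff)
      qed
    qed
    \<comment> \<open>A bound for the ratio \<open>K (Suc n) / K n\<close>; the second summand is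
      the cost of rounding up.\<close>
    define g where "g n = \<alpha> + 1 / \<alpha>^n" for n
    have inv: "(\<lambda>n. 1 / \<alpha>^n) \<longlonglongrightarrow> 0"
      using LIMSEQ_realpow_zero[of "1 / \<alpha>"] \<alpha> by (simp add: power_one_over)
    then have g: "g \<longlonglongrightarrow> \<alpha>" using tendsto_add[OF tendsto_const inv, of \<alpha>] by (simp add: g_def[abs_def])
    have g0: "g n > 0" for n using \<alpha> by (simp add: g_def add_pos_pos)
    have Kg: "real (K (Suc n)) \<le> g n * real (K n)" for n
    proof -
      have "real (K (Suc n)) \<le> \<alpha> * \<alpha>^n + 1" using K(2)[of "Suc n"] by simp
      also have "\<dots> = g n * \<alpha>^n" using \<alpha> by (simp add: g_def algebra_simps)
      also have "\<dots> \<le> g n * real (K n)" using K(1) g0 by (intro mult_left_mono) (auto simp: less_imp_le)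
      finally show ?thesis .
    qed
    define a' where "a' n = s (K n) / real (K n)" for n
    have a': "a' \<longlonglongrightarrow> \<mu>" unfolding a'_def K_def \<alpha>_def by (rule lim)
    have a'0: "0 \<le> a' n" for n by (simp add: a'_def s)
    have "(\<lambda>n. a' (Suc n) * g n) \<longlonglongrightarrow> \<mu> * \<alpha>" by (intro tendsto_intros LIMSEQ_Suc a' g)
    from filterlim_compose[OF this r_top]
    have up: "\<forall>\<^sub>F N in sequentially. a' (Suc (r N)) * g (r N) < b"
      using that(1) by (intro order_tendstoD(2)) (auto simp: \<alpha>_def)
    show "\<forall>\<^sub>F N in sequentially. s N / real N < b"
      using up eventually_ge_at_top[of 1]
    proof eventually_elim
      case (elim N)
      define n where "n = r N"
      have "s N / real N \<le> s (K (Suc n)) / real (K n)"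
        using r[OF elim(2)] s K1[of n] by (intro frac_le) (auto simp: n_def incseqD)
      also have "\<dots> = a' (Suc n) * (real (K (Suc n)) / real (K n))"
        using K1[of "Suc n"] by (simp add: a'_def)
      also have "\<dots> \<le> a' (Suc n) * g n"
        using Kg[of n] K1[of n] a'0 by (intro mult_left_mono) (auto simp: divide_le_eq)
      also have "\<dots> < b" using elim(1) by (simp add: n_def)
      finally show ?case .
    qed
    have "(\<lambda>n. a' n / g n) \<longlonglongrightarrow> \<mu> / \<alpha>" using \<alpha> by (intro tendsto_intros a' g) auto
    from filterlim_compose[OF this r_top]
    have down: "\<forall>\<^sub>F N in sequentially. a < a' (r N) / g (r N)"
      using that(2) by (intro order_tendstoD(1)) (auto simp: \<alpha>_def)
    show "\<forall>\<^sub>F N in sequentially. a < s N / real N"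
      using down eventually_ge_at_top[of 1]
    proof eventually_elim
      case (elim N)
      define n where "n = r N"
      have "a < a' n / g n" using elim(1) by (simp add: n_def)
      also have "\<dots> = s (K n) / (g n * real (K n))" by (simp add: a'_def)
      also have "\<dots> \<le> s (K n) / real (K (Suc n))"
        using Kg[of n] K1[of n] K1[of "Suc n"] s(2) g0 by (intro divide_left_mono mult_pos_pos) auto
      also have "\<dots> \<le> s N / real N"
        using r[OF elim(2)] s elim(2) by (intro frac_le) (auto simp: n_def incseqD)
      finally show ?case .
    qed
  qed
  have one: "(\<lambda>m. 1 + 1 / real (Suc m)) \<longlonglongrightarrow> 1"
    using tendsto_add[OF tendsto_const LIMSEQ_inverse_real_of_nat, of 1] by (simp add: inverse_eq_divide)
  have "(\<lambda>m. \<mu> * (1 + 1 / real (Suc m))) \<longlonglongrightarrow> \<mu> * 1" "(\<lambda>m. \<mu> / (1 + 1 / real (Suc m))) \<longlonglongrightarrow> \<mu> / 1"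
    by (intro tendsto_intros one; simp)+
  then have lims: "(\<lambda>m. \<mu> * (1 + 1 / real (Suc m))) \<longlonglongrightarrow> \<mu>" "(\<lambda>m. \<mu> / (1 + 1 / real (Suc m))) \<longlonglongrightarrow> \<mu>"
    by simp_all
  show ?thesis
  proof (rule order_tendstoI)
    fix a assume "a < \<mu>"
    from order_tendstoD(1)[OF lims(2) this] obtain m where "a < \<mu> / (1 + 1 / real (Suc m))"
      by (auto simp: eventually_sequentially)
    then show "\<forall>\<^sub>F N in sequentially. a < s N / real N" by (rule squeeze(2)[OF less_add_one])
  next
    fix b assume "\<mu> < b"
    from order_tendstoD(2)[OF lims(1) this] obtain m where "\<mu> * (1 + 1 / real (Suc m)) < b"
      by (auto simp: eventually_sequentially)
    then show "\<forall>\<^sub>F N in sequentially. s N / real N < b"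
      by (rule squeeze(1)[where a = "\<mu> / (1 + 1 / real (Suc m)) - 1"]) simp
  qed
qed


text \<open>Etemadi's argument: along the geometric sequence \<open>k n\<close>, the variables truncated at height \<open>k n\<close>
  have summable variances and differ from the original ones only finitely often.\<close>

lemma (in prob_space) slln_iid_nonneg:
  fixes Z :: "nat \<Rightarrow> 'a \<Rightarrow> real"
  assumes indep: "indep_vars (\<lambda>_. borel) Z {1..}"
    and dist: "\<And>i. i \<ge> 1 \<Longrightarrow> distr M borel (Z i) = distr M borel (Z 1)"
    and nonneg: "\<And>i \<omega>. 0 \<le> Z i \<omega>"
    and int: "integrable M (Z 1)"
  shows "AE \<omega> in M. (\<lambda>n. (\<Sum>i=1..n. Z i \<omega>) / real n) \<longlonglongrightarrow> expectation (Z 1)"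
proof -
  have meas: "Z i \<in> borel_measurable M" if "i \<ge> 1" for i
    using indep that by (simp add: indep_vars_def)
  note meas1 [measurable] = meas[OF order_refl]
  define \<mu> where "\<mu> = expectation (Z 1)"
  have same: "integrable M (\<lambda>\<omega>. h (Z i \<omega>)) \<longleftrightarrow> integrable M (\<lambda>\<omega>. h (Z 1 \<omega>))"
    "expectation (\<lambda>\<omega>. h (Z i \<omega>)) = expectation (\<lambda>\<omega>. h (Z 1 \<omega>))"
    if "i \<ge> 1" and h: "h \<in> borel_measurable borel" for i and h :: "real \<Rightarrow> real"
    using integrable_distr_eq[OF meas[OF that(1)] h] integrable_distr_eq[OF meas1 h]
      integral_distr[OF meas[OF that(1)] h] integral_distr[OF meas1 h] dist[OF that(1)] by simp_all
  have sub: "AE \<omega> in M. (\<lambda>n. (\<Sum>i=1..nat \<lceil>\<alpha>^n\<rceil>. Z i \<omega>) / real (nat \<lceil>\<alpha>^n\<rceil>)) \<longlonglongrightarrow> \<mu>"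
    if \<alpha>: "1 < \<alpha>" for \<alpha> :: real
  proof -
    define k where "k n = nat \<lceil>\<alpha>^n\<rceil>" for n
    have \<alpha>1: "1 \<le> \<alpha>^n" for n using \<alpha> by (simp add: one_le_power)
    have k: "\<alpha>^n \<le> real (k n)" "real (k n) \<le> 2 * \<alpha>^n" for n
    proof -
      have "real (k n) \<le> \<alpha>^n + 1" using \<alpha>1[of n] by (auto simp: k_def)
      then show "real (k n) \<le> 2 * \<alpha>^n" using \<alpha>1[of n] by linarith
      show "\<alpha>^n \<le> real (k n)" using \<alpha>1[of n] by (auto simp: k_def)
    qed
    have k1: "1 \<le> real (k n)" for n using k(1)[of n] \<alpha>1[of n] by linarith
    define C where "C = \<alpha> / (\<alpha> - 1)"
    have C: "C > 0" using \<alpha> by (simp add: C_def)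
    \<comment> \<open>The level depends on \<open>n\<close> and not on \<open>i\<close>, so for each
      \<open>n\<close> the truncated variables keep a common mean and variance.\<close>
    define h where "h n z = (if z \<le> real (k n) then z else 0)" for n z
    have h [measurable]: "h n \<in> borel_measurable borel" for n unfolding h_def by measurable
    have h_bnd: "\<bar>h n (Z i \<omega>)\<bar> \<le> real (k n)" for n i \<omega> using nonneg[of i \<omega>] by (auto simp: h_def)
    define \<mu>' where "\<mu>' n = expectation (\<lambda>\<omega>. h n (Z 1 \<omega>))" for n
    define U where "U n i \<omega> = h n (Z i \<omega>) - \<mu>' n" for n i \<omega>
    have hZ: "integrable M (\<lambda>\<omega>. h n (Z i \<omega>))" if "i \<ge> 1" for n i
      by (rule integrable_const_bound[where B = "real (k n)"])
         (use h_bnd meas[OF that] in \<open>auto intro: measurable_compose[OF _ h]\<close>)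
    have k_top: "filterlim (\<lambda>n. real (k n)) at_top sequentially"
    proof (rule filterlim_at_top_mono)
      show "filterlim (\<lambda>n. \<alpha>^n) at_top sequentially"
        by (rule filterlim_at_infinity_imp_filterlim_at_top[OF filterlim_realpow_sequentially_gt1])
           (use \<alpha> in simp_all)
    qed (use k in simp)
    have \<mu>': "\<mu>' \<longlonglongrightarrow> \<mu>"
      unfolding \<mu>'_def \<mu>_def
    proof (rule integral_dominated_convergence[where w = "Z 1"])
      show "AE \<omega> in M. (\<lambda>n. h n (Z 1 \<omega>)) \<longlonglongrightarrow> Z 1 \<omega>"
      proof (rule AE_I2)
        fix \<omega>
        have "\<forall>\<^sub>F n in sequentially. Z 1 \<omega> \<le> real (k n)"
          using k_top by (simp add: filterlim_at_top)
        then have "\<forall>\<^sub>F n in sequentially. h n (Z 1 \<omega>) = Z 1 \<omega>"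
          by eventually_elim (simp add: h_def)
        then show "(\<lambda>n. h n (Z 1 \<omega>)) \<longlonglongrightarrow> Z 1 \<omega>" by (rule tendsto_eventually)
      qed
      show "AE \<omega> in M. norm (h n (Z 1 \<omega>)) \<le> Z 1 \<omega>" for n
        using nonneg by (auto simp: h_def)
    qed (use int in simp_all)
    have U_int: "integrable M (\<lambda>\<omega>. U n i \<omega> * U n j \<omega>)" if "i \<ge> 1" "j \<ge> 1" for n i j
    proof (rule integrable_const_bound[where B = "(real (k n) + \<bar>\<mu>' n\<bar>) * (real (k n) + \<bar>\<mu>' n\<bar>)"])
      have "\<bar>U n i \<omega>\<bar> \<le> real (k n) + \<bar>\<mu>' n\<bar>" for i \<omega>
        using h_bnd[of n i \<omega>] by (simp add: U_def)
      then show "AE \<omega> in M. norm (U n i \<omega> * U n j \<omega>) \<le> (real (k n) + \<bar>\<mu>' n\<bar>) * (real (k n) + \<bar>\<mu>' n\<bar>)"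
        by (auto simp: abs_mult intro!: mult_mono)
      show "(\<lambda>\<omega>. U n i \<omega> * U n j \<omega>) \<in> borel_measurable M"
        using hZ[OF that(1)] hZ[OF that(2)] by (auto simp: U_def)
    qed
    have U_uncor: "expectation (\<lambda>\<omega>. U n i \<omega> * U n j \<omega>) = 0" if ij: "i \<ge> 1" "j \<ge> 1" "i \<noteq> j" for n i j
    proof -
      have "indep_vars (\<lambda>_. borel) (\<lambda>i \<omega>. (\<lambda>z. h n z - \<mu>' n) (Z i \<omega>)) {1..}"
        by (rule indep_vars_compose2[OF indep]) measurable
      then have "indep_vars (\<lambda>_. borel) (\<lambda>i \<omega>. U n i \<omega>) {i, j}"
        unfolding U_def by (rule indep_vars_subset) (use ij in auto)
      moreover have Ui: "integrable M (U n i)" if "i \<ge> 1" for i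
        using hZ[OF that, of n] unfolding U_def by simp
      ultimately have "expectation (\<lambda>\<omega>. \<Prod>l\<in>{i, j}. U n l \<omega>) = (\<Prod>l\<in>{i, j}. expectation (U n l))"
        by (intro indep_vars_lebesgue_integral) (use ij in auto)
      moreover have "expectation (U n i) = 0"
        using hZ[OF ij(1), of n] same(2)[OF ij(1) h, of n]
        unfolding U_def by (simp add: \<mu>'_def prob_space)
      ultimately show ?thesis using ij by simp
    qed
    define v where "v n = expectation (\<lambda>\<omega>. (h n (Z 1 \<omega>))\<^sup>2)" for n
    have h2: "integrable M (\<lambda>\<omega>. (h n (Z 1 \<omega>))\<^sup>2)" for n
      by (rule integrable_const_bound[where B = "(real (k n))\<^sup>2"])
         (use h_bnd in \<open>auto simp: abs_le_square_iff[symmetric]\<close>)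
    have U_var: "expectation (\<lambda>\<omega>. (U n i \<omega>)\<^sup>2) \<le> v n" if "i \<ge> 1" for n i
    proof -
      have "expectation (\<lambda>\<omega>. (U n i \<omega>)\<^sup>2) = expectation (\<lambda>\<omega>. (U n 1 \<omega>)\<^sup>2)"
        unfolding U_def by (rule same(2)[OF that]) measurable
      also have "\<dots> = v n - (\<mu>' n)\<^sup>2"
        using variance_eq[OF hZ[OF order_refl, of n] h2[of n]] by (simp add: U_def v_def \<mu>'_def)
      finally show ?thesis by simp
    qed
    define Y where "Y n \<omega> = (\<Sum>i=1..k n. U n i \<omega>) / real (k n)" for n \<omega>
    have "AE \<omega> in M. (\<lambda>n. Y n \<omega>) \<longlonglongrightarrow> 0"
    proof (rule AE_tendsto_0_if_summable_square)
      show "Y n \<in> borel_measurable M" for n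
        unfolding Y_def U_def
        by (intro borel_measurable_divide borel_measurable_sum borel_measurable_diff
              borel_measurable_const borel_measurable_integrable[OF hZ]) auto
      have eq: "(\<lambda>\<omega>. (Y n \<omega>)\<^sup>2) = (\<lambda>\<omega>. (\<Sum>i\<in>{1..k n}. U n i \<omega>)\<^sup>2 / (real (k n))\<^sup>2)" for n
        by (simp add: Y_def power_divide)
      note * = expectation_sum_square_uncorrelated[of "{1..k n}" "U n" for n, OF _ U_int U_uncor]
      show "integrable M (\<lambda>\<omega>. (Y n \<omega>)\<^sup>2)" for n
        unfolding eq by (intro integrable_divide *(1)) auto
      have Y_le: "expectation (\<lambda>\<omega>. (Y n \<omega>)\<^sup>2) \<le> v n / real (k n)" for n
      proof -
        have "expectation (\<lambda>\<omega>. (\<Sum>i\<in>{1..k n}. U n i \<omega>)\<^sup>2) = (\<Sum>i\<in>{1..k n}. expectation (\<lambda>\<omega>. (U n i \<omega>)\<^sup>2))"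
          by (rule *(2)) auto
        also have "\<dots> \<le> (\<Sum>i\<in>{1..k n}. v n)" by (intro sum_mono U_var) auto
        finally have "expectation (\<lambda>\<omega>. (Y n \<omega>)\<^sup>2) \<le> real (k n) * v n / (real (k n))\<^sup>2"
          unfolding eq by (simp add: divide_right_mono)
        also have "\<dots> = v n / real (k n)" using k1[of n] by (simp add: power2_eq_square)
        finally show ?thesis .
      qed
      \<comment> \<open>Sum and expectation are exchanged, which reduces the claim to a pointwise
        bound. A term survives only if \<open>z \<le> real (k n) \<le> 2 * \<alpha>^n\<close>, hence
        the threshold \<open>z / 2\<close> and the factor 2.\<close>
      have "summable (\<lambda>n. v n / real (k n))"
      proof (rule summableI_nonneg_bounded[where x = "2 * C * \<mu>"])
        show "0 \<le> v n / real (k n)" for n by (simp add: v_def)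
        fix N
        have "(\<Sum>n<N. v n / real (k n)) = expectation (\<lambda>\<omega>. \<Sum>n<N. (h n (Z 1 \<omega>))\<^sup>2 / real (k n))"
          unfolding v_def using h2 by (subst Bochner_Integration.integral_sum) auto
        also have "\<dots> \<le> expectation (\<lambda>\<omega>. 2 * C * Z 1 \<omega>)"
        proof (rule integral_mono)
          show "integrable M (\<lambda>\<omega>. \<Sum>n<N. (h n (Z 1 \<omega>))\<^sup>2 / real (k n))"
            using h2 by (intro Bochner_Integration.integrable_sum integrable_divide) auto
          show "integrable M (\<lambda>\<omega>. 2 * C * Z 1 \<omega>)" using int by simp
          fix \<omega>
          define z where "z = Z 1 \<omega>"
          have z: "0 \<le> z" by (simp add: z_def nonneg)
          show "(\<Sum>n<N. (h n (Z 1 \<omega>))\<^sup>2 / real (k n)) \<le> 2 * C * Z 1 \<omega>"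
          proof (cases "z = 0")
            case True
            then show ?thesis by (simp add: z_def[symmetric] h_def)
          next
            case False
            then have z0: "z > 0" using z by simp
            have "(h n z)\<^sup>2 / real (k n) \<le> z\<^sup>2 * (if z / 2 \<le> \<alpha>^n then 1 / \<alpha>^n else 0)" for n
            proof (cases "z \<le> real (k n)")
              case True
              then have "z / 2 \<le> \<alpha>^n" using k(2)[of n] by linarith
              moreover have "z\<^sup>2 / real (k n) \<le> z\<^sup>2 / \<alpha>^n"
                using k(1)[of n] \<alpha>1[of n] k1[of n] by (intro divide_left_mono) auto
              ultimately show ?thesis using True by (simp add: h_def)
            next
              case False
              then show ?thesis using \<alpha>1[of n] by (auto simp: h_def)
            qed
            then have "(\<Sum>n<N. (h n z)\<^sup>2 / real (k n)) \<le> (\<Sum>n<N. z\<^sup>2 * (if z / 2 \<le> \<alpha>^n then 1 / \<alpha>^n else 0))"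
              by (intro sum_mono)
            also have "\<dots> \<le> z\<^sup>2 * (\<alpha> / (\<alpha> - 1) / (z / 2))"
              unfolding sum_distrib_left[symmetric]
              using z0 \<alpha> by (intro mult_left_mono sum_inverse_power_above_le) auto
            also have "\<dots> = 2 * C * z" using z0 by (simp add: C_def power2_eq_square)
            finally show ?thesis by (simp add: z_def)
          qed
        qed
        also have "\<dots> = 2 * C * \<mu>" by (simp add: \<mu>_def)
        finally show "(\<Sum>n<N. v n / real (k n)) \<le> 2 * C * \<mu>" .
      qed
      then show "summable (\<lambda>n. expectation (\<lambda>\<omega>. (Y n \<omega>)\<^sup>2))"
        by (rule summable_comparison_test') (use Y_le in auto)
    qed
    moreover have "AE \<omega> in M. \<forall>\<^sub>F n in sequentially. \<omega> \<in> space M - {\<omega> \<in> space M. \<exists>i\<in>{1..k n}. real (k n) < Z i \<omega>}"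
    proof (rule borel_cantelli_AE1)
      have sets: "{\<omega> \<in> space M. real (k n) < Z i \<omega>} \<in> events" if "i \<ge> 1" for n i
        using meas[OF that] by measurable
      have eq: "{\<omega> \<in> space M. \<exists>i\<in>{1..k n}. real (k n) < Z i \<omega>} = (\<Union>i\<in>{1..k n}. {\<omega> \<in> space M. real (k n) < Z i \<omega>})" for n
        by auto
      show "{\<omega> \<in> space M. \<exists>i\<in>{1..k n}. real (k n) < Z i \<omega>} \<in> events" for n
        unfolding eq using sets by (intro sets.finite_UN) auto
      show "emeasure M {\<omega> \<in> space M. \<exists>i\<in>{1..k n}. real (k n) < Z i \<omega>} < \<infinity>" for n
        by (simp add: less_top[symmetric])
      define p where "p n = prob {\<omega> \<in> space M. real (k n) < Z 1 \<omega>}" for n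
      have p: "p n = expectation (\<lambda>\<omega>. indicator {real (k n)<..} (Z 1 \<omega>))" for n
      proof -
        have "expectation (\<lambda>\<omega>. indicat_real {real (k n)<..} (Z 1 \<omega>)) =
            expectation (indicat_real {\<omega> \<in> space M. real (k n) < Z 1 \<omega>})"
          by (intro Bochner_Integration.integral_cong) (auto simp: indicator_def)
        also have "\<dots> = p n" by (simp add: Bochner_Integration.integral_indicator p_def Int_def conj_commute)
        finally show ?thesis ..
      qed
      have prob_i: "prob {\<omega> \<in> space M. real (k n) < Z i \<omega>} = p n" if "i \<ge> 1" for n i
        using measure_distr[OF meas[OF that], of "{real (k n)<..}"]
          measure_distr[OF meas1, of "{real (k n)<..}"] dist[OF that]
        by (simp add: p_def vimage_def Int_def conj_commute)
      have le: "prob {\<omega> \<in> space M. \<exists>i\<in>{1..k n}. real (k n) < Z i \<omega>} \<le> real (k n) * p n" for n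
      proof -
        have "prob {\<omega> \<in> space M. \<exists>i\<in>{1..k n}. real (k n) < Z i \<omega>}
            \<le> (\<Sum>i\<in>{1..k n}. prob {\<omega> \<in> space M. real (k n) < Z i \<omega>})"
          unfolding eq using sets by (intro finite_measure_subadditive_finite) auto
        also have "\<dots> = real (k n) * p n" by (simp add: prob_i)
        finally show ?thesis .
      qed
      \<comment> \<open>The same exchange: \<open>real (k n) < z\<close> forces
        \<open>\<alpha>^n < z\<close>, while \<open>real (k n) \<le> 2 * \<alpha>^n\<close>.\<close>
      have "summable (\<lambda>n. real (k n) * p n)"
      proof (rule summableI_nonneg_bounded[where x = "2 * C * \<mu>"])
        show "0 \<le> real (k n) * p n" for n by (simp add: p_def)
        fix N
        have "(\<Sum>n<N. real (k n) * p n) = expectation (\<lambda>\<omega>. \<Sum>n<N. real (k n) * indicator {real (k n)<..} (Z 1 \<omega>))"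
          unfolding p
          by (subst Bochner_Integration.integral_sum)
             (auto intro!: integrable_mult_right integrable_const_bound[where B = 1] simp: indicator_def)
        also have "\<dots> \<le> expectation (\<lambda>\<omega>. 2 * C * Z 1 \<omega>)"
        proof (rule integral_mono)
          show "integrable M (\<lambda>\<omega>. \<Sum>n<N. real (k n) * indicator {real (k n)<..} (Z 1 \<omega>))"
            by (intro Bochner_Integration.integrable_sum integrable_mult_right integrable_const_bound[where B = 1])
               (auto simp: indicator_def)
          show "integrable M (\<lambda>\<omega>. 2 * C * Z 1 \<omega>)" using int by simp
          fix \<omega>
          define z where "z = Z 1 \<omega>"
          have "real (k n) * indicator {real (k n)<..} z \<le> 2 * (if \<alpha>^n < z then \<alpha>^n else 0)" for n
            using k[of n] \<alpha>1[of n] by (auto simp: indicator_def)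
          then have "(\<Sum>n<N. real (k n) * indicator {real (k n)<..} z) \<le> (\<Sum>n<N. 2 * (if \<alpha>^n < z then \<alpha>^n else 0))"
            by (intro sum_mono)
          also have "\<dots> \<le> 2 * (\<alpha> / (\<alpha> - 1) * z)"
            unfolding sum_distrib_left[symmetric]
            using \<alpha> nonneg by (intro mult_left_mono sum_power_below_le) (auto simp: z_def)
          finally show "(\<Sum>n<N. real (k n) * indicator {real (k n)<..} (Z 1 \<omega>)) \<le> 2 * C * Z 1 \<omega>"
            by (simp add: z_def C_def)
        qed
        also have "\<dots> = 2 * C * \<mu>" by (simp add: \<mu>_def)
        finally show "(\<Sum>n<N. real (k n) * p n) \<le> 2 * C * \<mu>" .
      qed
      then show "summable (\<lambda>n. prob {\<omega> \<in> space M. \<exists>i\<in>{1..k n}. real (k n) < Z i \<omega>})"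
        by (rule summable_comparison_test') (use le in auto)
    qed
    ultimately show ?thesis
      unfolding k_def[symmetric]
    proof eventually_elim
      case (elim \<omega>)
      have "(\<lambda>n. Y n \<omega> + \<mu>' n) \<longlonglongrightarrow> 0 + \<mu>" by (intro tendsto_intros elim \<mu>')
      moreover have "\<forall>\<^sub>F n in sequentially. Y n \<omega> + \<mu>' n = (\<Sum>i=1..k n. Z i \<omega>) / real (k n)"
        using elim(2)
      proof eventually_elim
        case (elim n)
        then have "h n (Z i \<omega>) = Z i \<omega>" if "i \<in> {1..k n}" for i
          using that by (auto simp: h_def not_less)
        then have "(\<Sum>i=1..k n. U n i \<omega>) = (\<Sum>i=1..k n. Z i \<omega>) - real (k n) * \<mu>' n"
          by (simp add: U_def sum_subtractf)
        then show ?case using k1[of n] by (simp add: Y_def diff_divide_distrib)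
      qed
      ultimately show ?case by (simp add: tendsto_cong)
    qed
  qed
  \<comment> \<open>Only countably many ratios \<open>\<alpha>\<close> are used, so one null set
    serves all of them.\<close>
  have "AE \<omega> in M. \<forall>m. (\<lambda>n. (\<Sum>i=1..nat \<lceil>(1 + 1 / real (Suc m))^n\<rceil>. Z i \<omega>) / real (nat \<lceil>(1 + 1 / real (Suc m))^n\<rceil>)) \<longlonglongrightarrow> \<mu>"
    unfolding AE_all_countable by (intro allI sub) simp
  then show ?thesis
    unfolding \<mu>_def[symmetric]
  proof eventually_elim
    case (elim \<omega>)
    show ?case
    proof (rule average_tendsto_if_geometric_subsequences)
      show "incseq (\<lambda>n. \<Sum>i=1..n. Z i \<omega>)"
        unfolding incseq_def by (intro allI impI sum_mono2) (auto simp: nonneg)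
    qed (use elim in \<open>auto simp: nonneg sum_nonneg\<close>)
  qed
qed

section \<open>Centred square-integrable random elements\<close>

lemma orthogonal_compD: "v \<in> orthogonal_comp V \<Longrightarrow> u \<in> V \<Longrightarrow> inner u v = 0"
  by (simp add: orthogonal_comp_def orthogonal_def)

lemma closed_orthogonal_comp: "closed (orthogonal_comp V)"
proof -
  have "orthogonal_comp V = (\<Inter>u\<in>V. {v. inner u v = 0})"
    by (auto simp: orthogonal_comp_def orthogonal_def)
  also have "closed \<dots>"
    by (intro closed_INT ballI closed_Collect_eq continuous_intros)
  finally show ?thesis .
qed

lemma subspace_closed_span: "subspace (closed_span A)"
  and closed_closed_span: "closed (closed_span A)"
  and subset_closed_span: "A \<subseteq> closed_span A"
proof -
  have "subspace (closed_span A) \<and> closed (closed_span A)"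
    unfolding closed_span_def
    by (rule hull_in) (auto intro: subspace_Inter closed_Inter)
  then show "subspace (closed_span A)" "closed (closed_span A)" by auto
  show "A \<subseteq> closed_span A" unfolding closed_span_def by (rule hull_subset)
qed

lemma closed_span_minimal: "A \<subseteq> V \<Longrightarrow> subspace V \<Longrightarrow> closed V \<Longrightarrow> closed_span A \<subseteq> V"
  unfolding closed_span_def by (rule hull_minimal) auto

text \<open>A point outside the support has a basic open neighbourhood of mass zero, and by second
  countability there are only countably many of these to avoid.\<close>

lemma AE_in_law_support:
  fixes X :: "'w \<Rightarrow> 'a :: second_countable_topology"
  assumes X [measurable]: "X \<in> borel_measurable M"
  shows "AE \<omega> in M. X \<omega> \<in> law_support M X"
proof -
  obtain B :: "'a set set" where B: "countable B" "topological_basis B"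
    using ex_countable_basis by blast
  define N where "N = {U \<in> B. emeasure (distr M borel X) U = 0}"
  have "countable N" using B(1) by (simp add: N_def)
  have op: "open U" if "U \<in> N" for U
    using that topological_basis_open[OF B(2)] by (simp add: N_def)
  have "AE \<omega> in M. X \<omega> \<notin> U" if "U \<in> N" for U
  proof -
    have "emeasure M (X -` U \<inter> space M) = 0"
      using that op[OF that] by (simp add: N_def emeasure_distr)
    then have "X -` U \<inter> space M \<in> null_sets M"
      using op[OF that] by (intro null_setsI measurable_sets[OF X]) auto
    then show ?thesis by (rule AE_I') auto
  qed
  then have "AE \<omega> in M. \<forall>U\<in>N. X \<omega> \<notin> U"
    by (subst AE_ball_countable[OF \<open>countable N\<close>]) simp
  then show ?thesis
  proof eventually_elim
    case (elim \<omega>)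
    show ?case
      unfolding law_support_def mem_Collect_eq
    proof (intro allI impI)
      fix U assume U: "open U" "X \<omega> \<in> U"
      then obtain V where V: "V \<in> B" "X \<omega> \<in> V" "V \<subseteq> U"
        using topological_basisE[OF B(2)] by metis
      then have "V \<notin> N" using elim by blast
      then have "0 < emeasure (distr M borel X) V" using V(1) by (simp add: N_def zero_less_iff_neq_zero)
      also have "\<dots> \<le> emeasure (distr M borel X) U" using U V by (intro emeasure_mono) auto
      finally show "0 < emeasure (distr M borel X) U" .
    qed
  qed
qed

locale centred_element = prob_space M
  for M :: "'w measure" +
  fixes X :: "'w \<Rightarrow> 'a :: {real_inner, banach, second_countable_topology}"
  assumes X_meas [measurable]: "X \<in> borel_measurable M"
    and X_square: "integrable M (\<lambda>\<omega>. (norm (X \<omega>))\<^sup>2)"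
    and X_mean: "integral\<^sup>L M X = 0"
begin

definition total_var :: real where
  "total_var = expectation (\<lambda>\<omega>. (norm (X \<omega>))\<^sup>2)"

definition cov_form :: "'a \<Rightarrow> 'a \<Rightarrow> real" where
  "cov_form a b = expectation (\<lambda>\<omega>. inner (X \<omega>) a * inner (X \<omega>) b)"

text \<open>The covariance operator on the whole space, as a Bochner integral; since
  \<open>X\<close> is centred, \<open>cov_form\<close> is its bilinear form.\<close>

definition cov_map :: "'a \<Rightarrow> 'a" where
  "cov_map a = (LINT \<omega>|M. inner (X \<omega>) a *\<^sub>R X \<omega>)"

definition S :: "'a set" where
  "S = closed_span (law_support M X)"

lemma integrable_X: "integrable M X"
proof (rule Bochner_Integration.integrable_bound)
  show "integrable M (\<lambda>\<omega>. 1 + (norm (X \<omega>))\<^sup>2)" using X_square by simp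
  have "r \<le> 1 + r\<^sup>2" for r :: real
  proof -
    have "0 \<le> (r - 1)\<^sup>2 + r\<^sup>2 + 1" by simp
    then show ?thesis by (simp add: power2_diff)
  qed
  then show "AE \<omega> in M. norm (X \<omega>) \<le> norm (1 + (norm (X \<omega>))\<^sup>2)" by (auto simp: abs_of_nonneg)
qed simp

lemma abs_inner_mult_inner_le: "\<bar>inner z a * inner z b\<bar> \<le> (norm z)\<^sup>2 * (norm a * norm b)"
  for z a b :: 'a
proof -
  have "\<bar>inner z a\<bar> * \<bar>inner z b\<bar> \<le> (norm z * norm a) * (norm z * norm b)"
    by (intro mult_mono Cauchy_Schwarz_ineq2) auto
  then show ?thesis by (simp add: abs_mult power2_eq_square mult_ac)
qed

lemma integrable_inner_mult_inner: "integrable M (\<lambda>\<omega>. inner (X \<omega>) a * inner (X \<omega>) b)"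
proof (rule Bochner_Integration.integrable_bound)
  show "integrable M (\<lambda>\<omega>. (norm (X \<omega>))\<^sup>2 * (norm a * norm b))" using X_square by simp
  show "AE \<omega> in M. norm (inner (X \<omega>) a * inner (X \<omega>) b) \<le> norm ((norm (X \<omega>))\<^sup>2 * (norm a * norm b))"
    using abs_inner_mult_inner_le by auto
qed simp

lemma abs_cov_form_le: "\<bar>cov_form a b\<bar> \<le> total_var * (norm a * norm b)"
proof -
  have "\<bar>cov_form a b\<bar> \<le> expectation (\<lambda>\<omega>. \<bar>inner (X \<omega>) a * inner (X \<omega>) b\<bar>)"
    unfolding cov_form_def by (rule integral_abs_bound)
  also have "\<dots> \<le> expectation (\<lambda>\<omega>. (norm (X \<omega>))\<^sup>2 * (norm a * norm b))"
    using X_square by (intro integral_mono integrable_abs integrable_inner_mult_inner abs_inner_mult_inner_le) simp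
  also have "\<dots> = total_var * (norm a * norm b)" by (simp add: total_var_def)
  finally show ?thesis .
qed

lemma total_var_nonneg: "0 \<le> total_var"
  by (simp add: total_var_def)

lemma cov_form_commute: "cov_form a b = cov_form b a"
  by (simp add: cov_form_def mult.commute)

lemma cov_form_nonneg: "0 \<le> cov_form a a"
  by (simp add: cov_form_def)

lemma linear_cov_form: "linear (\<lambda>a. cov_form a b)"
  by (rule linearI)
     (simp_all add: cov_form_def inner_add_right distrib_right integrable_inner_mult_inner mult.assoc)

lemma cov_form_diff_left: "cov_form (a - a') b = cov_form a b - cov_form a' b"
  by (rule linear_diff[OF linear_cov_form])

lemma integrable_inner_scaleR: "integrable M (\<lambda>\<omega>. inner (X \<omega>) a *\<^sub>R X \<omega>)"
proof (rule Bochner_Integration.integrable_bound)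
  show "integrable M (\<lambda>\<omega>. (norm (X \<omega>))\<^sup>2 * norm a)" using X_square by simp
  show "AE \<omega> in M. norm (inner (X \<omega>) a *\<^sub>R X \<omega>) \<le> norm ((norm (X \<omega>))\<^sup>2 * norm a)"
  proof (rule AE_I2)
    fix \<omega>
    have "\<bar>inner (X \<omega>) a\<bar> * norm (X \<omega>) \<le> (norm (X \<omega>) * norm a) * norm (X \<omega>)"
      by (intro mult_right_mono Cauchy_Schwarz_ineq2) auto
    then show "norm (inner (X \<omega>) a *\<^sub>R X \<omega>) \<le> norm ((norm (X \<omega>))\<^sup>2 * norm a)"
      by (simp add: power2_eq_square mult_ac)
  qed
qed simp

lemma inner_cov_map: "inner (cov_map a) b = cov_form a b"
proof -
  have "inner (cov_map a) b = (LINT \<omega>|M. inner (inner (X \<omega>) a *\<^sub>R X \<omega>) b)"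
    unfolding cov_map_def using integrable_inner_scaleR by (subst integral_inner_left) auto
  then show ?thesis by (simp add: cov_form_def)
qed

lemma linear_cov_map: "linear cov_map"
proof (rule linearI)
  show "cov_map (a + b) = cov_map a + cov_map b" for a b
    by (simp add: cov_map_def inner_add_right scaleR_add_left integrable_inner_scaleR)
  show "cov_map (c *\<^sub>R a) = c *\<^sub>R cov_map a" for c a
    by (simp add: cov_map_def flip: scaleR_scaleR)
qed

lemma expectation_inner: "expectation (\<lambda>\<omega>. inner (X \<omega>) a) = 0"
  using integral_inner_left[of a M X] integrable_X X_mean by simp

lemma variance_inner: "variance (\<lambda>\<omega>. inner (X \<omega>) a) = cov_form a a"
  by (simp add: expectation_inner cov_form_def power2_eq_square)

lemma covariance_inner: "covariance M (\<lambda>\<omega>. inner (X \<omega>) a) (\<lambda>\<omega>. inner (X \<omega>) b) = cov_form a b"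
  by (simp add: covariance_def expectation_inner cov_form_def)

lemma subspace_S: "subspace S" and closed_S: "closed S"
  by (simp_all add: S_def subspace_closed_span closed_closed_span)

lemma AE_in_S: "AE \<omega> in M. X \<omega> \<in> S"
  using AE_in_law_support[OF X_meas] subset_closed_span unfolding S_def by (auto elim: eventually_mono)

text \<open>\<open>X\<close> lies in \<open>S\<close> almost surely. Thus the component of the
  regression function orthogonal to \<open>S\<close> is invisible to all second moments and cannot
  be estimated.\<close>

lemma cov_form_orthogonal_S:
  assumes "v \<in> orthogonal_comp S"
  shows "cov_form v b = 0"
proof -
  have "AE \<omega> in M. inner (X \<omega>) v * inner (X \<omega>) b = 0"
    using AE_in_S by eventually_elim (simp add: orthogonal_compD[OF assms])
  then show ?thesis unfolding cov_form_def by (rule integral_eq_zero_AE)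
qed

text \<open>A direction of zero variance is orthogonal to the support of the law, hence to \<open>S\<close>.\<close>

lemma cov_form_definite:
  assumes "a \<in> S" "cov_form a a = 0"
  shows "a = 0"
proof -
  have "AE \<omega> in M. inner (X \<omega>) a * inner (X \<omega>) a = 0"
    using assms(2) integrable_inner_mult_inner[of a a]
    unfolding cov_form_def by (subst (asm) integral_nonneg_eq_0_iff_AE) auto
  then have ae: "AE \<omega> in M. inner (X \<omega>) a = 0" by simp
  have "law_support M X \<subseteq> orthogonal_comp {a}"
  proof
    fix z assume z: "z \<in> law_support M X"
    \<comment> \<open>This open set carries no mass, so it contains no point of the support.\<close>
    have op: "open {z. inner z a \<noteq> 0}" by (intro open_Collect_neq continuous_intros)
    have "emeasure (distr M borel X) {z. inner z a \<noteq> 0} = emeasure M (X -` {z. inner z a \<noteq> 0} \<inter> space M)"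
      using op by (intro emeasure_distr) auto
    also have "\<dots> = 0"
      using ae by (subst AE_iff_measurable[symmetric, where P = "\<lambda>\<omega>. inner (X \<omega>) a = 0"])
        (auto intro!: measurable_sets[OF X_meas] borel_open op)
    finally have "inner z a = 0" using z op by (auto simp: law_support_def)
    then show "z \<in> orthogonal_comp {a}"
      by (simp add: orthogonal_comp_def orthogonal_def inner_commute)
  qed
  then have "S \<subseteq> orthogonal_comp {a}"
    unfolding S_def by (rule closed_span_minimal[OF _ subspace_orthogonal_comp closed_orthogonal_comp])
  then have "inner a a = 0" using assms(1) orthogonal_compD by blast
  then show "a = 0" by simp
qed

subsection \<open>Karhunen--Loeve bases\<close>

context
  fixes V :: "'a set" and d :: nat and \<psi> :: "nat \<Rightarrow> 'a"
  assumes kl: "kl_basis M X V d \<psi>"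
begin

lemma kl_orthonormal: "orthonormal_upto d \<psi>"
  using kl unfolding kl_basis_def orthonormal_upto_def orthogonal_def by (auto simp: dot_square_norm)

lemma kl_span: "V = span (\<psi> ` {1..d})"
  using kl by (simp add: kl_basis_def)

lemma kl_subspace: "subspace V"
  by (simp add: kl_span)

lemma kl_in: "i \<in> {1..d} \<Longrightarrow> \<psi> i \<in> V"
  unfolding kl_span by (intro span_base) auto

lemma kl_basis_trunc_in: "k \<le> d \<Longrightarrow> basis_trunc \<psi> k b \<in> V"
  unfolding kl_span by (rule basis_trunc_in_span)

lemma kl_antimono: "i \<in> {1..d} \<Longrightarrow> j \<in> {1..d} \<Longrightarrow> i \<le> j \<Longrightarrow> cov_form (\<psi> j) (\<psi> j) \<le> cov_form (\<psi> i) (\<psi> i)"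
  using kl by (simp add: kl_basis_def variance_inner)

text \<open>Pairing the eigenvalue equation with \<open>\<psi> j\<close> under the integral gives
  the covariance. The equation concerns the projected element, but projection onto \<open>V\<close>
  does not change inner products with the basis.\<close>

lemma cov_form_kl:
  assumes ij: "i \<in> {1..d}" "j \<in> {1..d}"
  shows "cov_form (\<psi> i) (\<psi> j) = (if i = j then cov_form (\<psi> i) (\<psi> i) else 0)"
proof (cases "i = j")
  case False
  define Z where "Z \<omega> = basis_trunc \<psi> d (X \<omega>)" for \<omega>
  have Z_meas [measurable]: "Z \<in> borel_measurable M"
    unfolding Z_def basis_trunc_def by measurable
  have int_inner: "integrable M (\<lambda>\<omega>. inner (X \<omega>) a)" for a
    using integrable_X by (intro integrable_inner_left)
  have "integral\<^sup>L M Z = (\<Sum>i=1..d. (LINT \<omega>|M. inner (X \<omega>) (\<psi> i)) *\<^sub>R \<psi> i)"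
    unfolding Z_def basis_trunc_def using int_inner
    by (subst Bochner_Integration.integral_sum) (auto intro!: integrable_scaleR_left)
  then have EZ: "integral\<^sup>L M Z = 0" by (simp add: expectation_inner)
  have Z_inner: "inner (Z \<omega>) (\<psi> l) = inner (X \<omega>) (\<psi> l)" if "l \<in> {1..d}" for l \<omega>
    unfolding Z_def by (rule inner_basis_trunc_basis[OF kl_orthonormal that])
  have int: "integrable M (\<lambda>\<omega>. inner (X \<omega>) (\<psi> i) *\<^sub>R Z \<omega>)"
  proof (rule Bochner_Integration.integrable_bound)
    show "integrable M (\<lambda>\<omega>. inner (X \<omega>) (\<psi> i) *\<^sub>R X \<omega>)" by (rule integrable_inner_scaleR)
    show "AE \<omega> in M. norm (inner (X \<omega>) (\<psi> i) *\<^sub>R Z \<omega>) \<le> norm (inner (X \<omega>) (\<psi> i) *\<^sub>R X \<omega>)"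
      using norm_basis_trunc_le[OF kl_orthonormal] by (auto simp: Z_def intro!: mult_left_mono)
  qed simp
  have "cov_operator M (\<lambda>\<omega>. orth_proj V (X \<omega>)) (\<psi> i) = cov_form (\<psi> i) (\<psi> i) *\<^sub>R \<psi> i"
    using kl ij by (simp add: kl_basis_def variance_inner)
  moreover have "(\<lambda>\<omega>. orth_proj V (X \<omega>)) = Z"
    unfolding Z_def kl_span using orth_proj_span_eq[OF kl_orthonormal] by auto
  moreover have "cov_operator M Z (\<psi> i) = (LINT \<omega>|M. inner (X \<omega>) (\<psi> i) *\<^sub>R Z \<omega>)"
    by (simp add: cov_operator_def EZ Z_inner[OF ij(1)])
  ultimately have "(LINT \<omega>|M. inner (X \<omega>) (\<psi> i) *\<^sub>R Z \<omega>) = cov_form (\<psi> i) (\<psi> i) *\<^sub>R \<psi> i" by simp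
  then have "inner (LINT \<omega>|M. inner (X \<omega>) (\<psi> i) *\<^sub>R Z \<omega>) (\<psi> j) = 0"
    using orthonormal_uptoD[OF kl_orthonormal ij] False by simp
  moreover have "inner (LINT \<omega>|M. inner (X \<omega>) (\<psi> i) *\<^sub>R Z \<omega>) (\<psi> j) = cov_form (\<psi> i) (\<psi> j)"
    using integral_inner_left[of "\<psi> j" M "\<lambda>\<omega>. inner (X \<omega>) (\<psi> i) *\<^sub>R Z \<omega>"] int
    by (simp add: cov_form_def Z_inner[OF ij(2)])
  ultimately show ?thesis using False by simp
qed simp

text \<open>Expansion of \<open>b\<close> and diagonality. For \<open>b\<close> outside
  \<open>V\<close> the two sides differ by the covariance with the residual of \<open>b\<close>,
  which is the source of the bias.\<close>

lemma cov_form_kl_left: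
  assumes b: "b \<in> V" and i: "i \<in> {1..d}"
  shows "cov_form b (\<psi> i) = cov_form (\<psi> i) (\<psi> i) * inner b (\<psi> i)"
proof -
  have "cov_form b (\<psi> i) = cov_form (basis_trunc \<psi> d b) (\<psi> i)"
    using basis_trunc_eq_self[OF kl_orthonormal, of b] b by (simp add: kl_span)
  also have "\<dots> = (\<Sum>j=1..d. inner b (\<psi> j) * cov_form (\<psi> j) (\<psi> i))"
    unfolding basis_trunc_def by (simp add: linear_sum[OF linear_cov_form] linear_scale[OF linear_cov_form])
  also have "\<dots> = (\<Sum>j=1..d. if j = i then cov_form (\<psi> i) (\<psi> i) * inner b (\<psi> i) else 0)"
  proof (rule sum.cong[OF refl])
    fix j assume j: "j \<in> {1..d}"
    show "inner b (\<psi> j) * cov_form (\<psi> j) (\<psi> i) = (if j = i then cov_form (\<psi> i) (\<psi> i) * inner b (\<psi> i) else 0)"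
    proof (cases "j = i")
      case False
      then show ?thesis using cov_form_kl[OF j i] by simp
    qed simp
  qed
  finally show ?thesis using i by simp
qed

lemma cov_form_kl_self:
  assumes b: "b \<in> V"
  shows "cov_form b b = (\<Sum>i=1..d. cov_form (\<psi> i) (\<psi> i) * (inner b (\<psi> i))\<^sup>2)"
proof -
  have "cov_form b b = cov_form (basis_trunc \<psi> d b) b"
    using basis_trunc_eq_self[OF kl_orthonormal, of b] b by (simp add: kl_span)
  also have "\<dots> = (\<Sum>i=1..d. inner b (\<psi> i) * cov_form (\<psi> i) b)"
    unfolding basis_trunc_def by (simp add: linear_sum[OF linear_cov_form] linear_scale[OF linear_cov_form])
  also have "\<dots> = (\<Sum>i=1..d. cov_form (\<psi> i) (\<psi> i) * (inner b (\<psi> i))\<^sup>2)"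
    using b by (intro sum.cong refl)
      (simp add: cov_form_commute[of _ b] cov_form_kl_left power2_eq_square)
  finally show ?thesis .
qed

lemma norm_kl: "b \<in> V \<Longrightarrow> (norm b)\<^sup>2 = (\<Sum>i=1..d. (inner b (\<psi> i))\<^sup>2)"
  using norm_sum_basis[OF kl_orthonormal, of "\<lambda>i. inner b (\<psi> i)"] basis_trunc_eq_self[OF kl_orthonormal, of b]
  by (simp add: kl_span basis_trunc_def)

text \<open>A trace bound: by monotonicity \<open>k\<close> times the \<open>k\<close>-th eigenvalue
  is at most the sum of the first \<open>k\<close>, which Bessel's inequality bounds by
  \<open>total_var\<close>.\<close>

lemma kl_eigenvalue_le:
  assumes "k \<in> {1..d}"
  shows "cov_form (\<psi> k) (\<psi> k) \<le> total_var / real k"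
proof -
  have on: "orthonormal_upto k \<psi>" using kl_orthonormal assms by (simp add: orthonormal_upto_mono)
  have "real k * cov_form (\<psi> k) (\<psi> k) = (\<Sum>i=1..k. cov_form (\<psi> k) (\<psi> k))" by simp
  also have "\<dots> \<le> (\<Sum>i=1..k. cov_form (\<psi> i) (\<psi> i))"
    using assms by (intro sum_mono kl_antimono) auto
  also have "\<dots> = expectation (\<lambda>\<omega>. \<Sum>i=1..k. (inner (X \<omega>) (\<psi> i))\<^sup>2)"
    unfolding cov_form_def power2_eq_square
    by (subst Bochner_Integration.integral_sum) (auto simp: integrable_inner_mult_inner)
  also have "\<dots> \<le> total_var"
    unfolding total_var_def
    by (intro integral_mono X_square sum_square_inner_le on Bochner_Integration.integrable_sum)
       (simp add: power2_eq_square integrable_inner_mult_inner)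
  finally show ?thesis using assms by (simp add: field_simps)
qed

lemma kl_eigenvalue_pos:
  assumes "V \<subseteq> S" "i \<in> {1..d}"
  shows "0 < cov_form (\<psi> i) (\<psi> i)"
proof -
  have "\<psi> i \<noteq> 0" using orthonormal_uptoD[OF kl_orthonormal assms(2) assms(2)] by auto
  then have "cov_form (\<psi> i) (\<psi> i) \<noteq> 0" using cov_form_definite kl_in assms by blast
  then show ?thesis using cov_form_nonneg[of "\<psi> i"] by simp
qed

lemma norm_basis_trunc_diff_le:
  assumes "k \<le> d"
  shows "norm (basis_trunc \<psi> d b - basis_trunc \<psi> k b) \<le> 2 * norm b"
proof -
  have "orthonormal_upto k \<psi>" using kl_orthonormal assms by (rule orthonormal_upto_mono)
  then show ?thesis
    using norm_triangle_ineq4[of "basis_trunc \<psi> d b" "basis_trunc \<psi> k b"]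
      norm_basis_trunc_le[OF kl_orthonormal, of b] norm_basis_trunc_le[of k \<psi> b] by linarith
qed

text \<open>The coefficients of \<open>cov_map w\<close> are \<open>\<lambda>\<^sub>i \<langle>w, \<psi>\<^sub>i\<rangle>\<close>, and \<open>\<lambda>\<^sub>i \<le> total_var / k\<close> for \<open>i > k\<close>: this tail
  bound does not depend on \<open>d\<close>.\<close>

lemma norm_cov_map_tail_le:
  assumes w: "w \<in> V" and k: "k \<in> {1..d}"
  shows "norm (basis_trunc \<psi> d (cov_map w) - basis_trunc \<psi> k (cov_map w)) \<le> total_var / real k * norm w"
proof -
  \<comment> \<open>Padding the tail with zeros lets the norm formula for the full basis
    apply.\<close>
  define c where "c i = (if i \<le> k then 0 else inner (cov_map w) (\<psi> i))" for i
  have "basis_trunc \<psi> d (cov_map w) = (\<Sum>i\<in>{1..k} \<union> {k<..d}. inner (cov_map w) (\<psi> i) *\<^sub>R \<psi> i)"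
    unfolding basis_trunc_def using k by (intro sum.cong) auto
  also have "\<dots> = basis_trunc \<psi> k (cov_map w) + (\<Sum>i\<in>{k<..d}. inner (cov_map w) (\<psi> i) *\<^sub>R \<psi> i)"
    unfolding basis_trunc_def by (intro sum.union_disjoint) auto
  also have "(\<Sum>i\<in>{k<..d}. inner (cov_map w) (\<psi> i) *\<^sub>R \<psi> i) = (\<Sum>i=1..d. c i *\<^sub>R \<psi> i)"
    by (rule sum.mono_neutral_cong_left) (use k in \<open>auto simp: c_def\<close>)
  finally have "(norm (basis_trunc \<psi> d (cov_map w) - basis_trunc \<psi> k (cov_map w)))\<^sup>2 = (\<Sum>i=1..d. (c i)\<^sup>2)"
    by (simp add: norm_sum_basis[OF kl_orthonormal])
  also have "\<dots> \<le> (\<Sum>i=1..d. (total_var / real k)\<^sup>2 * (inner w (\<psi> i))\<^sup>2)"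
  proof (rule sum_mono)
    fix i assume i: "i \<in> {1..d}"
    show "(c i)\<^sup>2 \<le> (total_var / real k)\<^sup>2 * (inner w (\<psi> i))\<^sup>2"
    proof (cases "i \<le> k")
      case False
      have "cov_form (\<psi> i) (\<psi> i) \<le> total_var / real k"
        using kl_antimono[OF k i] kl_eigenvalue_le[OF k] False by linarith
      then have "(cov_form (\<psi> i) (\<psi> i))\<^sup>2 \<le> (total_var / real k)\<^sup>2"
        using cov_form_nonneg by (intro power_mono)
      then show ?thesis
        using False by (simp add: c_def inner_cov_map cov_form_kl_left[OF w i] power_mult_distrib mult_right_mono)
    qed (simp add: c_def)
  qed
  also have "\<dots> = (total_var / real k * norm w)\<^sup>2"
    unfolding power_mult_distrib norm_kl[OF w] sum_distrib_left ..
  finally show ?thesis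
    by (rule power2_le_imp_le) (simp add: total_var_nonneg)
qed

end

text \<open>One half of the Courant--Fischer principle: the eigenvalues grow with the space.\<close>

lemma kl_eigenvalue_mono:
  assumes kl: "kl_basis M X V d \<psi>" and kl': "kl_basis M X V' k \<psi>'"
    and sub: "V' \<subseteq> V" and k: "k \<in> {1..d}"
  shows "cov_form (\<psi>' k) (\<psi>' k) \<le> cov_form (\<psi> k) (\<psi> k)"
proof -
  note on = kl_orthonormal[OF kl] and on' = kl_orthonormal[OF kl']
  have "card (\<psi> ` {1..k - 1}) \<le> k - 1" using card_image_le[of "{1..k - 1}" \<psi>] by simp
  moreover have "1 \<le> k" using k by simp
  ultimately have "card (\<psi> ` {1..k - 1}) < card (\<psi>' ` {1..k})"
    unfolding orthonormal_upto_independent(2)[OF on'] by linarith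
  moreover have "basis_trunc \<psi> (k - 1) ` (\<psi>' ` {1..k}) \<subseteq> span (\<psi> ` {1..k - 1})"
    by (auto intro: basis_trunc_in_span)
  \<comment> \<open>A space of dimension \<open>k\<close> meets the kernel of \<open>k - 1\<close>
    coefficients. The Rayleigh quotient of this \<open>b\<close> is at least the \<open>k\<close>-th
    eigenvalue on \<open>V'\<close> and at most the one on \<open>V\<close>.\<close>
  ultimately obtain b where b: "b \<in> span (\<psi>' ` {1..k})" "b \<noteq> 0" "basis_trunc \<psi> (k - 1) b = 0"
    using linear_kernel_nontrivial[OF orthonormal_upto_independent(1)[OF on'] _ _ linear_basis_trunc]
    by (metis finite_atLeastAtMost finite_imageI)
  have b': "b \<in> V'" "b \<in> V" using b(1) sub kl_span[OF kl'] by auto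
  have "orthonormal_upto (k - 1) \<psi>" using on k by (auto intro: orthonormal_upto_mono)
  then have zero: "inner b (\<psi> i) = 0" if "i \<in> {1..k - 1}" for i
    using inner_basis_trunc_basis[of "k - 1" \<psi> i b] that b(3) by simp
  have "cov_form (\<psi>' k) (\<psi>' k) * (norm b)\<^sup>2 = (\<Sum>i=1..k. cov_form (\<psi>' k) (\<psi>' k) * (inner b (\<psi>' i))\<^sup>2)"
    by (simp add: norm_kl[OF kl' b'(1)] sum_distrib_left)
  also have "\<dots> \<le> (\<Sum>i=1..k. cov_form (\<psi>' i) (\<psi>' i) * (inner b (\<psi>' i))\<^sup>2)"
    using kl_antimono[OF kl'] k by (intro sum_mono mult_right_mono) auto
  also have "\<dots> = cov_form b b" by (rule cov_form_kl_self[OF kl' b'(1), symmetric])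
  also have "\<dots> = (\<Sum>i=1..d. cov_form (\<psi> i) (\<psi> i) * (inner b (\<psi> i))\<^sup>2)"
    by (rule cov_form_kl_self[OF kl b'(2)])
  also have "\<dots> \<le> (\<Sum>i=1..d. cov_form (\<psi> k) (\<psi> k) * (inner b (\<psi> i))\<^sup>2)"
  proof (rule sum_mono)
    fix i assume i: "i \<in> {1..d}"
    show "cov_form (\<psi> i) (\<psi> i) * (inner b (\<psi> i))\<^sup>2 \<le> cov_form (\<psi> k) (\<psi> k) * (inner b (\<psi> i))\<^sup>2"
    proof (cases "i < k")
      case True
      then show ?thesis using zero[of i] i by simp
    next
      case False
      then show ?thesis using kl_antimono[OF kl k i] by (intro mult_right_mono) auto
    qed
  qed
  also have "\<dots> = cov_form (\<psi> k) (\<psi> k) * (norm b)\<^sup>2"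
    by (simp add: norm_kl[OF kl b'(2)] sum_distrib_left)
  finally show ?thesis using b(2) by simp
qed

end

section \<open>Convergence of the empirical moments\<close>

lemma (in centred_element) integral_copy:
  assumes x: "x \<in> borel_measurable M" "distr M borel x = distr M borel X"
    and h: "h \<in> borel_measurable borel"
  shows "integrable M (\<lambda>\<omega>. h (x \<omega>) :: real) \<longleftrightarrow> integrable M (\<lambda>\<omega>. h (X \<omega>))"
    and "expectation (\<lambda>\<omega>. h (x \<omega>)) = expectation (\<lambda>\<omega>. h (X \<omega>))"
  using integrable_distr_eq[OF x(1) h] integrable_distr_eq[OF X_meas h]
    integral_distr[OF x(1) h] integral_distr[OF X_meas h] x(2) by simp_all

text \<open>The law for nonnegative variables applies to squares of coordinates; polarisation with
  \<open>a + b\<close> and \<open>a - b\<close> reaches the mixed products.\<close>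

lemma (in centred_element) empirical_cov_form_tendsto:
  assumes indep: "indep_vars (\<lambda>_. borel) x {1..}"
    and dist: "\<And>i. i \<ge> 1 \<Longrightarrow> distr M borel (x i) = distr M borel X"
  shows "AE \<omega> in M. (\<lambda>n. (\<Sum>i=1..n. inner (x i \<omega>) a * inner (x i \<omega>) b) / real n) \<longlonglongrightarrow> cov_form a b"
proof -
  have x: "x i \<in> borel_measurable M" if "i \<ge> 1" for i
    using indep that by (simp add: indep_vars_def)
  have sq: "AE \<omega> in M. (\<lambda>n. (\<Sum>i=1..n. (inner (x i \<omega>) a)\<^sup>2) / real n) \<longlonglongrightarrow> cov_form a a" for a
  proof -
    have meas: "(\<lambda>z. (inner z a)\<^sup>2) \<in> borel_measurable borel" by measurable
    have "AE \<omega> in M. (\<lambda>n. (\<Sum>i=1..n. (inner (x i \<omega>) a)\<^sup>2) / real n) \<longlonglongrightarrow> expectation (\<lambda>\<omega>. (inner (x 1 \<omega>) a)\<^sup>2)"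
    proof (rule slln_iid_nonneg)
      show "indep_vars (\<lambda>_. borel) (\<lambda>i \<omega>. (inner (x i \<omega>) a)\<^sup>2) {1..}"
        by (rule indep_vars_compose2[OF indep]) measurable
      show "integrable M (\<lambda>\<omega>. (inner (x 1 \<omega>) a)\<^sup>2)"
        using integral_copy(1)[OF x[OF order_refl] dist[OF order_refl] meas] integrable_inner_mult_inner[of a a]
        by (simp add: power2_eq_square)
      show "distr M borel (\<lambda>\<omega>. (inner (x i \<omega>) a)\<^sup>2) = distr M borel (\<lambda>\<omega>. (inner (x 1 \<omega>) a)\<^sup>2)"
        if "i \<ge> 1" for i
        using distr_distr[OF meas x[OF that]] distr_distr[OF meas x[OF order_refl]] dist[OF that] dist[OF order_refl]
        by (simp add: comp_def)
    qed simp
    then show ?thesis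
      using integral_copy(2)[OF x[OF order_refl] dist[OF order_refl] meas]
      by (simp add: cov_form_def power2_eq_square)
  qed
  have pol: "inner z a * inner z b = ((inner z (a + b))\<^sup>2 - (inner z (a - b))\<^sup>2) / 4" for z :: 'a
    by (simp add: inner_add_right inner_diff_right power2_eq_square algebra_simps)
  have "cov_form (a + b) (a + b) - cov_form (a - b) (a - b)
      = expectation (\<lambda>\<omega>. inner (X \<omega>) (a + b) * inner (X \<omega>) (a + b) - inner (X \<omega>) (a - b) * inner (X \<omega>) (a - b))"
    unfolding cov_form_def
    by (rule Bochner_Integration.integral_diff[symmetric]) (rule integrable_inner_mult_inner)+
  also have "\<dots> = expectation (\<lambda>\<omega>. 4 * (inner (X \<omega>) a * inner (X \<omega>) b))"
    by (intro Bochner_Integration.integral_cong refl) (simp add: pol power2_eq_square)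
  also have "\<dots> = 4 * cov_form a b" by (simp add: cov_form_def)
  finally have lim: "(cov_form (a + b) (a + b) - cov_form (a - b) (a - b)) / 4 = cov_form a b" by simp
  show ?thesis
    using sq[of "a + b"] sq[of "a - b"]
  proof eventually_elim
    case (elim \<omega>)
    have "(\<lambda>n. ((\<Sum>i=1..n. (inner (x i \<omega>) (a + b))\<^sup>2) / real n - (\<Sum>i=1..n. (inner (x i \<omega>) (a - b))\<^sup>2) / real n) / 4)
        \<longlonglongrightarrow> (cov_form (a + b) (a + b) - cov_form (a - b) (a - b)) / 4"
      by (intro tendsto_intros elim) simp
    then show ?case
      unfolding lim unfolding pol diff_divide_distrib sum_subtractf sum_divide_distrib[symmetric] by (simp add: mult_ac)
  qed
qed

text \<open>The preimages under \<open>f\<close> after \<open>U\<close> already form a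
  sigma-algebra, contained in the preimages under \<open>U\<close>; independence passes to
  subfamilies.\<close>

lemma (in prob_space) indep_elements_indep_var:
  fixes f g :: "_ \<Rightarrow> real"
  assumes "indep_elements M N U N' W"
    and f: "f \<in> borel_measurable N" and g: "g \<in> borel_measurable N'"
  shows "indep_var borel (\<lambda>\<omega>. f (U \<omega>)) borel (\<lambda>\<omega>. g (W \<omega>))"
proof -
  have U: "U \<in> measurable M N" and W: "W \<in> measurable M N'"
    and ind: "indep_set {U -` A \<inter> space M | A. A \<in> sets N} {W -` A \<inter> space M | A. A \<in> sets N'}"
    using assms(1) by (auto simp: indep_elements_def)
  have closed: "sigma_sets (space M) {(\<lambda>\<omega>. h (V \<omega>)) -` A \<inter> space M | A. A \<in> sets borel}
      \<subseteq> {V -` A \<inter> space M | A. A \<in> sets L}"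
    if V: "V \<in> measurable M L" and h: "h \<in> borel_measurable L"
    for V :: "'a \<Rightarrow> 'z" and L and h :: "'z \<Rightarrow> real"
  proof -
    have "sets (vimage_algebra (space M) (\<lambda>\<omega>. h (V \<omega>)) borel) = {(\<lambda>\<omega>. h (V \<omega>)) -` A \<inter> space M | A. A \<in> sets borel}"
      by (rule sets_vimage_algebra2) simp
    then have "sigma_sets (space M) {(\<lambda>\<omega>. h (V \<omega>)) -` A \<inter> space M | A. A \<in> sets borel}
        = {(\<lambda>\<omega>. h (V \<omega>)) -` A \<inter> space M | A. A \<in> sets borel}"
      using sets.sigma_sets_eq[of "vimage_algebra (space M) (\<lambda>\<omega>. h (V \<omega>)) borel"] by simp
    also have "\<dots> \<subseteq> {V -` A \<inter> space M | A. A \<in> sets L}"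
    proof safe
      fix A :: "real set" assume "A \<in> sets borel"
      then have "h -` A \<inter> space L \<in> sets L" using h by (rule measurable_sets[rotated])
      moreover have "(\<lambda>\<omega>. h (V \<omega>)) -` A \<inter> space M = V -` (h -` A \<inter> space L) \<inter> space M"
        using measurable_space[OF V] by auto
      ultimately show "\<exists>B. (\<lambda>\<omega>. h (V \<omega>)) -` A \<inter> space M = V -` B \<inter> space M \<and> B \<in> sets L" by blast
    qed
    finally show ?thesis .
  qed
  show ?thesis
    unfolding indep_var_eq
  proof (intro conjI)
    show "random_variable borel (\<lambda>\<omega>. f (U \<omega>))" using measurable_compose[OF U f] .
    show "random_variable borel (\<lambda>\<omega>. g (W \<omega>))" using measurable_compose[OF W g] .
    show "indep_set (sigma_sets (space M) {(\<lambda>\<omega>. f (U \<omega>)) -` A \<inter> space M | A. A \<in> sets borel})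
        (sigma_sets (space M) {(\<lambda>\<omega>. g (W \<omega>)) -` A \<inter> space M | A. A \<in> sets borel})"
      using ind unfolding indep_set_def
      by (rule indep_sets_mono_sets) (use closed[OF U f] closed[OF W g] in \<open>auto split: bool.split\<close>)
  qed
qed

lemma integrable_mult_of_squares:
  fixes f g :: "'a \<Rightarrow> real"
  assumes [measurable]: "f \<in> borel_measurable M" "g \<in> borel_measurable M"
    and int: "integrable M (\<lambda>\<omega>. (f \<omega>)\<^sup>2)" "integrable M (\<lambda>\<omega>. (g \<omega>)\<^sup>2)"
  shows "integrable M (\<lambda>\<omega>. f \<omega> * g \<omega>)"
proof (rule Bochner_Integration.integrable_bound)
  show "integrable M (\<lambda>\<omega>. (f \<omega>)\<^sup>2 + (g \<omega>)\<^sup>2)" using int by simp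
  have "\<bar>a * b\<bar> \<le> a\<^sup>2 + b\<^sup>2" for a b :: real
  proof -
    have "0 \<le> (\<bar>a\<bar> - \<bar>b\<bar>)\<^sup>2 + \<bar>a\<bar>\<^sup>2 + \<bar>b\<bar>\<^sup>2" by (intro add_nonneg_nonneg) auto
    then show ?thesis by (simp add: power2_diff abs_mult)
  qed
  then show "AE \<omega> in M. norm (f \<omega> * g \<omega>) \<le> norm ((f \<omega>)\<^sup>2 + (g \<omega>)\<^sup>2)" by auto
qed simp

text \<open>In a product of two summands the design factors and the noise factors can be grouped;
  independence of the two whole sequences factorises the expectation, and for distinct indices the
  noise part vanishes. All second moments equal \<open>cov_form a a * v\<close>.\<close>

lemma (in centred_element) noise_average_tendsto:
  fixes \<epsilon> :: "nat \<Rightarrow> 'w \<Rightarrow> real"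
  assumes indep_x: "indep_vars (\<lambda>_. borel) x {1..}"
    and dist: "\<And>i. i \<ge> 1 \<Longrightarrow> distr M borel (x i) = distr M borel X"
    and indep_\<epsilon>: "indep_vars (\<lambda>_. borel) \<epsilon> {1..}"
    and indep: "indep_elements M
           (PiM {1..} (\<lambda>_. borel)) (\<lambda>\<omega>. \<lambda>i\<in>{1..}. x i \<omega>)
           (PiM {1..} (\<lambda>_. borel)) (\<lambda>\<omega>. \<lambda>i\<in>{1..}. \<epsilon> i \<omega>)"
    and \<epsilon>: "\<And>i. i \<ge> 1 \<Longrightarrow> integrable M (\<epsilon> i)" "\<And>i. i \<ge> 1 \<Longrightarrow> integrable M (\<lambda>\<omega>. (\<epsilon> i \<omega>)\<^sup>2)"
    and mean: "\<And>i. i \<ge> 1 \<Longrightarrow> expectation (\<epsilon> i) = 0"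
    and var: "\<And>i. i \<ge> 1 \<Longrightarrow> variance (\<epsilon> i) = v"
  shows "AE \<omega> in M. (\<lambda>n. (\<Sum>i=1..n. \<epsilon> i \<omega> * inner (x i \<omega>) a) / real n) \<longlonglongrightarrow> 0"
proof (rule slln_uncorrelated)
  have x: "x i \<in> borel_measurable M" if "i \<ge> 1" for i
    using indep_x that by (simp add: indep_vars_def)
  have xa: "(\<lambda>\<omega>. inner (x i \<omega>) a) \<in> borel_measurable M" if "i \<ge> 1" for i
    using x[OF that] by measurable
  have meas: "(\<lambda>z. (inner z a)\<^sup>2) \<in> borel_measurable borel" by measurable
  have x2: "integrable M (\<lambda>\<omega>. (inner (x i \<omega>) a)\<^sup>2)" "expectation (\<lambda>\<omega>. (inner (x i \<omega>) a)\<^sup>2) = cov_form a a"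
    if "i \<ge> 1" for i
    using integral_copy[OF x[OF that] dist[OF that] meas] integrable_inner_mult_inner[of a a]
    by (simp_all add: cov_form_def power2_eq_square)
  have \<epsilon>_meas: "\<epsilon> i \<in> borel_measurable M" if "i \<ge> 1" for i
    using \<epsilon>(1)[OF that] by simp
  have eq: "(\<epsilon> i \<omega> * inner (x i \<omega>) a) * (\<epsilon> j \<omega> * inner (x j \<omega>) a)
      = (inner (x i \<omega>) a * inner (x j \<omega>) a) * (\<epsilon> i \<omega> * \<epsilon> j \<omega>)" for i j \<omega>
    by simp
  have int_x: "integrable M (\<lambda>\<omega>. inner (x i \<omega>) a * inner (x j \<omega>) a)" if "i \<ge> 1" "j \<ge> 1" for i j
    using that by (intro integrable_mult_of_squares xa x2)
  have int_\<epsilon>: "integrable M (\<lambda>\<omega>. \<epsilon> i \<omega> * \<epsilon> j \<omega>)" if "i \<ge> 1" "j \<ge> 1" for i j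
    using that by (intro integrable_mult_of_squares \<epsilon>_meas \<epsilon>)
  have iv: "indep_var borel (\<lambda>\<omega>. inner (x i \<omega>) a * inner (x j \<omega>) a) borel (\<lambda>\<omega>. \<epsilon> i \<omega> * \<epsilon> j \<omega>)"
    if "i \<ge> 1" "j \<ge> 1" for i j
  proof -
    have f: "(\<lambda>u. inner (u i) a * inner (u j) a) \<in> borel_measurable (PiM {1..} (\<lambda>_. borel :: 'a measure))"
      using that by (intro borel_measurable_times borel_measurable_inner measurable_component_singleton borel_measurable_const) auto
    have g: "(\<lambda>u. u i * u j) \<in> borel_measurable (PiM {1..} (\<lambda>_. borel :: real measure))"
      using that by (intro borel_measurable_times measurable_component_singleton) auto
    show ?thesis using indep_elements_indep_var[OF indep f g] that by simp
  qed
  show "(\<lambda>\<omega>. \<epsilon> i \<omega> * inner (x i \<omega>) a) \<in> borel_measurable M" if "i \<ge> 1" for i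
    using xa[OF that] \<epsilon>_meas[OF that] by measurable
  show "integrable M (\<lambda>\<omega>. (\<epsilon> i \<omega> * inner (x i \<omega>) a) * (\<epsilon> j \<omega> * inner (x j \<omega>) a))" if "i \<ge> 1" "j \<ge> 1" for i j
    unfolding eq by (intro indep_var_integrable iv int_x int_\<epsilon> that)
  have E: "expectation (\<lambda>\<omega>. (\<epsilon> i \<omega> * inner (x i \<omega>) a) * (\<epsilon> j \<omega> * inner (x j \<omega>) a))
      = expectation (\<lambda>\<omega>. inner (x i \<omega>) a * inner (x j \<omega>) a) * expectation (\<lambda>\<omega>. \<epsilon> i \<omega> * \<epsilon> j \<omega>)"
    if "i \<ge> 1" "j \<ge> 1" for i j
    unfolding eq by (intro indep_var_lebesgue_integral iv int_x int_\<epsilon> that)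
  show "expectation (\<lambda>\<omega>. (\<epsilon> i \<omega> * inner (x i \<omega>) a) * (\<epsilon> j \<omega> * inner (x j \<omega>) a)) = 0"
    if ij: "i \<ge> 1" "j \<ge> 1" "i \<noteq> j" for i j
  proof -
    have "indep_vars (\<lambda>_. borel) \<epsilon> {i, j}" by (rule indep_vars_subset[OF indep_\<epsilon>]) (use ij in auto)
    then have "expectation (\<lambda>\<omega>. \<Prod>l\<in>{i, j}. \<epsilon> l \<omega>) = (\<Prod>l\<in>{i, j}. expectation (\<epsilon> l))"
      by (intro indep_vars_lebesgue_integral) (use ij \<epsilon> in auto)
    then have "expectation (\<lambda>\<omega>. \<epsilon> i \<omega> * \<epsilon> j \<omega>) = 0" using ij mean by simp
    then show ?thesis using E[OF ij(1,2)] by simp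
  qed
  show "expectation (\<lambda>\<omega>. (\<epsilon> i \<omega> * inner (x i \<omega>) a)\<^sup>2) \<le> cov_form a a * v" if i: "i \<ge> 1" for i
    using E[OF i i] x2(2)[OF i] var[OF i] mean[OF i] by (simp add: power2_eq_square)
qed

text \<open>An Egorov-type argument: slowing down the growth of \<open>m\<close> makes the exceptional probabilities summable.\<close>

lemma (in prob_space) diagonal_eventually:
  fixes A :: "nat \<Rightarrow> nat \<Rightarrow> 'a set"
  assumes A [measurable]: "\<And>d n. A d n \<in> events"
    and ae: "\<And>d. d \<ge> 1 \<Longrightarrow> AE \<omega> in M. \<forall>\<^sub>F n in sequentially. \<omega> \<in> A d n"
  obtains m :: "nat \<Rightarrow> nat" where "\<And>n. n \<ge> 1 \<Longrightarrow> 1 \<le> m n" "filterlim m at_top sequentially"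
    "AE \<omega> in M. \<forall>\<^sub>F n in sequentially. \<omega> \<in> A (m n) n"
proof -
  \<comment> \<open>For fixed \<open>d\<close> these events increase in \<open>N\<close> to one of
    full probability, so some \<open>N d\<close> leaves out less than
    \<open>(1/2)^d\<close>.\<close>
  define B where "B d N = (\<Inter>n\<in>{N..}. A d n)" for d N
  have B [measurable]: "B d N \<in> events" for d N
    unfolding B_def by (intro sets.countable_INT) auto
  have "\<exists>N. 1 - (1/2)^d < prob (B d N)" if d: "d \<ge> 1" for d
  proof -
    have "incseq (B d)" unfolding B_def incseq_def by (intro allI impI INF_superset_mono) auto
    then have "(\<lambda>N. prob (B d N)) \<longlonglongrightarrow> prob (\<Union>N. B d N)"
      by (intro finite_Lim_measure_incseq) auto
    moreover have "prob (\<Union>N. B d N) = 1"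
    proof (rule prob_eq_1[THEN iffD2])
      show "AE \<omega> in M. \<omega> \<in> (\<Union>N. B d N)"
        using ae[OF d] by eventually_elim (auto simp: eventually_sequentially B_def)
    qed measurable
    ultimately have "\<forall>\<^sub>F N in sequentially. 1 - (1/2)^d < prob (B d N)"
      by (intro order_tendstoD(1)) auto
    then show ?thesis by (auto simp: eventually_sequentially)
  qed
  then obtain N where N: "\<And>d. d \<ge> 1 \<Longrightarrow> 1 - (1/2)^d < prob (B d (N d))" by metis
  define C where "C d = (if d = 0 then {} else space M - B d (N d))" for d
  have C [measurable]: "C d \<in> events" for d by (simp add: C_def)
  have bc: "AE \<omega> in M. \<forall>\<^sub>F d in sequentially. \<omega> \<in> space M - C d"
  proof (rule borel_cantelli_AE1)
    have "prob (C d) \<le> (1/2)^d" for d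
      using N[of d] prob_compl[of "B d (N d)"] by (cases "d = 0") (auto simp: C_def)
    then show "summable (\<lambda>d. prob (C d))"
      by (intro summable_comparison_test'[OF summable_geometric[of "1/2 :: real"]]) auto
  qed (simp_all add: less_top[symmetric])
  \<comment> \<open>\<open>m\<close> moves on to a new \<open>d\<close> only when \<open>n\<close>
    has passed \<open>N d\<close>, so \<open>B d (N d)\<close> already applies.\<close>
  obtain m where m: "\<And>n. n \<ge> 1 \<Longrightarrow> 1 \<le> m n \<and> m n \<le> n" "filterlim m at_top sequentially"
    "\<forall>\<^sub>F n in sequentially. N (m n) \<le> n"
    using diagonal_selection[of "\<lambda>d n. N d \<le> n"] eventually_ge_at_top by blast
  have "AE \<omega> in M. \<forall>\<^sub>F n in sequentially. \<omega> \<in> A (m n) n"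
    using bc
  proof eventually_elim
    case (elim \<omega>)
    have "\<forall>\<^sub>F n in sequentially. \<omega> \<in> space M - C (m n)"
      using elim m(2) by (rule eventually_compose_filterlim)
    then show ?case
      using m(3) eventually_ge_at_top[of 1]
    proof eventually_elim
      case (elim n)
      then show ?case using m(1)[of n] by (auto simp: C_def B_def split: if_splits)
    qed
  qed
  with m that show ?thesis by blast
qed

section \<open>Truncated expansions along nested spaces\<close>

locale nested_kl = centred_element M X
  for M :: "'w measure" and X :: "'w \<Rightarrow> 'a :: {real_inner, banach, second_countable_topology}" +
  fixes D :: "nat \<Rightarrow> 'a set" and \<psi> :: "nat \<Rightarrow> nat \<Rightarrow> 'a"
  assumes D_Suc: "\<And>d. d \<ge> 1 \<Longrightarrow> D d \<subseteq> D (Suc d)"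
    and kl: "\<And>d. d \<ge> 1 \<Longrightarrow> kl_basis M X (D d) d (\<psi> d)"
    and Dinf_S: "closure (\<Union>d\<in>{1..}. D d) \<subseteq> S"
begin

section \<open>The closed union of the nested spaces and expansions in it\<close>

definition Dinf :: "'a set" where
  "Dinf = closure (\<Union>d\<in>{1..}. D d)"

lemma Dinf_subset_S: "Dinf \<subseteq> S"
  unfolding Dinf_def by (rule Dinf_S)

lemma D_mono:
  assumes "1 \<le> d" "d \<le> d'"
  shows "D d \<subseteq> D d'"
  using assms(2)
proof (induction d' rule: dec_induct)
  case (step n)
  then show ?case using D_Suc[of n] assms(1) by (meson order_trans)
qed simp

lemma subspace_D: "d \<ge> 1 \<Longrightarrow> subspace (D d)"
  by (rule kl_subspace[OF kl])

lemma D_subset_Dinf: "d \<ge> 1 \<Longrightarrow> D d \<subseteq> Dinf"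
  unfolding Dinf_def using closure_subset[of "\<Union>d\<in>{1..}. D d"] by force

lemma D_subset_S: "d \<ge> 1 \<Longrightarrow> D d \<subseteq> S"
  using D_subset_Dinf Dinf_subset_S by blast

lemma subspace_UN_D: "subspace (\<Union>d\<in>{1..}. D d)"
  unfolding subspace_def
proof (intro conjI ballI allI)
  show "0 \<in> (\<Union>d\<in>{1..}. D d)"
    using subspace_0[OF subspace_D[OF order_refl]] by blast
  fix a b assume "a \<in> (\<Union>d\<in>{1..}. D d)" "b \<in> (\<Union>d\<in>{1..}. D d)"
  then obtain i j where ij: "i \<ge> 1" "a \<in> D i" "j \<ge> 1" "b \<in> D j" by auto
  then have "a \<in> D (max i j)" "b \<in> D (max i j)"
    using D_mono[of i "max i j"] D_mono[of j "max i j"] by auto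
  then have "a + b \<in> D (max i j)" using ij by (intro subspace_add subspace_D) auto
  then show "a + b \<in> (\<Union>d\<in>{1..}. D d)" using ij by auto
next
  fix c :: real and a assume "a \<in> (\<Union>d\<in>{1..}. D d)"
  then show "c *\<^sub>R a \<in> (\<Union>d\<in>{1..}. D d)" using subspace_scale[OF subspace_D] by blast
qed

lemma subspace_Dinf: "subspace Dinf" and closed_Dinf: "closed Dinf"
  unfolding Dinf_def by (simp_all add: subspace_closure subspace_UN_D)

text \<open>An approximating vector from some \<open>D m\<close> is fixed by all later projections,
  so the error is at most twice the distance to it.\<close>

lemma proj_tendsto:
  assumes u: "u \<in> Dinf"
  shows "(\<lambda>d. norm (u - basis_trunc (\<psi> d) d u)) \<longlonglongrightarrow> 0"
proof (rule LIMSEQ_I)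
  fix e :: real assume "e > 0"
  then obtain v where v: "v \<in> (\<Union>d\<in>{1..}. D d)" "dist v u < e / 2"
    using u unfolding Dinf_def closure_approachable by (meson half_gt_zero)
  then obtain m where m: "m \<ge> 1" "v \<in> D m" by auto
  have "norm (norm (u - basis_trunc (\<psi> d) d u) - 0) < e" if "d \<ge> m" for d
  proof -
    have d: "d \<ge> 1" using m that by simp
    have "v \<in> D d" using D_mono[OF m(1) that] m(2) by blast
    then have "basis_trunc (\<psi> d) d v = v"
      using basis_trunc_eq_self[OF kl_orthonormal[OF kl[OF d]], of v] kl_span[OF kl[OF d]] by simp
    then have "u - basis_trunc (\<psi> d) d u = (u - v) - basis_trunc (\<psi> d) d (u - v)"
      by (simp add: basis_trunc_diff)
    also have "norm \<dots> \<le> norm (u - v) + norm (u - v)"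
      using norm_basis_trunc_le[OF kl_orthonormal[OF kl[OF d]], of "u - v"]
        norm_triangle_ineq4[of "u - v" "basis_trunc (\<psi> d) d (u - v)"] by linarith
    finally show ?thesis using v(2) by (simp add: dist_norm norm_minus_commute)
  qed
  then show "\<exists>no. \<forall>d\<ge>no. norm (norm (u - basis_trunc (\<psi> d) d u) - 0) < e" by blast
qed

text \<open>The covariance operator compressed to \<open>Dinf\<close> is injective, so its range is dense.\<close>

lemma approx_by_cov_map:
  assumes u: "u \<in> Dinf" and e: "e > 0"
  obtains m w q where "m \<ge> 1" "w \<in> D m" "q \<in> orthogonal_comp Dinf" "norm (u - cov_map w - q) < e"
proof -
  define W where "W = (\<Union>d\<in>{1..}. D d)"
  \<comment> \<open>The complement is added because \<open>cov_map w\<close> may leave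
    \<open>Dinf\<close>; density of \<open>R\<close> is then a statement about its compression to
    \<open>Dinf\<close>.\<close>
  define R where "R = {cov_map w + q | w q. w \<in> W \<and> q \<in> orthogonal_comp Dinf}"
  have W: "subspace W" unfolding W_def by (rule subspace_UN_D)
  have R: "subspace R"
    unfolding subspace_def
  proof (intro conjI ballI allI)
    show "0 \<in> R" unfolding R_def
      using linear_0[OF linear_cov_map] subspace_0[OF W] subspace_0[OF subspace_orthogonal_comp] by force
    fix a b assume "a \<in> R" "b \<in> R"
    then obtain w q w' q' where *: "a = cov_map w + q" "b = cov_map w' + q'" "w \<in> W" "w' \<in> W"
      "q \<in> orthogonal_comp Dinf" "q' \<in> orthogonal_comp Dinf" unfolding R_def by blast
    then have "a + b = cov_map (w + w') + (q + q')" "w + w' \<in> W" "q + q' \<in> orthogonal_comp Dinf"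
      by (auto simp: linear_add[OF linear_cov_map] subspace_add[OF W] subspace_add[OF subspace_orthogonal_comp])
    then show "a + b \<in> R" unfolding R_def by blast
  next
    fix c :: real and a assume "a \<in> R"
    then obtain w q where *: "a = cov_map w + q" "w \<in> W" "q \<in> orthogonal_comp Dinf" unfolding R_def by blast
    then have "c *\<^sub>R a = cov_map (c *\<^sub>R w) + c *\<^sub>R q" "c *\<^sub>R w \<in> W" "c *\<^sub>R q \<in> orthogonal_comp Dinf"
      by (auto simp: linear_scale[OF linear_cov_map] subspace_scale[OF W] scaleR_add_right
          subspace_scale[OF subspace_orthogonal_comp])
    then show "c *\<^sub>R a \<in> R" unfolding R_def by blast
  qed
  obtain p where p: "p \<in> closure R" and orth: "\<And>v. v \<in> closure R \<Longrightarrow> orthogonal (u - p) v"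
    using projection_exists[OF subspace_closure[OF R] closed_closure] by blast
  define r where "r = u - p"
  have orthR: "inner r (cov_map w + q) = 0" if "w \<in> W" "q \<in> orthogonal_comp Dinf" for w q
  proof -
    have "cov_map w + q \<in> closure R"
      using that closure_subset[of R] unfolding R_def by blast
    then show ?thesis using orth by (auto simp: r_def orthogonal_def)
  qed
  \<comment> \<open>The residual \<open>r\<close> lies in \<open>Dinf\<close>: its own residual
    \<open>r - r'\<close> belongs to the complement and is orthogonal to both \<open>r\<close> and
    \<open>r'\<close>, hence zero.\<close>
  obtain r' where r': "r' \<in> Dinf" "\<And>v. v \<in> Dinf \<Longrightarrow> orthogonal (r - r') v"
    using projection_exists[OF subspace_Dinf closed_Dinf] by blast
  have "r - r' \<in> orthogonal_comp Dinf"
    using r'(2) by (auto simp: orthogonal_comp_def orthogonal_commute)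
  then have "inner r (r - r') = 0"
    using orthR[of 0 "r - r'"] subspace_0[OF W] linear_0[OF linear_cov_map] by simp
  moreover have "inner r' (r - r') = 0" using r' by (simp add: orthogonal_def inner_commute)
  ultimately have "inner (r - r') (r - r') = 0" by (simp add: inner_diff_left)
  then have r_Dinf: "r \<in> Dinf" using r'(1) by simp
  have cov0: "cov_form r w = 0" if "w \<in> W" for w
    using orthR[OF that subspace_0[OF subspace_orthogonal_comp]]
    by (simp add: inner_commute[of r] inner_cov_map cov_form_commute)
  \<comment> \<open>Orthogonality is known on the union only; the closed kernel extends it to
    \<open>Dinf\<close>, where \<open>w = r\<close> may be taken.\<close>
  have "Dinf \<subseteq> {w. inner (cov_map r) w = 0}"
    unfolding Dinf_def W_def[symmetric]
  proof (rule closure_minimal)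
    show "closed {w. inner (cov_map r) w = 0}" by (intro closed_Collect_eq continuous_intros)
  qed (auto simp: inner_cov_map cov0)
  then have "cov_form r r = 0" using r_Dinf by (auto simp: inner_cov_map)
  then have "r = 0" using cov_form_definite r_Dinf Dinf_subset_S by blast
  then have "u \<in> closure R" using p by (simp add: r_def)
  then obtain z where "z \<in> R" "dist z u < e" using e unfolding closure_approachable by blast
  then obtain w q where "w \<in> W" "q \<in> orthogonal_comp Dinf" "norm (u - (cov_map w + q)) < e"
    unfolding R_def by (auto simp: dist_norm norm_minus_commute)
  moreover then obtain m where "m \<ge> 1" "w \<in> D m" by (auto simp: W_def)
  ultimately show ?thesis using that by (simp add: diff_diff_eq)
qed

lemma basis_trunc_tendsto:
  assumes u: "u \<in> Dinf" and k_le: "\<And>d. d \<ge> 1 \<Longrightarrow> 1 \<le> k d \<and> k d \<le> d"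
    and k_top: "filterlim k at_top sequentially"
  shows "(\<lambda>d. basis_trunc (\<psi> d) (k d) u) \<longlonglongrightarrow> u"
proof (rule metric_LIMSEQ_I)
  fix e :: real assume e: "e > 0"
  \<comment> \<open>A difference of two truncations at most doubles a norm, so \<open>e / 8\<close>
    costs \<open>e / 4\<close>. The projection error and the tail of \<open>cov_map w\<close> cost
    \<open>e / 4\<close> each.\<close>
  obtain m w q where m: "m \<ge> 1" and w: "w \<in> D m" and q: "q \<in> orthogonal_comp Dinf"
    and close: "norm (u - cov_map w - q) < e / 8"
    using approx_by_cov_map[OF u, of "e / 8"] e by auto
  \<comment> \<open>The condition \<open>total_var / real (k d) * norm w \<le> e / 4\<close>, solved
    for \<open>k d\<close>.\<close>
  have "\<forall>\<^sub>F d in sequentially. 4 * (total_var * norm w) / e < real (k d)"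
    using filterlim_compose[OF filterlim_real_sequentially k_top] by (simp add: filterlim_at_top_dense)
  moreover have "\<forall>\<^sub>F d in sequentially. norm (u - basis_trunc (\<psi> d) d u) < e / 4"
    using order_tendstoD(2)[OF proj_tendsto[OF u], of "e / 4"] e by simp
  ultimately have "\<forall>\<^sub>F d in sequentially. dist (basis_trunc (\<psi> d) (k d) u) u < e"
    using eventually_ge_at_top[of m]
  proof eventually_elim
    case (elim d)
    have d: "d \<ge> 1" using m elim by simp
    define T where "T b = basis_trunc (\<psi> d) d b - basis_trunc (\<psi> d) (k d) b" for b
    have k: "k d \<in> {1..d}" using k_le[OF d] by simp
    have Tq: "T q = 0"
    proof -
      have "inner q (\<psi> d i) = 0" if "i \<in> {1..d}" for i
        using orthogonal_compD[OF q, of "\<psi> d i"] kl_in[OF kl[OF d] that] D_subset_Dinf[OF d]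
        by (auto simp: inner_commute)
      then show ?thesis using k by (simp add: T_def basis_trunc_def)
    qed
    have "w \<in> D d" using w D_mono[OF m elim(3)] by blast
    then have "norm (T (cov_map w)) \<le> total_var / real (k d) * norm w"
      unfolding T_def by (rule norm_cov_map_tail_le[OF kl[OF d] _ k])
    also have "\<dots> \<le> e / 4"
      using elim(1) e k by (simp add: field_simps)
    finally have 1: "norm (T (cov_map w)) \<le> e / 4" .
    have 2: "norm (T (u - cov_map w - q)) \<le> 2 * norm (u - cov_map w - q)"
      unfolding T_def using k by (intro norm_basis_trunc_diff_le[OF kl[OF d]]) simp
    have eq: "u - basis_trunc (\<psi> d) (k d) u = (u - basis_trunc (\<psi> d) d u) + (T (u - cov_map w - q) + T (cov_map w) + T q)"
      by (simp add: T_def basis_trunc_diff)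
    have "norm (u - basis_trunc (\<psi> d) (k d) u) \<le>
        norm (u - basis_trunc (\<psi> d) d u) + (norm (T (u - cov_map w - q)) + norm (T (cov_map w)))"
      unfolding eq Tq add_0_right
      by (rule order_trans[OF norm_triangle_ineq add_left_mono[OF norm_triangle_ineq]])
    also have "\<dots> < e" using 1 2 elim(2) close e by linarith
    finally show ?case by (simp add: dist_norm norm_minus_commute)
  qed
  then show "\<exists>no. \<forall>d\<ge>no. dist (basis_trunc (\<psi> d) (k d) u) u < e"
    by (simp add: eventually_sequentially)
qed

text \<open>The solution in \<open>D d\<close> of the population normal equations, which are
  diagonal in the Karhunen--Loeve basis: the limit of the untruncated estimator.\<close>

definition population_coeffs :: "nat \<Rightarrow> 'a \<Rightarrow> 'a" where
  "population_coeffs d \<beta> = (\<Sum>i=1..d. (cov_form \<beta> (\<psi> d i) / cov_form (\<psi> d i) (\<psi> d i)) *\<^sub>R \<psi> d i)"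

text \<open>The residual of \<open>u\<close> lies in \<open>S\<close> and is orthogonal to
  \<open>D d\<close>; \<open>v\<close> is orthogonal to all of \<open>S\<close> and contributes
  nothing.\<close>

lemma orth_proj_complement:
  assumes d: "d \<ge> 1" and u: "u \<in> S" and v: "v \<in> orthogonal_comp S"
  shows "orth_proj (S \<inter> orthogonal_comp (D d)) (u + v) = u - basis_trunc (\<psi> d) d u"
proof (rule orth_proj_eqI)
  note on = kl_orthonormal[OF kl[OF d]] and sp = kl_span[OF kl[OF d]]
  show "subspace (S \<inter> orthogonal_comp (D d))"
    by (rule subspace_inter[OF subspace_S subspace_orthogonal_comp])
  have "basis_trunc (\<psi> d) d u \<in> D d" by (rule kl_basis_trunc_in[OF kl[OF d] order_refl])
  then have "u - basis_trunc (\<psi> d) d u \<in> S"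
    using D_subset_S[OF d] u by (intro subspace_diff[OF subspace_S]) auto
  moreover have "u - basis_trunc (\<psi> d) d u \<in> orthogonal_comp (D d)"
    using orthogonal_diff_basis_trunc[OF on] by (auto simp: orthogonal_comp_def sp orthogonal_commute)
  ultimately show "u - basis_trunc (\<psi> d) d u \<in> S \<inter> orthogonal_comp (D d)" by blast
  fix z assume z: "z \<in> S \<inter> orthogonal_comp (D d)"
  then have "inner v z = 0" using orthogonal_compD[OF v, of z] by (simp add: inner_commute)
  moreover have "inner (basis_trunc (\<psi> d) d u) z = 0"
    using z orthogonal_compD kl_basis_trunc_in[OF kl[OF d] order_refl] by blast
  ultimately show "orthogonal (u + v - (u - basis_trunc (\<psi> d) d u)) z"
    by (simp add: orthogonal_def inner_add_left inner_diff_left)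
qed

lemma asymptotic_bias_eq:
  assumes d: "d \<ge> 1" and u: "u \<in> S" and v: "v \<in> orthogonal_comp S"
  shows "asymptotic_bias M X (S \<inter> orthogonal_comp (D d)) d (\<psi> d) (u + v)
    = (\<Sum>i=1..d. (cov_form (u - basis_trunc (\<psi> d) d u) (\<psi> d i) / cov_form (\<psi> d i) (\<psi> d i)) *\<^sub>R \<psi> d i)"
  unfolding asymptotic_bias_def orth_proj_complement[OF assms] covariance_inner variance_inner
  by (simp add: cov_form_commute)

text \<open>Split \<open>u\<close> into its projection on \<open>D d\<close> and the residual. The
  projection reproduces its own coefficients by diagonality, the residual gives the bias, and
  \<open>v\<close> is uncorrelated with everything.\<close>

lemma population_coeffs_eq:
  assumes d: "d \<ge> 1" and u: "u \<in> S" and v: "v \<in> orthogonal_comp S"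
  shows "population_coeffs d (u + v) =
    basis_trunc (\<psi> d) d u + asymptotic_bias M X (S \<inter> orthogonal_comp (D d)) d (\<psi> d) (u + v)"
proof -
  let ?P = "basis_trunc (\<psi> d) d u"
  note on = kl_orthonormal[OF kl[OF d]]
  have "cov_form (u + v) (\<psi> d i) / cov_form (\<psi> d i) (\<psi> d i) =
      inner u (\<psi> d i) + cov_form (u - ?P) (\<psi> d i) / cov_form (\<psi> d i) (\<psi> d i)" if i: "i \<in> {1..d}" for i
  proof -
    have "cov_form (u + v) (\<psi> d i) = cov_form ?P (\<psi> d i) + cov_form (u - ?P) (\<psi> d i)"
      using cov_form_orthogonal_S[OF v] by (simp add: linear_add[OF linear_cov_form] cov_form_diff_left)
    also have "cov_form ?P (\<psi> d i) = cov_form (\<psi> d i) (\<psi> d i) * inner u (\<psi> d i)"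
      using cov_form_kl_left[OF kl[OF d] kl_basis_trunc_in[OF kl[OF d] order_refl] i]
        inner_basis_trunc_basis[OF on i] by simp
    finally show ?thesis
      using kl_eigenvalue_pos[OF kl[OF d] D_subset_S[OF d] i] by (simp add: add_divide_distrib)
  qed
  then show ?thesis
    unfolding asymptotic_bias_eq[OF assms] population_coeffs_def basis_trunc_def[of _ _ u]
    by (simp add: sum.distrib[symmetric] scaleR_add_left[symmetric])
qed

text \<open>For fixed \<open>k\<close> a crude sum of \<open>k\<close> equal bounds suffices; the
  denominator \<open>\<mu>\<close> belongs to \<open>D k\<close> and does not move with
  \<open>d\<close>.\<close>

lemma bias_trunc_tendsto:
  assumes u: "u \<in> Dinf" and v: "v \<in> orthogonal_comp S" and k: "k \<ge> 1"
  shows "(\<lambda>d. norm (basis_trunc (\<psi> d) k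
    (asymptotic_bias M X (S \<inter> orthogonal_comp (D d)) d (\<psi> d) (u + v)))) \<longlonglongrightarrow> 0"
proof -
  define \<mu> where "\<mu> = cov_form (\<psi> k k) (\<psi> k k)"
  have \<mu>: "\<mu> > 0" unfolding \<mu>_def using k by (intro kl_eigenvalue_pos[OF kl] D_subset_S) auto
  define w where "w d = u - basis_trunc (\<psi> d) d u" for d
  have uS: "u \<in> S" using u Dinf_subset_S by blast
  have bound: "norm (basis_trunc (\<psi> d) k (asymptotic_bias M X (S \<inter> orthogonal_comp (D d)) d (\<psi> d) (u + v)))
      \<le> real k * (total_var * norm (w d) / \<mu>)" if "d \<ge> k" for d
  proof -
    have d: "d \<ge> 1" using k that by simp
    note on = kl_orthonormal[OF kl[OF d]]
    define \<delta> where "\<delta> i = cov_form (w d) (\<psi> d i) / cov_form (\<psi> d i) (\<psi> d i)" for i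
    have nm: "norm (\<psi> d i) = 1" if "i \<in> {1..d}" for i
      using orthonormal_uptoD[OF on that that] by (simp add: norm_eq_sqrt_inner)
    have "basis_trunc (\<psi> d) k (asymptotic_bias M X (S \<inter> orthogonal_comp (D d)) d (\<psi> d) (u + v))
        = (\<Sum>i=1..k. \<delta> i *\<^sub>R \<psi> d i)"
      unfolding asymptotic_bias_eq[OF d uS v] basis_trunc_def[of _ k] w_def[symmetric] \<delta>_def[symmetric]
      using that by (intro sum.cong refl) (simp add: inner_sum_basis[OF on])
    also have "norm \<dots> \<le> (\<Sum>i=1..k. total_var * norm (w d) / \<mu>)"
    proof (rule sum_norm_le)
      fix i assume i: "i \<in> {1..k}"
      then have id: "i \<in> {1..d}" using that by simp
      have "\<mu> \<le> cov_form (\<psi> d k) (\<psi> d k)"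
        unfolding \<mu>_def using k that by (intro kl_eigenvalue_mono[OF kl kl D_mono]) auto
      also have "\<dots> \<le> cov_form (\<psi> d i) (\<psi> d i)"
        using i that k by (intro kl_antimono[OF kl[OF d]]) auto
      finally have le: "\<mu> \<le> cov_form (\<psi> d i) (\<psi> d i)" .
      have "\<bar>cov_form (w d) (\<psi> d i)\<bar> / cov_form (\<psi> d i) (\<psi> d i) \<le> total_var * norm (w d) / \<mu>"
        using abs_cov_form_le[of "w d" "\<psi> d i"] \<mu> le by (intro frac_le) (auto simp: nm[OF id])
      then show "norm (\<delta> i *\<^sub>R \<psi> d i) \<le> total_var * norm (w d) / \<mu>"
        using \<mu> le by (simp add: \<delta>_def nm[OF id])
    qed
    finally show ?thesis by simp
  qed
  have "(\<lambda>d. real k * (total_var * norm (w d) / \<mu>)) \<longlonglongrightarrow> real k * (total_var * 0 / \<mu>)"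
    unfolding w_def using \<mu> by (intro tendsto_intros proj_tendsto u) auto
  then have lim: "(\<lambda>d. real k * (total_var * norm (w d) / \<mu>)) \<longlonglongrightarrow> 0" by simp
  show ?thesis
  proof (rule tendsto_sandwich[OF _ _ tendsto_const lim])
    show "\<forall>\<^sub>F d in sequentially. norm (basis_trunc (\<psi> d) k
        (asymptotic_bias M X (S \<inter> orthogonal_comp (D d)) d (\<psi> d) (u + v))) \<le> real k * (total_var * norm (w d) / \<mu>)"
      using eventually_ge_at_top[of k] by eventually_elim (rule bound)
  qed simp
qed

end

section \<open>The regression theorem\<close>

text \<open>Needed for the projection on \<open>Sperp\<close> to be determined. Since elements are
  classes, the operations are compared through representatives almost everywhere.\<close>

lemma subspace_L2_on: "subspace (L2_on T)"
  unfolding subspace_def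
proof (intro conjI ballI allI)
  have "AE t in lborel. rep_L2 0 t = 0"
    using rep_abs_L2[OF square_integrable_zero] by (simp add: zero_L2_def)
  then show "0 \<in> L2_on T" unfolding L2_on_def by auto
  fix f g assume f: "f \<in> L2_on T" and g: "g \<in> L2_on T"
  have "f + g = abs_L2 (\<lambda>t. rep_L2 f t + rep_L2 g t)"
    using plus_abs_L2[OF square_integrable_rep square_integrable_rep, of f g] by (simp add: abs_rep_L2)
  then have "AE t in lborel. rep_L2 (f + g) t = rep_L2 f t + rep_L2 g t"
    using rep_abs_L2[OF square_integrable_add[OF square_integrable_rep square_integrable_rep]] by simp
  then show "f + g \<in> L2_on T"
    using f g unfolding L2_on_def by (auto elim: eventually_elim2)
next
  fix c f assume f: "f \<in> L2_on T"
  have "c *\<^sub>R f = abs_L2 (\<lambda>t. c * rep_L2 f t)"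
    using scaleR_abs_L2[OF square_integrable_rep, of c f] by (simp add: abs_rep_L2)
  then have "AE t in lborel. rep_L2 (c *\<^sub>R f) t = c * rep_L2 f t"
    using rep_abs_L2[OF square_integrable_scale[OF square_integrable_rep]] by simp
  then show "c *\<^sub>R f \<in> L2_on T"
    using f unfolding L2_on_def by auto
qed

text \<open>The ambient type is the space over the whole line, hence the intersection with
  \<open>L2_on T\<close> in \<open>Sperp\<close>. As \<open>least_square\<close> is a definite
  description, \<open>well_defined\<close> accompanies the almost sure limits of the estimator. The
  sequence \<open>m\<close> plays the role of the dimensions chosen along the sample size.\<close>

theorem mainTheorem5:
  fixes T :: "real set"
    and M :: "'w measure"
    and X :: "'w \<Rightarrow> L2"
    and x :: "nat \<Rightarrow> 'w \<Rightarrow> L2"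
    and \<epsilon> y :: "nat \<Rightarrow> 'w \<Rightarrow> real"
    and \<beta> :: L2
    and \<sigma> :: real
    and D :: "nat \<Rightarrow> L2 set"
    and \<psi> :: "nat \<Rightarrow> nat \<Rightarrow> L2"
  defines "S \<equiv> closed_span (law_support M X)"
    and "Sperp \<equiv> orthogonal_comp (closed_span (law_support M X)) \<inter> L2_on T"
    and "Dinf \<equiv> closure (\<Union>d\<in>{1..}. D d)"
    and "\<beta>t \<equiv> \<lambda>d k n \<omega>. basis_trunc (\<psi> d) k (least_square (D d) (\<lambda>i. x i \<omega>) (\<lambda>i. y i \<omega>) n)"
    and "well_defined \<equiv> \<lambda>d n \<omega>. \<exists>!b. is_least_square (D d) (\<lambda>i. x i \<omega>) (\<lambda>i. y i \<omega>) n b"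
    and "\<gamma> \<equiv> \<lambda>d. asymptotic_bias M X
                (closed_span (law_support M X) \<inter> orthogonal_comp (D d)) d (\<psi> d) \<beta>"
  assumes "compact T"
    and "prob_space M"
    and "\<beta> \<in> L2_on T"
    and "X \<in> borel_measurable M"
    and "\<And>\<omega>. \<omega> \<in> space M \<Longrightarrow> X \<omega> \<in> L2_on T"
    and "integrable M (\<lambda>\<omega>. (norm (X \<omega>))\<^sup>2)"
    and "(LINT \<omega>|M. X \<omega>) = 0"
    and "\<And>i \<omega>. i \<ge> 1 \<Longrightarrow> \<omega> \<in> space M \<Longrightarrow> x i \<omega> \<in> L2_on T"
    and "prob_space.indep_vars M (\<lambda>_. borel) x {1..}"
    and "\<And>i. i \<ge> 1 \<Longrightarrow> distr M borel (x i) = distr M borel X"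
    and "prob_space.indep_vars M (\<lambda>_. borel) \<epsilon> {1..}"
    and "indep_elements M
           (PiM {1..} (\<lambda>_. borel)) (\<lambda>\<omega>. \<lambda>i\<in>{1..}. x i \<omega>)
           (PiM {1..} (\<lambda>_. borel)) (\<lambda>\<omega>. \<lambda>i\<in>{1..}. \<epsilon> i \<omega>)"
    and "\<And>i. i \<ge> 1 \<Longrightarrow> integrable M (\<epsilon> i)"
    and "\<And>i. i \<ge> 1 \<Longrightarrow> integrable M (\<lambda>\<omega>. (\<epsilon> i \<omega>)\<^sup>2)"
    and "\<And>i. i \<ge> 1 \<Longrightarrow> (LINT \<omega>|M. \<epsilon> i \<omega>) = 0"
    and "\<And>i. i \<ge> 1 \<Longrightarrow> prob_space.variance M (\<epsilon> i) = \<sigma>\<^sup>2"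
    and "\<sigma>\<^sup>2 > 0"
    and "\<And>i \<omega>. i \<ge> 1 \<Longrightarrow> \<omega> \<in> space M \<Longrightarrow> y i \<omega> = inner (x i \<omega>) \<beta> + \<epsilon> i \<omega>"
    and "\<And>d. d \<ge> 1 \<Longrightarrow> subspace (D d)"
    and "\<And>d. d \<ge> 1 \<Longrightarrow> D d \<subseteq> L2_on T"
    and "\<And>d. d \<ge> 1 \<Longrightarrow> dim (D d) = d"
    and "\<And>d. d \<ge> 1 \<Longrightarrow> D d \<subseteq> D (Suc d)"
    and "\<And>d. d \<ge> 1 \<Longrightarrow> kl_basis M X (D d) d (\<psi> d)"
    and "\<exists>u\<in>Dinf. \<exists>v\<in>Sperp. \<beta> = u + v"
    and "Dinf \<subseteq> S"
  shows "\<exists>k :: nat \<Rightarrow> nat.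
    (\<forall>d\<ge>1. 1 \<le> k d \<and> k d \<le> d) \<and> filterlim k at_top sequentially \<and>
    (\<exists>L :: nat \<Rightarrow> L2.
       (\<forall>d\<ge>1. L d \<in> L2_on T \<and>
          (AE \<omega> in M. (\<forall>\<^sub>F n in sequentially. well_defined d n \<omega>) \<and>
             (\<lambda>n. \<beta>t d (k d) n \<omega>) \<longlonglongrightarrow> L d)) \<and>
       L \<longlonglongrightarrow> orth_proj Dinf \<beta>) \<and>
    (\<lambda>d. norm (basis_trunc (\<psi> d) (k d) (\<gamma> d))) \<longlonglongrightarrow> 0 \<and>
    (\<exists>m :: nat \<Rightarrow> nat.
       (\<forall>n\<ge>1. m n \<ge> 1) \<and>
       (AE \<omega> in M. (\<forall>\<^sub>F n in sequentially. well_defined (m n) n \<omega>) \<and>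
          (\<lambda>n. \<beta>t (m n) (k (m n)) n \<omega>) \<longlonglongrightarrow> orth_proj Dinf \<beta>) \<and>
       (AE \<omega> in M. (\<lambda>n. norm (\<beta>t (m n) (k (m n)) n \<omega> - \<beta>)) \<longlonglongrightarrow> norm (orth_proj Sperp \<beta>)) \<and>
       (\<beta> \<in> Dinf \<longrightarrow>
          (AE \<omega> in M. (\<lambda>n. norm (\<beta>t (m n) (k (m n)) n \<omega> - \<beta>)) \<longlonglongrightarrow> 0)))"
proof -
  note asms = assms(7-)
  note x_indep = asms(9) and x_dist = asms(10)
    and eps_indep = asms(11) and y_eq = asms(18)
    and D_T = asms(20) and decomp = asms(24) and sub = asms(25)
  interpret prob_space M by (rule asms(2))
  have centred: "centred_element M X"
    by unfold_locales (fact asms)+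
  interpret K: nested_kl M X D \<psi>
  proof (rule nested_kl.intro[OF centred nested_kl_axioms.intro])
    show "D d \<subseteq> D (Suc d)" "kl_basis M X (D d) d (\<psi> d)" if "d \<ge> 1" for d
      using that by (fact asms)+
    show "closure (\<Union>d\<in>{1..}. D d) \<subseteq> centred_element.S M X"
      using sub by (simp add: centred_element.S_def[OF centred] S_def Dinf_def)
  qed
  have S_eq: "closed_span (law_support M X) = K.S" by (simp add: K.S_def)
  have Dinf_eq: "Dinf = K.Dinf" by (simp add: Dinf_def K.Dinf_def)
  obtain u v where u: "u \<in> K.Dinf" and v: "v \<in> Sperp" and \<beta>: "\<beta> = u + v"
    using decomp Dinf_eq by blast
  have vS: "v \<in> orthogonal_comp K.S" using v by (simp add: Sperp_def S_eq)
  have uS: "u \<in> K.S" using u K.Dinf_subset_S by blast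
  have proj_Dinf: "orth_proj Dinf \<beta> = u"
    unfolding Dinf_eq \<beta>
    using u vS K.Dinf_subset_S orthogonal_compD[OF vS]
    by (intro orth_proj_eqI K.subspace_Dinf) (auto simp: orthogonal_def inner_commute[of v])
  have proj_Sperp: "orth_proj Sperp \<beta> = v"
    unfolding \<beta>
  proof (rule orth_proj_eqI)
    show "subspace Sperp"
      unfolding Sperp_def by (intro subspace_inter subspace_orthogonal_comp subspace_L2_on)
    show "v \<in> Sperp" by (rule v)
    fix z assume "z \<in> Sperp"
    then have "z \<in> orthogonal_comp K.S" by (simp add: Sperp_def S_eq)
    then show "orthogonal (u + v - v) z" using orthogonal_compD uS by (simp add: orthogonal_def)
  qed
  define LS where "LS d n \<omega> = least_square (D d) (\<lambda>i. x i \<omega>) (\<lambda>i. y i \<omega>) n" for d n \<omega>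
  define \<nu> where "\<nu> d i = K.cov_form (\<psi> d i) (\<psi> d i)" for d i
  define G where "G d i j n \<omega> = (\<Sum>l=1..n. inner (x l \<omega>) (\<psi> d i) * inner (x l \<omega>) (\<psi> d j)) / real n" for d i j n \<omega>
  \<comment> \<open>The empirical moment of \<open>y\<close> with the model equation substituted:
    measurability and limit come from \<open>x\<close> and \<open>\<epsilon>\<close>, and on
    \<open>space M\<close> it agrees with the moment of \<open>y\<close>.\<close>
  define C where "C d i n \<omega> = (\<Sum>l=1..n. inner (x l \<omega>) \<beta> * inner (x l \<omega>) (\<psi> d i)) / real n
    + (\<Sum>l=1..n. \<epsilon> l \<omega> * inner (x l \<omega>) (\<psi> d i)) / real n" for d i n \<omega>
  \<comment> \<open>The hypotheses of the perturbation estimate as an event, measurable so that its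
    probability can enter the diagonal argument over \<open>d\<close>.\<close>
  define good where "good \<eta> d n = {\<omega> \<in> space M.
      (\<forall>i\<in>{1..d}. \<forall>j\<in>{1..d}. \<bar>G d i j n \<omega> - (if i = j then \<nu> d i else 0)\<bar> < \<eta>) \<and>
      (\<forall>i\<in>{1..d}. \<bar>C d i n \<omega> - K.cov_form \<beta> (\<psi> d i)\<bar> < \<eta>)}" for \<eta> d n
  have x_meas: "x i \<in> borel_measurable M" if "i \<ge> 1" for i
    using x_indep that by (simp add: indep_vars_def)
  have eps_meas: "\<epsilon> i \<in> borel_measurable M" if "i \<ge> 1" for i
    using eps_indep that by (simp add: indep_vars_def)
  have xi_meas: "(\<lambda>\<omega>. inner (x i \<omega>) a) \<in> borel_measurable M" if "i \<ge> 1" for i a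
    using x_meas[OF that] by measurable
  have G_meas [measurable]: "G d i j n \<in> borel_measurable M" for d i j n
    unfolding G_def by (intro borel_measurable_divide borel_measurable_sum borel_measurable_times xi_meas) auto
  have C_meas [measurable]: "C d i n \<in> borel_measurable M" for d i n
    unfolding C_def
    by (intro borel_measurable_divide borel_measurable_sum borel_measurable_times xi_meas eps_meas
        borel_measurable_add) auto
  have good_sets: "good \<eta> d n \<in> events" for \<eta> d n
    unfolding good_def by measurable
  have good_AE: "AE \<omega> in M. \<forall>\<^sub>F n in sequentially. \<omega> \<in> good \<eta> d n" if d: "d \<ge> 1" and \<eta>: "\<eta> > 0" for \<eta> d
  proof -
    have "AE \<omega> in M. \<forall>i\<in>{1..d}. \<forall>j\<in>{1..d}. (\<lambda>n. G d i j n \<omega>) \<longlonglongrightarrow> K.cov_form (\<psi> d i) (\<psi> d j)"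
      unfolding G_def
      by (intro AE_ball_countable[THEN iffD2] ballI K.empirical_cov_form_tendsto[OF x_indep x_dist]) auto
    moreover have "AE \<omega> in M. \<forall>i\<in>{1..d}. (\<lambda>n. C d i n \<omega>) \<longlonglongrightarrow> K.cov_form \<beta> (\<psi> d i)"
    proof (intro AE_ball_countable[THEN iffD2] ballI)
      fix i
      have "AE \<omega> in M. (\<lambda>n. (\<Sum>l=1..n. inner (x l \<omega>) \<beta> * inner (x l \<omega>) (\<psi> d i)) / real n) \<longlonglongrightarrow> K.cov_form \<beta> (\<psi> d i)"
        by (rule K.empirical_cov_form_tendsto[OF x_indep x_dist])
      moreover have "AE \<omega> in M. (\<lambda>n. (\<Sum>l=1..n. \<epsilon> l \<omega> * inner (x l \<omega>) (\<psi> d i)) / real n) \<longlonglongrightarrow> 0"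
        by (rule K.noise_average_tendsto[OF x_indep x_dist eps_indep asms(12-16)])
      ultimately show "AE \<omega> in M. (\<lambda>n. C d i n \<omega>) \<longlonglongrightarrow> K.cov_form \<beta> (\<psi> d i)"
      proof eventually_elim
        case (elim \<omega>)
        from tendsto_add[OF elim] show ?case by (simp add: C_def)
      qed
    qed simp
    ultimately show ?thesis
      using AE_space
    proof eventually_elim
      case (elim \<omega>)
      have "\<forall>\<^sub>F n in sequentially. \<forall>i\<in>{1..d}. \<forall>j\<in>{1..d}. \<bar>G d i j n \<omega> - (if i = j then \<nu> d i else 0)\<bar> < \<eta>"
      proof (intro eventually_ball_finite ballI)
        fix i j assume ij: "i \<in> {1..d}" "j \<in> {1..d}"
        then have "(\<lambda>n. G d i j n \<omega>) \<longlonglongrightarrow> K.cov_form (\<psi> d i) (\<psi> d j)"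
          using elim(1) by blast
        then have "(\<lambda>n. G d i j n \<omega>) \<longlonglongrightarrow> (if i = j then \<nu> d i else 0)"
          unfolding \<nu>_def by (subst (asm) K.cov_form_kl[OF K.kl[OF d] ij])
        then show "\<forall>\<^sub>F n in sequentially. \<bar>G d i j n \<omega> - (if i = j then \<nu> d i else 0)\<bar> < \<eta>"
          using tendstoD[OF _ \<eta>] by (fastforce simp: dist_real_def)
      qed auto
      moreover have "\<forall>\<^sub>F n in sequentially. \<forall>i\<in>{1..d}. \<bar>C d i n \<omega> - K.cov_form \<beta> (\<psi> d i)\<bar> < \<eta>"
      proof (intro eventually_ball_finite ballI)
        fix i assume "i \<in> {1..d}"
        then have "(\<lambda>n. C d i n \<omega>) \<longlonglongrightarrow> K.cov_form \<beta> (\<psi> d i)" using elim(2) by blast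
        then show "\<forall>\<^sub>F n in sequentially. \<bar>C d i n \<omega> - K.cov_form \<beta> (\<psi> d i)\<bar> < \<eta>"
          using tendstoD[OF _ \<eta>] by (fastforce simp: dist_real_def)
      qed auto
      ultimately show ?case
        by eventually_elim (use elim(3) in \<open>simp add: good_def\<close>)
    qed
  qed
  define b where "b d = K.population_coeffs d \<beta>" for d
  have "\<exists>\<eta>>0. \<forall>n. \<forall>\<omega>\<in>good \<eta> d n. well_defined d n \<omega> \<and> norm (LS d n \<omega> - b d) < e"
    if d: "d \<ge> 1" and e: "e > 0" for d and e :: real
  proof -
    obtain \<eta> where \<eta>: "\<eta> > 0" and pert:
      "\<And>xs ys N. (\<And>i j. i \<in> {1..d} \<Longrightarrow> j \<in> {1..d} \<Longrightarrow>
        \<bar>(\<Sum>l=1..N. inner (xs l) (\<psi> d i) * inner (xs l) (\<psi> d j)) / real N - (if i = j then \<nu> d i else 0)\<bar> < \<eta>)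
      \<Longrightarrow> (\<And>i. i \<in> {1..d} \<Longrightarrow> \<bar>(\<Sum>l=1..N. ys l * inner (xs l) (\<psi> d i)) / real N - K.cov_form \<beta> (\<psi> d i)\<bar> < \<eta>)
      \<Longrightarrow> (\<exists>!b. is_least_square (D d) xs ys N b) \<and>
        norm (least_square (D d) xs ys N - (\<Sum>i=1..d. (K.cov_form \<beta> (\<psi> d i) / \<nu> d i) *\<^sub>R \<psi> d i)) < e"
    proof (rule least_square_perturbation[OF K.kl_orthonormal[OF K.kl[OF d]] K.kl_span[OF K.kl[OF d]] _ e,
          of "\<nu> d" "\<lambda>i. K.cov_form \<beta> (\<psi> d i)"])
      show "\<nu> d i > 0" if "i \<in> {1..d}" for i
        unfolding \<nu>_def by (rule K.kl_eigenvalue_pos[OF K.kl[OF d] K.D_subset_S[OF d] that])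
    qed blast
    have "well_defined d n \<omega> \<and> norm (LS d n \<omega> - b d) < e" if \<omega>: "\<omega> \<in> good \<eta> d n" for n \<omega>
    proof -
      have "C d i n \<omega> = (\<Sum>l=1..n. y l \<omega> * inner (x l \<omega>) (\<psi> d i)) / real n" for i
      proof -
        have "\<omega> \<in> space M" using \<omega> by (simp add: good_def)
        then have "(\<Sum>l=1..n. y l \<omega> * inner (x l \<omega>) (\<psi> d i)) =
            (\<Sum>l=1..n. inner (x l \<omega>) \<beta> * inner (x l \<omega>) (\<psi> d i) + \<epsilon> l \<omega> * inner (x l \<omega>) (\<psi> d i))"
          by (intro sum.cong refl) (simp add: y_eq distrib_right)
        then show ?thesis by (simp add: C_def sum.distrib add_divide_distrib)
      qed
      then show ?thesis
        using pert[of "\<lambda>l. x l \<omega>" n "\<lambda>l. y l \<omega>"] \<omega>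
        by (simp add: good_def G_def well_defined_def LS_def b_def K.population_coeffs_def \<nu>_def)
    qed
    with \<eta> show ?thesis by blast
  qed
  then obtain \<eta> where \<eta>: "\<And>d e. d \<ge> 1 \<Longrightarrow> e > 0 \<Longrightarrow> \<eta> d e > 0"
    and good: "\<And>d e n \<omega>. d \<ge> 1 \<Longrightarrow> e > 0 \<Longrightarrow> \<omega> \<in> good (\<eta> d e) d n \<Longrightarrow>
      well_defined d n \<omega> \<and> norm (LS d n \<omega> - b d) < e"
    by metis
  \<comment> \<open>Tying the tolerance to \<open>j\<close> makes the diagonal choice leave a bias
    below \<open>1 / real (k d)\<close>, which tends to zero.\<close>
  have bias0: "\<forall>\<^sub>F d in sequentially. norm (basis_trunc (\<psi> d) j (\<gamma> d)) < 1 / real j" if "j \<ge> 1" for j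
    using order_tendstoD(2)[OF K.bias_trunc_tendsto[OF u vS that], of "1 / real j"] that
    by (simp add: \<gamma>_def S_eq \<beta>)
  obtain k where k: "\<And>d. d \<ge> 1 \<Longrightarrow> 1 \<le> k d \<and> k d \<le> d" and k_top: "filterlim k at_top sequentially"
    and bias: "\<forall>\<^sub>F d in sequentially. norm (basis_trunc (\<psi> d) (k d) (\<gamma> d)) < 1 / real (k d)"
    using diagonal_selection[of "\<lambda>j d. norm (basis_trunc (\<psi> d) j (\<gamma> d)) < 1 / real j", OF bias0] by blast
  have inverse_0: "(\<lambda>n. 1 / real (f n)) \<longlonglongrightarrow> 0" if "filterlim f at_top sequentially" for f :: "nat \<Rightarrow> nat"
    by (rule filterlim_compose[OF lim_1_over_n that])
  have bias_lim: "(\<lambda>d. norm (basis_trunc (\<psi> d) (k d) (\<gamma> d))) \<longlonglongrightarrow> 0"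
    by (rule tendsto_sandwich[OF _ _ tendsto_const inverse_0[OF k_top]])
       (use bias in \<open>auto elim: eventually_mono\<close>)
  define L where "L d = basis_trunc (\<psi> d) (k d) (b d)" for d
  \<comment> \<open>Truncation is a contraction, so the rate for the full estimator carries over
    whatever \<open>k d\<close> is.\<close>
  have L_close: "norm (\<beta>t d (k d) n \<omega> - L d) \<le> norm (LS d n \<omega> - b d)" if d: "d \<ge> 1" for d n \<omega>
  proof -
    have "orthonormal_upto (k d) (\<psi> d)"
      using orthonormal_upto_mono[OF K.kl_orthonormal[OF K.kl[OF d]]] k[OF d] by simp
    from norm_basis_trunc_le[OF this, of "LS d n \<omega> - b d"]
    show ?thesis by (simp add: \<beta>t_def L_def LS_def basis_trunc_diff)
  qed
  have L_T: "L d \<in> L2_on T" if d: "d \<ge> 1" for d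
    using K.kl_basis_trunc_in[OF K.kl[OF d]] k[OF d] D_T[OF d] by (auto simp: L_def)
  \<comment> \<open>Because \<open>k d \<le> d\<close>, truncating the projection of
    \<open>u\<close> is the same as truncating \<open>u\<close>.\<close>
  have L_eq: "L d = basis_trunc (\<psi> d) (k d) u + basis_trunc (\<psi> d) (k d) (\<gamma> d)" if d: "d \<ge> 1" for d
    using basis_trunc_basis_trunc[OF K.kl_orthonormal[OF K.kl[OF d]], of "k d" u] k[OF d]
    by (simp add: L_def b_def \<beta> K.population_coeffs_eq[OF d uS vS] basis_trunc_add \<gamma>_def S_eq)
  have L_lim: "L \<longlonglongrightarrow> u"
  proof -
    have "(\<lambda>d. basis_trunc (\<psi> d) (k d) u + basis_trunc (\<psi> d) (k d) (\<gamma> d)) \<longlonglongrightarrow> u + 0"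
      by (intro tendsto_add K.basis_trunc_tendsto[OF u k k_top] tendsto_norm_zero_cancel[OF bias_lim])
    moreover have "\<forall>\<^sub>F d in sequentially. basis_trunc (\<psi> d) (k d) u + basis_trunc (\<psi> d) (k d) (\<gamma> d) = L d"
      using eventually_ge_at_top[of 1] by eventually_elim (simp add: L_eq)
    ultimately show ?thesis by (simp add: tendsto_cong)
  qed
  have fixed_d: "AE \<omega> in M. (\<forall>\<^sub>F n in sequentially. well_defined d n \<omega>) \<and> (\<lambda>n. \<beta>t d (k d) n \<omega>) \<longlonglongrightarrow> L d"
    if d: "d \<ge> 1" for d
  proof -
    have "AE \<omega> in M. \<forall>q. \<forall>\<^sub>F n in sequentially. \<omega> \<in> good (\<eta> d (1 / real (Suc q))) d n"
      unfolding AE_all_countable by (intro allI good_AE d \<eta>) simp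
    then show ?thesis
    proof eventually_elim
      case (elim \<omega>)
      have ev: "\<forall>\<^sub>F n in sequentially. well_defined d n \<omega> \<and> norm (LS d n \<omega> - b d) < 1 / real (Suc q)" for q
        using elim[rule_format, of q] by eventually_elim (rule good[OF d], auto)
      have "(\<lambda>n. \<beta>t d (k d) n \<omega>) \<longlonglongrightarrow> L d"
      proof (rule tendstoI)
        fix e :: real assume "e > 0"
        then obtain q where q: "1 / real (Suc q) < e" using nat_approx_posE by blast
        show "\<forall>\<^sub>F n in sequentially. dist (\<beta>t d (k d) n \<omega>) (L d) < e"
          using ev[of q]
        proof eventually_elim
          case (elim n)
          then show ?case using L_close[OF d, of n \<omega>] q by (simp add: dist_norm)
        qed
      qed
      moreover have "\<forall>\<^sub>F n in sequentially. well_defined d n \<omega>" using ev[of 0] by eventually_elim simp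
      ultimately show ?case by simp
    qed
  qed
  \<comment> \<open>The tolerance \<open>1 / real d\<close> shrinks with the dimension, so along
    \<open>m\<close> the estimator approaches the moving target \<open>L (m n)\<close>, which itself
    tends to \<open>u\<close>.\<close>
  obtain m where m1: "\<And>n. n \<ge> 1 \<Longrightarrow> 1 \<le> m n" and m_top: "filterlim m at_top sequentially"
    and m_good: "AE \<omega> in M. \<forall>\<^sub>F n in sequentially. \<omega> \<in> good (\<eta> (m n) (1 / real (m n))) (m n) n"
  proof (rule diagonal_eventually[of "\<lambda>d n. good (\<eta> d (1 / real d)) d n"])
    show "AE \<omega> in M. \<forall>\<^sub>F n in sequentially. \<omega> \<in> good (\<eta> d (1 / real d)) d n" if "d \<ge> 1" for d
      using that by (intro good_AE \<eta>) auto
  qed (use good_sets in auto)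
  have Lm: "(\<lambda>n. L (m n)) \<longlonglongrightarrow> u" by (rule filterlim_compose[OF L_lim m_top])
  have diag: "AE \<omega> in M. (\<forall>\<^sub>F n in sequentially. well_defined (m n) n \<omega>) \<and> (\<lambda>n. \<beta>t (m n) (k (m n)) n \<omega>) \<longlonglongrightarrow> u"
    using m_good
  proof eventually_elim
    case (elim \<omega>)
    have ev: "\<forall>\<^sub>F n in sequentially. well_defined (m n) n \<omega> \<and>
        norm (\<beta>t (m n) (k (m n)) n \<omega> - L (m n)) \<le> 1 / real (m n)"
      using elim eventually_ge_at_top[of 1]
    proof eventually_elim
      case (elim n)
      then show ?case
        using good[OF m1[OF elim(2)] _ elim(1)] m1[OF elim(2)] L_close[OF m1[OF elim(2)], of n \<omega>] by auto
    qed
    have "(\<lambda>n. norm (\<beta>t (m n) (k (m n)) n \<omega> - L (m n))) \<longlonglongrightarrow> 0"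
      by (rule tendsto_sandwich[OF _ _ tendsto_const inverse_0[OF m_top]])
         (use ev in \<open>auto elim: eventually_mono\<close>)
    from tendsto_add[OF tendsto_norm_zero_cancel[OF this] Lm]
    have "(\<lambda>n. \<beta>t (m n) (k (m n)) n \<omega>) \<longlonglongrightarrow> u" by simp
    moreover have "\<forall>\<^sub>F n in sequentially. well_defined (m n) n \<omega>" using ev by eventually_elim simp
    ultimately show ?case by simp
  qed
  have err: "AE \<omega> in M. (\<lambda>n. norm (\<beta>t (m n) (k (m n)) n \<omega> - \<beta>)) \<longlonglongrightarrow> norm v"
    using diag
  proof eventually_elim
    case (elim \<omega>)
    have "(\<lambda>n. norm (\<beta>t (m n) (k (m n)) n \<omega> - \<beta>)) \<longlonglongrightarrow> norm (u - \<beta>)"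
      using elim by (intro tendsto_intros) auto
    then show ?case by (simp add: \<beta>)
  qed
  have v0: "v = 0" if "\<beta> \<in> Dinf"
  proof -
    have "orth_proj Dinf \<beta> = \<beta>"
      using that unfolding Dinf_eq by (intro orth_proj_eqI K.subspace_Dinf) (auto simp: orthogonal_def)
    then show ?thesis using proj_Dinf \<beta> by simp
  qed
  have "\<forall>d\<ge>1. 1 \<le> k d \<and> k d \<le> d"
    using k by blast
  moreover have "\<forall>d\<ge>1. L d \<in> L2_on T \<and> (AE \<omega> in M. (\<forall>\<^sub>F n in sequentially. well_defined d n \<omega>) \<and>
      (\<lambda>n. \<beta>t d (k d) n \<omega>) \<longlonglongrightarrow> L d)"
    using L_T fixed_d by blast
  moreover have "\<forall>n\<ge>1. 1 \<le> m n"
    using m1 by blast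
  moreover have "\<beta> \<in> Dinf \<longrightarrow> (AE \<omega> in M. (\<lambda>n. norm (\<beta>t (m n) (k (m n)) n \<omega> - \<beta>)) \<longlonglongrightarrow> 0)"
    using err v0 by auto
  ultimately show ?thesis
    unfolding proj_Dinf proj_Sperp using k_top L_lim bias_lim diag err by blast
qed

end
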